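(* Let $d\ge1$ and let $G_d=\mathbb Z^d\dashv\mathbb Z$ be the comb graph with base $\mathbb Z^d$ and fibre $\mathbb Z$, with adjacency operator $A_{G_d}$ and exhaustion $\Lambda_n=[-n,n]^d\dashv[-n,n]$. Then $G_d$ has low energy hidden spectrum, i.e. $E_0(H)<E_m(H)$ for $H=\|A_{G_d}\|I-A_{G_d}$. In particular $$\|A_{G_d}\|=2\sqrt{d^2+1}.$$ The generalized Perron--Frobenius vector on $G_d$, obtained as the pointwise limit of Perron--Frobenius vectors on $\Lambda_n$, can be explicitly calculated.
   Context: Comb product: for graphs $G,K$ and a vertex $o\in VK$, $G\dashv(K,o)$ has vertex set $VG\times VK$, with $(g,h)\sim(g',h')$ iff ($g=g'$ and $h\sim h'$) or ($h=h'=o$ and $g\sim g'$). Here $o=0$. $[-n,n]$ is the path graph on $\{-n,\dots,n\}$ and $[-n,n]^d$ the corresponding finite subgraph of the lattice graph $\mathbb Z^d$. For a positive operator $H$ on $\ell^2(VG_d)$, $P_n$ is the projection onto $\ell^2(V\Lambda_n)$ and $H_{\Lambda_n}=P_nHP_n$ acts on $\ell^2(V\Lambda_n)$; $E_0(H)=\lim_n\min\sigma(H_{\Lambda_n})$. For $H=\|A_{G_d}\|I-A_{G_d}$, the measure $dN_H$ is determined by $\int\varphi\,dN_H=\lim_n\frac{1}{|V\Lambda_n|}\mathrm{Tr}(\varphi(H)P_n)$ for continuous $\varphi$, and $E_m(H)=\inf\mathrm{supp}(dN_H)$. The Perron--Frobenius vector of a finite connected graph is the (unique up to scale) positive eigenvector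 of its adjacency matrix $A$ with eigenvalue $\|A\|$; a generalized Perron--Frobenius vector of an infinite graph of bounded degree with adjacency operator $A$ is a (not necessarily $\ell^2$) function $v$ on the vertices with positive entries and $Av=\|A\|v$. *)

theory Defs
  imports "HOL-Analysis.Analysis" "Graph_Theory.Pair_Digraph"
begin

section \<open>Graphs\<close>

text \<open>
  An undirected simple graph is represented by a loop-free digraph with a symmetric set of arcs.
\<close>

definition induced :: "'a pair_pre_digraph \<Rightarrow> 'a set \<Rightarrow> 'a pair_pre_digraph" where
  "induced G S = \<lparr> pverts = pverts G \<inter> S, parcs = parcs G \<inter> S \<times> S \<rparr>"

definition int_graph :: "int pair_pre_digraph" where
  "int_graph = \<lparr> pverts = UNIV, parcs = {(h, h'). \<bar>h - h'\<bar> = 1} \<rparr>"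

definition lattice_graph :: "(int ^ 'd::finite) pair_pre_digraph" where
  "lattice_graph = \<lparr> pverts = UNIV, parcs = {(g, g'). (\<Sum>i\<in>UNIV. \<bar>g $ i - g' $ i\<bar>) = 1} \<rparr>"

definition int_path :: "nat \<Rightarrow> int pair_pre_digraph" where
  "int_path n = induced int_graph {- int n..int n}"

definition lattice_box :: "nat \<Rightarrow> (int ^ 'd::finite) pair_pre_digraph" where
  "lattice_box n = induced lattice_graph {g. \<forall>i. g $ i \<in> {- int n..int n}}"

definition comb_product ::
    "'a pair_pre_digraph \<Rightarrow> 'b pair_pre_digraph \<Rightarrow> 'b \<Rightarrow> ('a \<times> 'b) pair_pre_digraph" where
  "comb_product G K r =
     \<lparr> pverts = pverts G \<times> pverts K,
       parcs = {((g, h), (g', h')) | g h g' h'.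
                 g \<in> pverts G \<and> g' \<in> pverts G \<and> h \<in> pverts K \<and> h' \<in> pverts K \<and>
                 ((g = g' \<and> (h, h') \<in> parcs K) \<or> (h = r \<and> h' = r \<and> (g, g') \<in> parcs G))} \<rparr>"

section \<open>Operators on square-summable functions\<close>

text \<open>
  The space of square-summable functions on \<open>V\<close> is realised as a set of functions on the ambient
  type that vanish off \<open>V\<close>; this makes it literally a subspace of the space on any larger vertex
  set.  Operators are functions whose values matter only on that carrier.
\<close>

definition ell2 :: "'a set \<Rightarrow> ('a \<Rightarrow> complex) set" where
  "ell2 V = {f. (\<forall>x. x \<notin> V \<longrightarrow> f x = 0) \<and> (\<lambda>x. (cmod (f x))\<^sup>2) summable_on UNIV}"

definition ell2_norm :: "('a \<Rightarrow> complex) \<Rightarrow> real" where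
  "ell2_norm f = sqrt (\<Sum>\<^sub>\<infinity>x. (cmod (f x))\<^sup>2)"

type_synonym 'a operator = "('a \<Rightarrow> complex) \<Rightarrow> ('a \<Rightarrow> complex)"

definition bounded_operator :: "'a set \<Rightarrow> 'a operator \<Rightarrow> bool" where
  "bounded_operator V T \<longleftrightarrow>
     T \<in> ell2 V \<rightarrow> ell2 V \<and>
     (\<forall>f\<in>ell2 V. \<forall>g\<in>ell2 V. T (\<lambda>x. f x + g x) = (\<lambda>x. T f x + T g x)) \<and>
     (\<forall>c. \<forall>f\<in>ell2 V. T (\<lambda>x. c * f x) = (\<lambda>x. c * T f x)) \<and>
     (\<exists>C. \<forall>f\<in>ell2 V. ell2_norm (T f) \<le> C * ell2_norm f)"

definition op_norm :: "'a set \<Rightarrow> 'a operator \<Rightarrow> real" where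
  "op_norm V T = (SUP f\<in>{f \<in> ell2 V. ell2_norm f \<le> 1}. ell2_norm (T f))"

definition spectrum :: "'a set \<Rightarrow> 'a operator \<Rightarrow> complex set" where
  "spectrum V T = {z. \<not> (\<exists>S. bounded_operator V S \<and>
     (\<forall>f\<in>ell2 V. S (\<lambda>x. z * f x - T f x) = f \<and> (\<lambda>x. z * S f x - T (S f) x) = f))}"

definition proj :: "'a set \<Rightarrow> 'a operator" where
  "proj W f = (\<lambda>x. if x \<in> W then f x else 0)"

definition compression :: "'a set \<Rightarrow> 'a operator \<Rightarrow> 'a operator" where
  "compression W T = proj W \<circ> T \<circ> proj W"

definition poly_op :: "complex poly \<Rightarrow> 'a operator \<Rightarrow> 'a operator" where
  "poly_op p T f = (\<lambda>x. \<Sum>i\<le>degree p. coeff p i * (T ^^ i) f x)"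

text \<open>
  Continuous functional calculus of a bounded self-adjoint operator: the norm limit of \<open>p k\<close>
  evaluated at \<open>T\<close>, for any polynomials \<open>p k\<close> converging to \<open>\<phi>\<close> uniformly on the spectrum of \<open>T\<close>.
  Extensionality fixes the irrelevant values off the carrier, so that the description is unique.
\<close>

definition fun_calc :: "'a set \<Rightarrow> (real \<Rightarrow> complex) \<Rightarrow> 'a operator \<Rightarrow> 'a operator" where
  "fun_calc V \<phi> T = (THE S. S \<in> extensional (ell2 V) \<and> bounded_operator V S \<and>
     (\<forall>p. uniform_limit {t. complex_of_real t \<in> spectrum V T}
             (\<lambda>k t. poly (p k) (complex_of_real t)) \<phi> sequentially \<longrightarrow>
          (\<lambda>k. op_norm V (\<lambda>f x. poly_op (p k) T f x - S f x)) \<longlonglongrightarrow> 0))"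

definition trace_op :: "'a set \<Rightarrow> 'a operator \<Rightarrow> complex" where
  "trace_op V T = (\<Sum>\<^sub>\<infinity>x\<in>V. T (indicator {x}) x)"

definition adj_op :: "'a pair_pre_digraph \<Rightarrow> ('a \<Rightarrow> 'b::comm_monoid_add) \<Rightarrow> 'a \<Rightarrow> 'b" where
  "adj_op G f = (\<lambda>x. if x \<in> pverts G then \<Sum>y | (x, y) \<in> parcs G. f y else 0)"

definition adj_norm :: "'a pair_pre_digraph \<Rightarrow> real" where
  "adj_norm G = op_norm (pverts G) (adj_op G)"

definition hamiltonian :: "'a pair_pre_digraph \<Rightarrow> 'a operator" where
  "hamiltonian G f = (\<lambda>x. complex_of_real (adj_norm G) * f x - adj_op G f x)"

section \<open>Hidden spectrum\<close>

text \<open>Below, \<open>W n\<close> is the vertex set of the \<open>n\<close>-th finite graph of the exhaustion.\<close>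

definition min_spectrum :: "'a set \<Rightarrow> 'a operator \<Rightarrow> real" where
  "min_spectrum V T = Min {t. complex_of_real t \<in> spectrum V T}"

definition E_0 :: "(nat \<Rightarrow> 'a set) \<Rightarrow> 'a operator \<Rightarrow> real" where
  "E_0 W H = lim (\<lambda>n. min_spectrum (W n) (compression (W n) H))"

definition is_ids :: "'a set \<Rightarrow> (nat \<Rightarrow> 'a set) \<Rightarrow> 'a operator \<Rightarrow> real measure \<Rightarrow> bool" where
  "is_ids V W H N \<longleftrightarrow> sets N = sets borel \<and>
     (\<forall>\<phi> :: real \<Rightarrow> complex. continuous_on UNIV \<phi> \<longrightarrow>
        integrable N \<phi> \<and>
        (\<lambda>n. trace_op V (fun_calc V \<phi> H \<circ> proj (W n)) / of_nat (card (W n)))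
          \<longlonglongrightarrow> integral\<^sup>L N \<phi>)"

definition ids :: "'a set \<Rightarrow> (nat \<Rightarrow> 'a set) \<Rightarrow> 'a operator \<Rightarrow> real measure" where
  "ids V W H = (THE N. is_ids V W H N)"

definition measure_support :: "real measure \<Rightarrow> real set" where
  "measure_support N = {t. \<forall>U. open U \<longrightarrow> t \<in> U \<longrightarrow> emeasure N U > 0}"

definition E_m :: "'a set \<Rightarrow> (nat \<Rightarrow> 'a set) \<Rightarrow> 'a operator \<Rightarrow> real" where
  "E_m V W H = Inf (measure_support (ids V W H))"

definition low_energy_hidden_spectrum ::
    "'a pair_pre_digraph \<Rightarrow> (nat \<Rightarrow> 'a pair_pre_digraph) \<Rightarrow> bool" where
  "low_energy_hidden_spectrum G L \<longleftrightarrow>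
     E_0 (\<lambda>n. pverts (L n)) (hamiltonian G) < E_m (pverts G) (\<lambda>n. pverts (L n)) (hamiltonian G)"

text \<open>
  For a finite connected graph this is the Perron-Frobenius vector; for an infinite graph of
  bounded degree it is a generalized one, as no summability is required.
\<close>

definition perron_frobenius :: "'a pair_pre_digraph \<Rightarrow> ('a \<Rightarrow> real) \<Rightarrow> bool" where
  "perron_frobenius G v \<longleftrightarrow>
     (\<forall>x\<in>pverts G. v x > 0) \<and> (\<forall>x\<in>pverts G. adj_op G v x = adj_norm G * v x)"

end

theory Submission
  imports Defs
    "HOL-Computational_Algebra.Fundamental_Theorem_Algebra"
    "HOL-Probability.Levy"
    "HOL-Real_Asymp.Real_Asymp"
begin

text \<open>
  On the comb, \<open>v (g, h) = s ^ \<bar>h\<bar>\<close> with \<open>s + 1 / s = 2 * s + 2 * d\<close> is a positive eigenfunction of the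
  adjacency operator \<open>A\<close>, so by Schur's test its eigenvalue \<open>2 * sqrt (d\<^sup>2 + 1)\<close> bounds \<open>A\<close>. On a box
  the Perron-Frobenius vector separates into cosines along the base and a combination of
  \<open>q ^ \<bar>h\<bar>\<close> and \<open>q ^ (- \<bar>h\<bar>)\<close> along the fibres, with eigenvalue \<open>q + 1 / q\<close>; the equation at the base
  forces \<open>q\<close> to tend to \<open>s\<close>. Hence the norms converge to that bound, so \<open>E_0 = 0\<close>, and the vectors
  converge to \<open>v\<close>. The density of states does not see the base: a vertex at height \<open>h\<close> has the closed
  walks of length at most \<open>\<bar>h\<bar>\<close> of the integer path, and almost all vertices of a large box are high
  up. So \<open>dN\<close> is the arcsine law of the path, supported in \<open>[\<parallel>A\<parallel> - 2, \<parallel>A\<parallel> + 2]\<close>, and \<open>\<parallel>A\<parallel> > 2\<close>.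
  The functional calculus defining \<open>dN\<close> rests on the bound of \<open>\<parallel>p(H)\<parallel>\<close> by the supremum of \<open>\<bar>p\<bar>\<close> on the spectrum.
\<close>

section \<open>Square-summable functions as a Hilbert space\<close>

text \<open>The quantities of the theorem are defined through \<open>THE\<close>,
  \<open>lim\<close>, \<open>Min\<close> and \<open>Inf\<close>, which carry meaning only after
  existence is settled: spectra on finite vertex sets must be finite, functional calculus and
  density of states unique, the support nonempty. Much of the development serves this. No spectral
  theorem is assumed. The bounds on spectra and the norm bound for polynomials rest on one fact,
  that a coercive operator is invertible, together with the fundamental theorem of algebra.
  Coercivity concerns the real part of the quadratic form, so the real part of the inner product is
  enough; for complex-linear operators the imaginary part is recovered by multiplying one argument
  by \<open>\<i>\<close>. The box vectors can be written down because passing to an induced subgraph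
  amounts to the value zero just outside it: a positive solution of the comb equation inside the box
  that vanishes at its outer neighbours is a Perron-Frobenius vector of the box.\<close>

definition re_inner :: "('a \<Rightarrow> complex) \<Rightarrow> ('a \<Rightarrow> complex) \<Rightarrow> real" where
  "re_inner f g = (\<Sum>\<^sub>\<infinity>x. Re (f x * cnj (g x)))"

lemma ell2_summable: "f \<in> ell2 V \<Longrightarrow> (\<lambda>x. (cmod (f x))\<^sup>2) summable_on UNIV"
  by (simp add: ell2_def)

lemma ell2_off: "f \<in> ell2 V \<Longrightarrow> x \<notin> V \<Longrightarrow> f x = 0"
  by (simp add: ell2_def)

lemma ell2_mono: "V \<subseteq> W \<Longrightarrow> ell2 V \<subseteq> ell2 W"
  by (auto simp: ell2_def)

lemma ell2_subset_UNIV: "f \<in> ell2 V \<Longrightarrow> f \<in> ell2 UNIV"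
  by (auto simp: ell2_def)

lemma summable_on_real_comparison:
  fixes f g :: "'a \<Rightarrow> real"
  assumes "g summable_on A" "\<And>x. x \<in> A \<Longrightarrow> \<bar>f x\<bar> \<le> g x"
  shows "f summable_on A"
proof -
  have "(\<lambda>x. norm (f x)) summable_on A"
  proof (rule nonneg_bdd_above_summable_on)
    show "bdd_above (sum (\<lambda>x. norm (f x)) ` {F. F \<subseteq> A \<and> finite F})"
    proof (rule bdd_aboveI2)
      fix F assume F: "F \<in> {F. F \<subseteq> A \<and> finite F}"
      have "sum (\<lambda>x. norm (f x)) F \<le> sum g F"
        using F assms(2) by (intro sum_mono) auto
      also have "\<dots> \<le> infsum g A"
        using F assms by (intro finite_sum_le_infsum) (auto intro: order_trans[OF abs_ge_zero])
      finally show "sum (\<lambda>x. norm (f x)) F \<le> infsum g A" .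
    qed
  qed auto
  then show ?thesis
    by (rule abs_summable_summable)
qed

text \<open>Operators are estimated on finite sets of vertices; a common bound on the partial sums
  yields membership and the bound on the squared norm at once.\<close>

lemma ell2_bdd_sumI:
  assumes "\<And>x. x \<notin> V \<Longrightarrow> f x = 0"
    and "\<And>F. finite F \<Longrightarrow> (\<Sum>x\<in>F. (cmod (f x))\<^sup>2) \<le> C"
  shows "f \<in> ell2 V" "(\<Sum>\<^sub>\<infinity>x. (cmod (f x))\<^sup>2) \<le> C"
proof -
  have s: "(\<lambda>x. (cmod (f x))\<^sup>2) summable_on UNIV"
    by (rule nonneg_bdd_above_summable_on) (auto intro!: bdd_aboveI2 assms)
  show "f \<in> ell2 V"
    using s assms by (auto simp: ell2_def)
  show "(\<Sum>\<^sub>\<infinity>x. (cmod (f x))\<^sup>2) \<le> C"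
    by (rule infsum_le_finite_sums[OF s]) (use assms in auto)
qed

lemma ell2_finite_support:
  assumes "finite W" "\<And>x. x \<notin> W \<Longrightarrow> f x = 0" "W \<subseteq> V"
  shows "f \<in> ell2 V"
proof -
  have "(\<lambda>x. (cmod (f x))\<^sup>2) summable_on W"
    using assms by simp
  then have "(\<lambda>x. (cmod (f x))\<^sup>2) summable_on UNIV"
    by (subst summable_on_cong_neutral[where T = W and g = "\<lambda>x. (cmod (f x))\<^sup>2"]) (auto simp: assms)
  then show ?thesis
    using assms by (auto simp: ell2_def)
qed

lemma ell2_indicator: "x \<in> V \<Longrightarrow> indicator {x} \<in> ell2 V"
  by (rule ell2_finite_support[of "{x}"]) auto

lemma ell2_add:
  assumes "f \<in> ell2 V" "g \<in> ell2 V"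
  shows "(\<lambda>x. f x + g x) \<in> ell2 V"
proof -
  have "(\<lambda>x. 2 * (cmod (f x))\<^sup>2 + 2 * (cmod (g x))\<^sup>2) summable_on UNIV"
    by (intro summable_on_add summable_on_cmult_right ell2_summable[OF assms(1)] ell2_summable[OF assms(2)])
  moreover have "(cmod (f x + g x))\<^sup>2 \<le> 2 * (cmod (f x))\<^sup>2 + 2 * (cmod (g x))\<^sup>2" for x
  proof -
    have "(cmod (f x + g x))\<^sup>2 \<le> (cmod (f x) + cmod (g x))\<^sup>2"
      by (intro power_mono norm_triangle_ineq norm_ge_zero)
    also have "\<dots> \<le> 2 * (cmod (f x))\<^sup>2 + 2 * (cmod (g x))\<^sup>2"
      using sum_squares_bound[of "cmod (f x)" "cmod (g x)"] by (simp add: power2_sum)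
    finally show ?thesis .
  qed
  ultimately have "(\<lambda>x. (cmod (f x + g x))\<^sup>2) summable_on UNIV"
    by (elim summable_on_real_comparison) auto
  then show ?thesis
    using assms by (auto simp: ell2_def)
qed

lemma ell2_cmult:
  assumes "f \<in> ell2 V"
  shows "(\<lambda>x. c * f x) \<in> ell2 V"
  using assms summable_on_cmult_right[OF ell2_summable[OF assms], of "(cmod c)\<^sup>2"]
  by (auto simp: ell2_def norm_mult power_mult_distrib)

lemma ell2_zero [simp]: "(\<lambda>x. 0) \<in> ell2 V"
  by (simp add: ell2_def)

lemma ell2_uminus: "f \<in> ell2 V \<Longrightarrow> (\<lambda>x. - f x) \<in> ell2 V"
  using ell2_cmult[of f V "-1"] by simp

lemma ell2_diff: "f \<in> ell2 V \<Longrightarrow> g \<in> ell2 V \<Longrightarrow> (\<lambda>x. f x - g x) \<in> ell2 V"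
  using ell2_add[of f V "\<lambda>x. - g x"] ell2_uminus[of g V] by simp

lemma ell2_sum: "(\<And>i. i \<in> I \<Longrightarrow> f i \<in> ell2 V) \<Longrightarrow> (\<lambda>x. \<Sum>i\<in>I. f i x) \<in> ell2 V"
  by (induction I rule: infinite_finite_induct) (auto intro: ell2_add)

lemma re_inner_summable:
  assumes "f \<in> ell2 V" "g \<in> ell2 W"
  shows "(\<lambda>x. Re (f x * cnj (g x))) summable_on UNIV"
    and "(\<lambda>x. cmod (f x * g x)) summable_on UNIV"
proof -
  have *: "(\<lambda>x. (cmod (f x))\<^sup>2 + (cmod (g x))\<^sup>2) summable_on UNIV"
    by (intro summable_on_add ell2_summable[OF assms(1)] ell2_summable[OF assms(2)])
  have le: "cmod (f x) * cmod (g x) \<le> (cmod (f x))\<^sup>2 + (cmod (g x))\<^sup>2" for x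
    using sum_squares_bound[of "cmod (f x)" "cmod (g x)"]
      mult_nonneg_nonneg[OF norm_ge_zero[of "f x"] norm_ge_zero[of "g x"]] by linarith
  show "(\<lambda>x. cmod (f x * g x)) summable_on UNIV"
    by (rule summable_on_real_comparison[OF *]) (use le in \<open>auto simp: norm_mult\<close>)
  show "(\<lambda>x. Re (f x * cnj (g x))) summable_on UNIV"
  proof (rule summable_on_real_comparison[OF *])
    show "\<bar>Re (f x * cnj (g x))\<bar> \<le> (cmod (f x))\<^sup>2 + (cmod (g x))\<^sup>2" for x
      using le[of x] abs_Re_le_cmod[of "f x * cnj (g x)"] by (simp add: norm_mult)
  qed
qed

text \<open>Only the space on all vertices becomes a type, so that \<open>real_inner\<close>
  supplies Cauchy-Schwarz, the triangle inequality and the metric. Members of \<open>ell2 V\<close>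
  vanish off \<open>V\<close>, so each \<open>ell2 V\<close> is a subspace of it, and results are
  carried back by \<open>coord\<close> and \<open>Abs_l2\<close>.\<close>

typedef 'a l2 = "ell2 (UNIV :: 'a set)"
  morphisms coord Abs_l2
  by (rule exI[of _ "\<lambda>x. 0"]) simp

lemma coord_ell2 [simp]: "coord F \<in> ell2 UNIV"
  by (rule coord)

lemma coord_Abs_l2 [simp]: "f \<in> ell2 V \<Longrightarrow> coord (Abs_l2 f) = f"
  by (rule Abs_l2_inverse) (rule ell2_subset_UNIV)

lemma l2_eqI: "(\<And>x. coord F x = coord G x) \<Longrightarrow> F = G"
  by (metis coord_inject ext)

instantiation l2 :: (type) real_inner
begin

definition "0 = Abs_l2 (\<lambda>x. 0)"
definition "F + G = Abs_l2 (\<lambda>x. coord F x + coord G x)"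
definition "F - G = Abs_l2 (\<lambda>x. coord F x - coord G x)"
definition "- F = Abs_l2 (\<lambda>x. - coord F x)"
definition "r *\<^sub>R F = Abs_l2 (\<lambda>x. complex_of_real r * coord F x)"
definition "F \<bullet> G = re_inner (coord F) (coord G)"
definition "norm (F :: 'a l2) = sqrt (F \<bullet> F)"
definition "dist F (G :: 'a l2) = norm (F - G)"
definition "sgn (F :: 'a l2) = inverse (norm F) *\<^sub>R F"
definition "uniformity = (INF e\<in>{0<..}. principal {(F, G :: 'a l2). dist F G < e})"
definition "open (U :: 'a l2 set) \<longleftrightarrow>
  (\<forall>F\<in>U. eventually (\<lambda>(F', G). F' = F \<longrightarrow> G \<in> U) uniformity)"

lemma coord_simps [simp]:
  "coord 0 x = 0"
  "coord (F + G) x = coord F x + coord G x"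
  "coord (F - G) x = coord F x - coord G x"
  "coord (- F) x = - coord F x"
  "coord (r *\<^sub>R F) x = complex_of_real r * coord F x"
  unfolding zero_l2_def plus_l2_def minus_l2_def uminus_l2_def scaleR_l2_def
  by (auto simp: coord_Abs_l2[of _ UNIV] ell2_add ell2_diff ell2_uminus ell2_cmult)

instance
proof
  fix F G H :: "'a l2" and r s :: real
  show "F + G + H = F + (G + H)" "F + G = G + F" "0 + F = F" "- F + F = 0" "F - G = F + - G"
    "r *\<^sub>R (F + G) = r *\<^sub>R F + r *\<^sub>R G" "(r + s) *\<^sub>R F = r *\<^sub>R F + s *\<^sub>R F"
    "r *\<^sub>R s *\<^sub>R F = (r * s) *\<^sub>R F" "1 *\<^sub>R F = F"
    by (rule l2_eqI; simp add: algebra_simps)+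
  show "F \<bullet> G = G \<bullet> F"
    by (simp add: inner_l2_def re_inner_def mult.commute)
  show "(F + G) \<bullet> H = F \<bullet> H + G \<bullet> H"
    using infsum_add[OF re_inner_summable(1)[OF coord_ell2[of F] coord_ell2[of H]]
        re_inner_summable(1)[OF coord_ell2[of G] coord_ell2[of H]]]
    by (simp add: inner_l2_def re_inner_def distrib_right algebra_simps)
  show "(r *\<^sub>R F) \<bullet> G = r * (F \<bullet> G)"
  proof -
    have "(r *\<^sub>R F) \<bullet> G = (\<Sum>\<^sub>\<infinity>x. r * Re (coord F x * cnj (coord G x)))"
      unfolding inner_l2_def re_inner_def by (intro infsum_cong) (simp add: algebra_simps)
    also have "\<dots> = r * (F \<bullet> G)"
      unfolding inner_l2_def re_inner_def by (rule infsum_cmult_right')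
    finally show ?thesis .
  qed
  have sq: "Re (coord F x * cnj (coord F x)) = (cmod (coord F x))\<^sup>2" for x
    by (metis Re_complex_of_real complex_norm_square)
  show "0 \<le> F \<bullet> F"
    unfolding inner_l2_def re_inner_def by (intro infsum_nonneg) (simp add: sq)
  show "F \<bullet> F = 0 \<longleftrightarrow> F = 0"
  proof
    assume "F \<bullet> F = 0"
    then have "(cmod (coord F x))\<^sup>2 = 0" for x
      using nonneg_infsum_le_0D[of "\<lambda>x. (cmod (coord F x))\<^sup>2" UNIV x] ell2_summable[OF coord_ell2[of F]]
      unfolding inner_l2_def re_inner_def sq by simp
    then show "F = 0"
      by (intro l2_eqI) simp
  qed (simp add: inner_l2_def re_inner_def)
  show "norm F = sqrt (F \<bullet> F)" "dist F G = norm (F - G)" "sgn F = inverse (norm F) *\<^sub>R F"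
    by (simp_all add: norm_l2_def dist_l2_def sgn_l2_def)
  show "uniformity = (INF e\<in>{0<..}. principal {(F, G :: 'a l2). dist F G < e})"
    by (rule uniformity_l2_def)
  fix U :: "'a l2 set"
  show "open U = (\<forall>F\<in>U. eventually (\<lambda>(F', G). F' = F \<longrightarrow> G \<in> U) uniformity)"
    by (rule open_l2_def)
qed

end

lemma re_inner_self: "re_inner f f = (\<Sum>\<^sub>\<infinity>x. (cmod (f x))\<^sup>2)"
proof -
  have "Re (f x * cnj (f x)) = (cmod (f x))\<^sup>2" for x
    by (metis Re_complex_of_real complex_norm_square)
  then show ?thesis
    by (simp add: re_inner_def)
qed

lemma ell2_norm_eq_sqrt_inner: "ell2_norm f = sqrt (re_inner f f)"
  by (simp add: ell2_norm_def re_inner_self)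

lemma norm_l2_coord: "norm F = ell2_norm (coord F)"
  by (simp add: norm_l2_def inner_l2_def ell2_norm_eq_sqrt_inner)

lemma ell2_norm_Abs: "f \<in> ell2 V \<Longrightarrow> ell2_norm f = norm (Abs_l2 f)"
  by (simp add: norm_l2_coord)

lemma re_inner_Abs: "f \<in> ell2 V \<Longrightarrow> g \<in> ell2 W \<Longrightarrow> re_inner f g = Abs_l2 f \<bullet> Abs_l2 g"
  by (simp add: inner_l2_def)

lemma Abs_l2_linear:
  assumes "f \<in> ell2 V" "g \<in> ell2 V"
  shows "Abs_l2 (\<lambda>x. f x + g x) = Abs_l2 f + Abs_l2 g"
    and "Abs_l2 (\<lambda>x. f x - g x) = Abs_l2 f - Abs_l2 g"
    and "Abs_l2 (\<lambda>x. complex_of_real r * f x) = r *\<^sub>R Abs_l2 f"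
    and "Abs_l2 (\<lambda>x. 0) = (0 :: 'a l2)"
  using assms
  by (auto intro!: l2_eqI simp: coord_Abs_l2[OF ell2_add] coord_Abs_l2[OF ell2_diff]
      coord_Abs_l2[OF ell2_cmult] zero_l2_def)

lemma ell2_norm_nonneg [simp]: "0 \<le> ell2_norm f"
  unfolding ell2_norm_def by (intro real_sqrt_ge_zero infsum_nonneg) simp

lemma ell2_norm_square: "(ell2_norm f)\<^sup>2 = re_inner f f"
proof -
  have "0 \<le> re_inner f f"
    unfolding re_inner_self by (intro infsum_nonneg) simp
  then show ?thesis
    by (simp add: ell2_norm_eq_sqrt_inner)
qed

lemma ell2_norm_zero [simp]: "ell2_norm (\<lambda>x. 0) = 0"
  by (simp add: ell2_norm_def)

lemma ell2_norm_eq_0: "f \<in> ell2 V \<Longrightarrow> ell2_norm f = 0 \<longleftrightarrow> f = (\<lambda>x. 0)"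
proof
  assume f: "f \<in> ell2 V" and "ell2_norm f = 0"
  then have "Abs_l2 f = 0"
    by (simp add: ell2_norm_Abs)
  then have "coord (Abs_l2 f) x = 0" for x
    by simp
  then show "f = (\<lambda>x. 0)"
    using f by auto
qed simp

lemma ell2_norm_triangle:
  assumes "f \<in> ell2 V" "g \<in> ell2 V"
  shows "ell2_norm (\<lambda>x. f x + g x) \<le> ell2_norm f + ell2_norm g"
  using assms by (simp add: ell2_norm_Abs[OF ell2_add] ell2_norm_Abs Abs_l2_linear norm_triangle_ineq)

lemma ell2_norm_cmult: "ell2_norm (\<lambda>x. c * f x) = cmod c * ell2_norm f"
proof -
  have "(\<Sum>\<^sub>\<infinity>x. (cmod (c * f x))\<^sup>2) = (cmod c)\<^sup>2 * (\<Sum>\<^sub>\<infinity>x. (cmod (f x))\<^sup>2)"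
    by (subst infsum_cmult_right'[symmetric]) (simp add: norm_mult power_mult_distrib)
  then show ?thesis
    by (simp add: ell2_norm_def real_sqrt_mult)
qed

lemma ell2_norm_triangle_sub:
  assumes "f \<in> ell2 V" "g \<in> ell2 V"
  shows "ell2_norm (\<lambda>x. f x - g x) \<le> ell2_norm f + ell2_norm g"
  using assms by (simp add: ell2_norm_Abs[OF ell2_diff] ell2_norm_Abs Abs_l2_linear norm_triangle_ineq4)

lemma cmod_le_ell2_norm:
  assumes "f \<in> ell2 V"
  shows "cmod (f x) \<le> ell2_norm f"
proof -
  have "(\<Sum>y\<in>{x}. (cmod (f y))\<^sup>2) \<le> (\<Sum>\<^sub>\<infinity>y. (cmod (f y))\<^sup>2)"
    by (rule finite_sum_le_infsum[OF ell2_summable[OF assms]]) auto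
  then show ?thesis
    by (simp add: ell2_norm_def real_le_rsqrt)
qed

lemma ell2_norm_indicator [simp]: "ell2_norm (indicator {x}) = 1"
proof -
  have "(\<Sum>\<^sub>\<infinity>y. (cmod (indicator {x} y))\<^sup>2) = (\<Sum>\<^sub>\<infinity>y\<in>{x}. (cmod (indicator {x} y))\<^sup>2)"
    by (rule infsum_cong_neutral) auto
  then show ?thesis
    by (simp add: ell2_norm_def)
qed

lemma re_inner_add_left:
  "f \<in> ell2 V \<Longrightarrow> g \<in> ell2 V \<Longrightarrow> h \<in> ell2 V \<Longrightarrow>
    re_inner (\<lambda>x. f x + g x) h = re_inner f h + re_inner g h"
  by (simp add: re_inner_Abs[OF ell2_add] re_inner_Abs Abs_l2_linear inner_add_left)

lemma re_inner_diff_left: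
  "f \<in> ell2 V \<Longrightarrow> g \<in> ell2 V \<Longrightarrow> h \<in> ell2 V \<Longrightarrow>
    re_inner (\<lambda>x. f x - g x) h = re_inner f h - re_inner g h"
  by (simp add: re_inner_Abs[OF ell2_diff] re_inner_Abs Abs_l2_linear inner_diff_left)

lemma re_inner_commute: "re_inner f g = re_inner g f"
  by (simp add: re_inner_def mult.commute)

lemma re_inner_add_right:
  "f \<in> ell2 V \<Longrightarrow> g \<in> ell2 V \<Longrightarrow> h \<in> ell2 V \<Longrightarrow>
    re_inner f (\<lambda>x. g x + h x) = re_inner f g + re_inner f h"
  by (simp add: re_inner_commute[of f] re_inner_add_left)

lemma re_inner_diff_right:
  "f \<in> ell2 V \<Longrightarrow> g \<in> ell2 V \<Longrightarrow> h \<in> ell2 V \<Longrightarrow>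
    re_inner f (\<lambda>x. g x - h x) = re_inner f g - re_inner f h"
  by (simp add: re_inner_commute[of f] re_inner_diff_left)

lemma re_inner_cmult: "re_inner (\<lambda>x. c * f x) g = re_inner f (\<lambda>x. cnj c * g x)"
  by (simp add: re_inner_def mult.assoc mult.left_commute)

lemma re_inner_scaleR_left: "re_inner (\<lambda>x. complex_of_real r * f x) g = r * re_inner f g"
  unfolding re_inner_def by (subst infsum_cmult_right'[symmetric]) (simp add: algebra_simps)

lemma re_inner_scaleR_right: "re_inner f (\<lambda>x. complex_of_real r * g x) = r * re_inner f g"
  by (simp add: re_inner_commute[of f] re_inner_scaleR_left)

lemma re_inner_le_norms:
  "f \<in> ell2 V \<Longrightarrow> g \<in> ell2 W \<Longrightarrow> \<bar>re_inner f g\<bar> \<le> ell2_norm f * ell2_norm g"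
  by (simp add: re_inner_Abs ell2_norm_Abs Cauchy_Schwarz_ineq2)

text \<open>A Cauchy sequence converges at each vertex, and the Cauchy bound survives the limit on
  every finite set of vertices, hence in norm. The subspace form is what the fixed-point argument
  and the limits of polynomials need in order to stay in \<open>ell2 V\<close>.\<close>

lemma complete_ell2: "complete {F. coord F \<in> ell2 V}"
proof (rule completeI)
  fix F :: "nat \<Rightarrow> 'a l2"
  assume V: "\<forall>n. F n \<in> {F. coord F \<in> ell2 V}" and "Cauchy F"
  have le: "cmod (coord (F m) x - coord (F n) x) \<le> dist (F m) (F n)" for m n x
    using cmod_le_ell2_norm[OF coord_ell2[of "F m - F n"], of x] by (simp add: dist_norm norm_l2_coord)
  have "Cauchy (\<lambda>n. coord (F n) x)" for x
    unfolding Cauchy_def dist_norm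
    using \<open>Cauchy F\<close>[unfolded Cauchy_def] le by (meson le_less_trans)
  then have "\<exists>l. (\<lambda>n. coord (F n) x) \<longlonglongrightarrow> l" for x
    using Cauchy_convergent_iff convergent_def by blast
  then obtain f where f: "\<And>x. (\<lambda>n. coord (F n) x) \<longlonglongrightarrow> f x"
    by metis
  have bound: "(\<lambda>x. f x - coord (F n) x) \<in> ell2 UNIV \<and> norm (Abs_l2 (\<lambda>x. f x - coord (F n) x)) \<le> e"
    if e: "e > 0" and n: "\<And>m. m \<ge> n \<Longrightarrow> dist (F m) (F n) \<le> e" for n e
  proof -
    have *: "(\<Sum>x\<in>A. (cmod (f x - coord (F n) x))\<^sup>2) \<le> e\<^sup>2" if A: "finite A" for A
    proof (rule LIMSEQ_le_const2)
      show "(\<lambda>m. \<Sum>x\<in>A. (cmod (coord (F m) x - coord (F n) x))\<^sup>2)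
          \<longlonglongrightarrow> (\<Sum>x\<in>A. (cmod (f x - coord (F n) x))\<^sup>2)"
        by (intro tendsto_intros f)
      show "\<exists>N. \<forall>m\<ge>N. (\<Sum>x\<in>A. (cmod (coord (F m) x - coord (F n) x))\<^sup>2) \<le> e\<^sup>2"
      proof (intro exI allI impI)
        fix m assume "m \<ge> n"
        have "(\<Sum>x\<in>A. (cmod (coord (F m - F n) x))\<^sup>2) \<le> (\<Sum>\<^sub>\<infinity>x. (cmod (coord (F m - F n) x))\<^sup>2)"
          by (rule finite_sum_le_infsum[OF ell2_summable[OF coord_ell2] A]) auto
        also have "\<dots> = (dist (F m) (F n))\<^sup>2"
          by (simp only: dist_norm norm_l2_coord ell2_norm_square re_inner_self)
        also have "\<dots> \<le> e\<^sup>2"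
          using n[OF \<open>m \<ge> n\<close>] by (intro power_mono) auto
        finally show "(\<Sum>x\<in>A. (cmod (coord (F m) x - coord (F n) x))\<^sup>2) \<le> e\<^sup>2"
          by simp
      qed
    qed
    have m: "(\<lambda>x. f x - coord (F n) x) \<in> ell2 UNIV"
      by (rule ell2_bdd_sumI(1)[of _ _ "e\<^sup>2"]) (use * in auto)
    have "(ell2_norm (\<lambda>x. f x - coord (F n) x))\<^sup>2 \<le> e\<^sup>2"
      unfolding ell2_norm_square re_inner_self by (rule ell2_bdd_sumI(2)[of UNIV]) (use * in auto)
    then have "ell2_norm (\<lambda>x. f x - coord (F n) x) \<le> e"
      using e by (simp add: abs_le_square_iff[symmetric])
    then show ?thesis
      using m by (simp add: norm_l2_coord)
  qed
  have cau: "\<exists>N. \<forall>n\<ge>N. \<forall>m\<ge>n. dist (F m) (F n) \<le> e" if "e > 0" for e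
    using \<open>Cauchy F\<close>[unfolded Cauchy_def, rule_format, OF that] by (meson less_imp_le order_trans)
  obtain N where N: "\<And>n m. n \<ge> N \<Longrightarrow> m \<ge> n \<Longrightarrow> dist (F m) (F n) \<le> 1"
    using cau[of 1] by auto
  have "(\<lambda>x. (f x - coord (F N) x) + coord (F N) x) \<in> ell2 UNIV"
    by (intro ell2_add) (use bound[of 1 N] N in auto)
  then have f2: "f \<in> ell2 UNIV"
    by simp
  have "f x = 0" if "x \<notin> V" for x
  proof (rule LIMSEQ_unique[OF f])
    show "(\<lambda>n. coord (F n) x) \<longlonglongrightarrow> 0"
      using V that by (simp add: ell2_off[of _ V])
  qed
  then have f2V: "f \<in> ell2 V"
    using f2 by (auto simp: ell2_def)
  have "F \<longlonglongrightarrow> Abs_l2 f"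
  proof (rule metric_LIMSEQ_I)
    fix e :: real assume "e > 0"
    then obtain N where N: "\<And>n m. n \<ge> N \<Longrightarrow> m \<ge> n \<Longrightarrow> dist (F m) (F n) \<le> e / 2"
      using cau[of "e / 2"] by auto
    show "\<exists>N. \<forall>n\<ge>N. dist (F n) (Abs_l2 f) < e"
    proof (intro exI allI impI)
      fix n assume "n \<ge> N"
      have "norm (Abs_l2 (\<lambda>x. f x - coord (F n) x)) \<le> e / 2"
        using bound[of "e / 2" n] N \<open>n \<ge> N\<close> \<open>e > 0\<close> by auto
      moreover have "Abs_l2 (\<lambda>x. f x - coord (F n) x) = Abs_l2 f - F n"
        using Abs_l2_linear(2)[OF f2 coord_ell2[of "F n"]] by (simp add: coord_inverse)
      ultimately show "dist (F n) (Abs_l2 f) < e"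
        using \<open>e > 0\<close> by (simp add: dist_norm norm_minus_commute)
    qed
  qed
  then show "\<exists>l\<in>{F. coord F \<in> ell2 V}. F \<longlonglongrightarrow> l"
    using f2V by (intro bexI[of _ "Abs_l2 f"]) auto
qed

lemma coord_diff: "coord (F - G) = (\<lambda>x. coord F x - coord G x)"
  by (rule ext) simp

section \<open>Bounded operators and polynomials of operators\<close>

lemma bounded_operatorI:
  assumes "\<And>f. f \<in> ell2 V \<Longrightarrow> T f \<in> ell2 V"
    and "\<And>f g. f \<in> ell2 V \<Longrightarrow> g \<in> ell2 V \<Longrightarrow> T (\<lambda>x. f x + g x) = (\<lambda>x. T f x + T g x)"
    and "\<And>c f. f \<in> ell2 V \<Longrightarrow> T (\<lambda>x. c * f x) = (\<lambda>x. c * T f x)"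
    and "\<And>f. f \<in> ell2 V \<Longrightarrow> ell2_norm (T f) \<le> C * ell2_norm f"
  shows "bounded_operator V T"
  unfolding bounded_operator_def using assms by blast

lemma bounded_operatorD:
  assumes "bounded_operator V T" "f \<in> ell2 V"
  shows "T f \<in> ell2 V"
    and "g \<in> ell2 V \<Longrightarrow> T (\<lambda>x. f x + g x) = (\<lambda>x. T f x + T g x)"
    and "T (\<lambda>x. c * f x) = (\<lambda>x. c * T f x)"
  using assms unfolding bounded_operator_def by blast+

lemma bounded_operator_zero: "bounded_operator V T \<Longrightarrow> T (\<lambda>x. 0) = (\<lambda>x. 0)"
  using bounded_operatorD(3)[of V T "\<lambda>x. 0" 0] by simp

lemma bounded_operator_diff:
  assumes "bounded_operator V T" "f \<in> ell2 V" "g \<in> ell2 V"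
  shows "T (\<lambda>x. f x - g x) = (\<lambda>x. T f x - T g x)"
  using bounded_operatorD(2)[OF assms(1,2) ell2_cmult[OF assms(3), of "-1"]]
    bounded_operatorD(3)[OF assms(1,3), of "-1"] by simp

lemma bounded_operator_sum:
  assumes "bounded_operator V T" "\<And>i. i \<in> I \<Longrightarrow> f i \<in> ell2 V"
  shows "T (\<lambda>x. \<Sum>i\<in>I. f i x) = (\<lambda>x. \<Sum>i\<in>I. T (f i) x)"
  using assms(2)
proof (induction I rule: infinite_finite_induct)
  case (insert i I)
  then show ?case
    by (simp add: bounded_operatorD(2)[OF assms(1) _ ell2_sum])
qed (use bounded_operator_zero[OF assms(1)] in auto)

lemma bounded_operator_bound:
  assumes "bounded_operator V T"
  obtains C where "C > 0" "\<And>f. f \<in> ell2 V \<Longrightarrow> ell2_norm (T f) \<le> C * ell2_norm f"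
proof -
  obtain C where C: "\<And>f. f \<in> ell2 V \<Longrightarrow> ell2_norm (T f) \<le> C * ell2_norm f"
    using assms unfolding bounded_operator_def by blast
  have "ell2_norm (T f) \<le> (\<bar>C\<bar> + 1) * ell2_norm f" if "f \<in> ell2 V" for f
    using C[OF that] mult_right_mono[of C "\<bar>C\<bar> + 1" "ell2_norm f"] abs_ge_self[of C] by simp
  then show ?thesis
    using that[of "\<bar>C\<bar> + 1"] by auto
qed

lemma bounded_operator_cong:
  assumes "bounded_operator V T" "\<And>f. f \<in> ell2 V \<Longrightarrow> S f = T f"
  shows "bounded_operator V S"
proof -
  obtain C where "\<And>f. f \<in> ell2 V \<Longrightarrow> ell2_norm (T f) \<le> C * ell2_norm f"
    using bounded_operator_bound[OF assms(1)] by blast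
  then show ?thesis
    by (intro bounded_operatorI[of _ _ C])
      (simp_all add: assms(2) ell2_add ell2_cmult bounded_operatorD[OF assms(1)])
qed

lemma bounded_operator_const_0: "bounded_operator V (\<lambda>f x. 0)"
  by (rule bounded_operatorI[of _ _ 0]) auto

lemma bounded_operator_id: "bounded_operator V (\<lambda>f. f)"
  by (rule bounded_operatorI[of _ _ 1]) auto

lemma bounded_operator_comp:
  assumes "bounded_operator V S" "bounded_operator V T"
  shows "bounded_operator V (\<lambda>f. S (T f))"
proof -
  obtain C where C: "C > 0" "\<And>f. f \<in> ell2 V \<Longrightarrow> ell2_norm (S f) \<le> C * ell2_norm f"
    using bounded_operator_bound[OF assms(1)] by blast
  obtain D where D: "\<And>f. f \<in> ell2 V \<Longrightarrow> ell2_norm (T f) \<le> D * ell2_norm f"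
    using bounded_operator_bound[OF assms(2)] by blast
  show ?thesis
  proof (rule bounded_operatorI[of _ _ "C * D"])
    fix f assume f: "f \<in> ell2 V"
    have "ell2_norm (S (T f)) \<le> C * ell2_norm (T f)"
      by (intro C bounded_operatorD[OF assms(2)] f)
    also have "\<dots> \<le> C * (D * ell2_norm f)"
      using C(1) D[OF f] by simp
    finally show "ell2_norm (S (T f)) \<le> C * D * ell2_norm f"
      by simp
  qed (use assms in \<open>simp_all add: bounded_operatorD\<close>)
qed

lemma bounded_operator_cmult:
  assumes "bounded_operator V T"
  shows "bounded_operator V (\<lambda>f x. c * T f x)"
proof -
  obtain C where C: "\<And>f. f \<in> ell2 V \<Longrightarrow> ell2_norm (T f) \<le> C * ell2_norm f"
    using bounded_operator_bound[OF assms(1)] by blast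
  show ?thesis
    by (rule bounded_operatorI[of _ _ "cmod c * C"])
      (use C in \<open>auto simp: ell2_cmult bounded_operatorD[OF assms] ell2_norm_cmult mult.assoc
        mult.left_commute[of c] distrib_left intro!: mult_left_mono\<close>)
qed

lemma bounded_operator_plus:
  assumes "bounded_operator V S" "bounded_operator V T"
  shows "bounded_operator V (\<lambda>f x. S f x + T f x)"
proof -
  obtain C where C: "\<And>f. f \<in> ell2 V \<Longrightarrow> ell2_norm (S f) \<le> C * ell2_norm f"
    using bounded_operator_bound[OF assms(1)] by blast
  obtain D where D: "\<And>f. f \<in> ell2 V \<Longrightarrow> ell2_norm (T f) \<le> D * ell2_norm f"
    using bounded_operator_bound[OF assms(2)] by blast
  show ?thesis
  proof (rule bounded_operatorI[of _ _ "C + D"])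
    fix f assume f: "f \<in> ell2 V"
    show "ell2_norm (\<lambda>x. S f x + T f x) \<le> (C + D) * ell2_norm f"
      using ell2_norm_triangle[OF bounded_operatorD(1)[OF assms(1) f] bounded_operatorD(1)[OF assms(2) f]]
        C[OF f] D[OF f] by (simp add: algebra_simps)
  qed (use assms in \<open>simp_all add: bounded_operatorD ell2_add algebra_simps\<close>)
qed

lemma bounded_operator_minus:
  assumes "bounded_operator V S" "bounded_operator V T"
  shows "bounded_operator V (\<lambda>f x. S f x - T f x)"
  using bounded_operator_plus[OF assms(1) bounded_operator_cmult[OF assms(2), of "-1"]] by simp

lemma bounded_operator_shift: "bounded_operator V T \<Longrightarrow> bounded_operator V (\<lambda>f x. z * f x - T f x)"
  using bounded_operator_minus[OF bounded_operator_cmult[OF bounded_operator_id]] .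

lemma bounded_operator_op_norm:
  assumes "bounded_operator V T" "f \<in> ell2 V" "ell2_norm f \<le> 1"
  shows "ell2_norm (T f) \<le> op_norm V T"
proof -
  obtain C where C: "C > 0" "\<And>f. f \<in> ell2 V \<Longrightarrow> ell2_norm (T f) \<le> C * ell2_norm f"
    using bounded_operator_bound[OF assms(1)] by blast
  show ?thesis
    unfolding op_norm_def
  proof (rule cSUP_upper)
    show "bdd_above ((\<lambda>f. ell2_norm (T f)) ` {f \<in> ell2 V. ell2_norm f \<le> 1})"
    proof (rule bdd_aboveI2)
      fix f assume f: "f \<in> {f \<in> ell2 V. ell2_norm f \<le> 1}"
      then have "ell2_norm (T f) \<le> C * ell2_norm f"
        using C by blast
      also have "\<dots> \<le> C * 1"
        using C(1) f by (intro mult_left_mono) auto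
      finally show "ell2_norm (T f) \<le> C"
        by simp
    qed
  qed (use assms in auto)
qed

lemma op_norm_le:
  assumes "\<And>f. f \<in> ell2 V \<Longrightarrow> ell2_norm f \<le> 1 \<Longrightarrow> ell2_norm (T f) \<le> C"
  shows "op_norm V T \<le> C"
  unfolding op_norm_def
proof (rule cSUP_least)
  have "(\<lambda>x. 0) \<in> {f \<in> ell2 V. ell2_norm f \<le> 1}"
    by simp
  then show "{f \<in> ell2 V. ell2_norm f \<le> 1} \<noteq> {}"
    by blast
qed (use assms in auto)

lemma op_norm_nonneg: "bounded_operator V T \<Longrightarrow> 0 \<le> op_norm V T"
  using bounded_operator_op_norm[of V T "\<lambda>x. 0"] by (simp add: bounded_operator_zero)

lemma ell2_norm_le_op_norm:
  assumes "bounded_operator V T" "f \<in> ell2 V"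
  shows "ell2_norm (T f) \<le> op_norm V T * ell2_norm f"
proof (cases "ell2_norm f = 0")
  case True
  then show ?thesis
    using assms ell2_norm_eq_0[OF assms(2)] by (simp add: bounded_operator_zero[OF assms(1)])
next
  case False
  define c where "c = complex_of_real (1 / ell2_norm f)"
  have c: "cmod c = 1 / ell2_norm f"
    by (simp add: c_def norm_divide)
  have "ell2_norm (T (\<lambda>x. c * f x)) \<le> op_norm V T"
    using False by (intro bounded_operator_op_norm assms ell2_cmult) (simp add: ell2_norm_cmult c)
  then show ?thesis
    using False ell2_norm_nonneg[of f]
    by (simp add: bounded_operatorD(3)[OF assms] ell2_norm_cmult c pos_divide_le_eq less_le)
qed

section \<open>Polynomials of a bounded operator\<close>

lemma poly_op_altdef:
  assumes "degree p \<le> n"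
  shows "poly_op p T f x = (\<Sum>i\<le>n. coeff p i * (T ^^ i) f x)"
  unfolding poly_op_def using assms
  by (intro sum.mono_neutral_left) (auto simp: coeff_eq_0 not_le)

lemma poly_op_0 [simp]: "poly_op 0 T f = (\<lambda>x. 0)"
  by (simp add: poly_op_def)

text \<open>Horner's rule with \<open>T\<close> applied to the argument instead of the result; in
  this form it holds for every map \<open>T\<close>. It is the reason why inductions such as that of
  \<open>poly_op_commute\<close> generalise over \<open>f\<close>.\<close>

lemma poly_op_pCons: "poly_op (pCons a p) T f = (\<lambda>x. a * f x + poly_op p T (T f) x)"
proof
  fix x
  have "poly_op (pCons a p) T f x = (\<Sum>i\<le>Suc (degree p). coeff (pCons a p) i * (T ^^ i) f x)"
    by (rule poly_op_altdef) (rule degree_pCons_le)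
  also have "\<dots> = a * f x + (\<Sum>i\<le>degree p. coeff p i * (T ^^ Suc i) f x)"
    by (subst sum.atMost_Suc_shift) simp
  finally show "poly_op (pCons a p) T f x = a * f x + poly_op p T (T f) x"
    by (simp add: poly_op_def funpow_swap1)
qed

lemma poly_op_add: "poly_op (p + q) T f = (\<lambda>x. poly_op p T f x + poly_op q T f x)"
proof
  fix x
  let ?n = "max (degree p) (degree q)"
  show "poly_op (p + q) T f x = poly_op p T f x + poly_op q T f x"
    using degree_add_le_max[of p q]
    by (simp add: poly_op_altdef[of _ ?n] sum.distrib distrib_right)
qed

lemma poly_op_smult: "poly_op (smult c p) T f = (\<lambda>x. c * poly_op p T f x)"
  by (rule ext, subst (1 2) poly_op_altdef[of _ "degree p"])
    (auto simp: degree_smult_le sum_distrib_left mult.assoc)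

lemma poly_op_diff: "poly_op (p - q) T f = (\<lambda>x. poly_op p T f x - poly_op q T f x)"
  using poly_op_add[of p "smult (-1) q" T f] unfolding poly_op_smult by simp

lemma bounded_operator_poly:
  assumes "bounded_operator V T"
  shows "bounded_operator V (poly_op p T)"
proof (induction p)
  case 0
  then show ?case
    using bounded_operator_const_0[of V] bounded_operator_cong[of V _ "poly_op 0 T"] by simp
next
  case (pCons a p)
  have "bounded_operator V (\<lambda>f x. a * f x + poly_op p T (T f) x)"
    by (intro bounded_operator_plus bounded_operator_cmult bounded_operator_id
        bounded_operator_comp[OF pCons.IH assms])
  then show ?case
    by (rule bounded_operator_cong) (simp add: poly_op_pCons)
qed

lemma poly_op_commute:
  assumes "bounded_operator V T" "f \<in> ell2 V"
  shows "poly_op p T (T f) = T (poly_op p T f)"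
  using assms(2)
proof (induction p arbitrary: f)
  case 0
  then show ?case
    using bounded_operator_zero[OF assms(1)] by simp
next
  case (pCons a p)
  have Tf: "T f \<in> ell2 V"
    by (rule bounded_operatorD(1)[OF assms(1) pCons.prems])
  have pTf: "poly_op p T (T f) \<in> ell2 V"
    by (rule bounded_operatorD(1)[OF bounded_operator_poly[OF assms(1)] Tf])
  show ?case
    unfolding poly_op_pCons bounded_operatorD(2)[OF assms(1) ell2_cmult[OF pCons.prems] pTf]
      bounded_operatorD(3)[OF assms(1) pCons.prems] pCons.IH[OF Tf] ..
qed

lemma poly_op_mult:
  assumes "bounded_operator V T" "f \<in> ell2 V"
  shows "poly_op (p * q) T f = poly_op p T (poly_op q T f)"
  using assms(2)
proof (induction p arbitrary: f)
  case (pCons a p)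
  have "poly_op (p * q) T (T f) = poly_op p T (T (poly_op q T f))"
    using pCons.IH[OF bounded_operatorD(1)[OF assms(1) pCons.prems]]
    by (simp add: poly_op_commute[OF assms(1) pCons.prems])
  then show ?case
    by (simp add: mult_pCons_left poly_op_add poly_op_smult poly_op_pCons)
qed simp

section \<open>Invertible operators and roots of polynomials\<close>

definition op_invertible :: "'a set \<Rightarrow> 'a operator \<Rightarrow> bool" where
  "op_invertible V T \<longleftrightarrow> (\<exists>S. bounded_operator V S \<and> (\<forall>f\<in>ell2 V. S (T f) = f \<and> T (S f) = f))"

lemma spectrum_iff: "z \<in> spectrum V T \<longleftrightarrow> \<not> op_invertible V (\<lambda>f x. z * f x - T f x)"
  by (simp add: spectrum_def op_invertible_def)

lemma op_invertible_cong:
  assumes "op_invertible V T" "\<And>f. f \<in> ell2 V \<Longrightarrow> S f = T f"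
  shows "op_invertible V S"
proof -
  obtain R where R: "bounded_operator V R" "\<And>f. f \<in> ell2 V \<Longrightarrow> R (T f) = f \<and> T (R f) = f"
    using assms(1) by (auto simp: op_invertible_def)
  then show ?thesis
    unfolding op_invertible_def
    by (intro exI[of _ R]) (simp add: assms(2) bounded_operatorD(1)[OF R(1)])
qed

lemma op_invertible_comp:
  assumes "op_invertible V S" "op_invertible V T" "bounded_operator V S" "bounded_operator V T"
  shows "op_invertible V (\<lambda>f. S (T f))"
proof -
  obtain R where R: "bounded_operator V R" "\<And>f. f \<in> ell2 V \<Longrightarrow> R (S f) = f \<and> S (R f) = f"
    using assms(1) by (auto simp: op_invertible_def)
  obtain Q where Q: "bounded_operator V Q" "\<And>f. f \<in> ell2 V \<Longrightarrow> Q (T f) = f \<and> T (Q f) = f"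
    using assms(2) by (auto simp: op_invertible_def)
  show ?thesis
    unfolding op_invertible_def
    by (rule exI[of _ "\<lambda>f. Q (R f)"])
      (simp add: R Q bounded_operator_comp bounded_operatorD(1)[OF assms(3)] bounded_operatorD(1)[OF assms(4)]
        bounded_operatorD(1)[OF R(1)] bounded_operatorD(1)[OF Q(1)])
qed

lemma op_invertible_cmult:
  assumes "c \<noteq> 0"
  shows "op_invertible V (\<lambda>f x. c * f x)"
  unfolding op_invertible_def
  by (rule exI[of _ "\<lambda>f x. inverse c * f x"])
    (use assms in \<open>auto intro!: bounded_operator_cmult bounded_operator_id\<close>)

lemma op_invertible_cmultD:
  assumes "op_invertible V (\<lambda>f x. c * T f x)" "bounded_operator V T" "c \<noteq> 0"
  shows "op_invertible V T"
proof -
  have "op_invertible V (\<lambda>f x. inverse c * (c * T f x))"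
    using op_invertible_comp[OF op_invertible_cmult[of "inverse c"] assms(1)] assms
    by (simp add: bounded_operator_cmult bounded_operator_id)
  then show ?thesis
    by (rule op_invertible_cong) (use assms in auto)
qed

text \<open>One half of the spectral mapping theorem: \<open>p\<close> splits into linear factors
  over the complex numbers, and each factor is invertible when its root lies off the
  spectrum.\<close>

lemma poly_op_invertible:
  assumes "bounded_operator V T" "p \<noteq> 0" "\<And>z. poly p z = 0 \<Longrightarrow> z \<notin> spectrum V T"
  shows "op_invertible V (poly_op p T)"
  using assms(2,3)
proof (induction "degree p" arbitrary: p)
  case 0
  then obtain c where "p = [:c:]" "c \<noteq> 0"
    by (metis degree_eq_zeroE pCons_0_0)
  then show ?case
    by (intro op_invertible_cong[OF op_invertible_cmult[of c]]) (simp_all add: poly_op_pCons)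
next
  case (Suc n)
  then have "\<not> constant (poly p)"
    by (simp add: constant_degree)
  then obtain z where z: "poly p z = 0"
    using fundamental_theorem_of_algebra by blast
  then obtain q where q: "p = [:- z, 1:] * q"
    by (metis dvdE poly_eq_0_iff_dvd)
  with Suc.prems have "q \<noteq> 0"
    by auto
  then have "degree p = degree [:- z, 1:] + degree q"
    unfolding q by (intro degree_mult_eq) auto
  with Suc.hyps(2) have "degree q = n"
    by simp
  then have inv: "op_invertible V (poly_op q T)"
    using Suc.hyps(1)[of q] \<open>q \<noteq> 0\<close> Suc.prems(2) by (simp add: q)
  have "op_invertible V (\<lambda>f x. z * f x - T f x)"
    using Suc.prems z by (simp add: spectrum_iff)
  from op_invertible_comp[OF op_invertible_cmult[of "-1"] this
      bounded_operator_cmult[OF bounded_operator_id] bounded_operator_shift[OF assms(1)]]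
  have "op_invertible V (\<lambda>f x. - 1 * (z * f x - T f x))"
    by simp
  then have "op_invertible V (poly_op [:- z, 1:] T)"
    by (rule op_invertible_cong) (simp add: poly_op_pCons)
  from op_invertible_comp[OF this inv] show ?case
    unfolding q by (rule op_invertible_cong[OF _])
      (simp_all only: poly_op_mult[OF assms(1)] bounded_operator_poly[OF assms(1)])
qed

text \<open>
  The equation \<open>C u = f\<close> is solved by Banach's fixed point theorem, since \<open>u \<mapsto> u - k (C u - f)\<close>
  is a contraction for small \<open>k > 0\<close>.
\<close>

lemma coercive_invertible:
  assumes C: "bounded_operator V C" and "c > 0"
    and coercive: "\<And>f. f \<in> ell2 V \<Longrightarrow> c * (ell2_norm f)\<^sup>2 \<le> re_inner (C f) f"
  shows "op_invertible V C"
proof -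
  obtain M0 where M0: "M0 > 0" "\<And>f. f \<in> ell2 V \<Longrightarrow> ell2_norm (C f) \<le> M0 * ell2_norm f"
    using bounded_operator_bound[OF C] by blast
  \<comment> \<open>Raising the bound to at least \<open>c\<close> makes \<open>q\<close> below
    nonnegative, so that \<open>sqrt q\<close> is a contraction constant.\<close>
  define M where "M = max M0 c"
  have M: "ell2_norm (C f) \<le> M * ell2_norm f" if "f \<in> ell2 V" for f
    using M0(2)[OF that] mult_right_mono[of M0 M "ell2_norm f"] by (simp add: M_def)
  have "M > 0" "c \<le> M"
    using M0(1) by (auto simp: M_def)
  \<comment> \<open>For this \<open>k\<close> the factor
    \<open>1 - 2 * k * c + k\<^sup>2 * M\<^sup>2\<close> in the estimate of \<open>g - k C g\<close>
    is smallest; its minimum is the \<open>q\<close> defined next.\<close>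
  define k where "k = c / M\<^sup>2"
  have k: "k > 0"
    using \<open>c > 0\<close> \<open>M > 0\<close> by (simp add: k_def)
  define q where "q = 1 - c\<^sup>2 / M\<^sup>2"
  have q: "0 \<le> q" "q < 1"
    using \<open>c > 0\<close> \<open>M > 0\<close> \<open>c \<le> M\<close> by (auto simp: q_def power_mono)
  define D where "D = {F. coord F \<in> ell2 V}"
  have Abs_D: "Abs_l2 f \<in> D" if "f \<in> ell2 V" for f
    using that by (simp add: D_def)
  have contr: "ell2_norm (\<lambda>x. g x - complex_of_real k * C g x) \<le> sqrt q * ell2_norm g"
    if g: "g \<in> ell2 V" for g
  proof -
    have Cg: "C g \<in> ell2 V"
      using bounded_operatorD[OF C g] by simp
    let ?h = "\<lambda>x. complex_of_real k * C g x"
    have h: "?h \<in> ell2 V"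
      by (rule ell2_cmult[OF Cg])
    have "(ell2_norm (C g))\<^sup>2 \<le> (M * ell2_norm g)\<^sup>2"
      by (intro power_mono M g) simp
    then have "k\<^sup>2 * (ell2_norm (C g))\<^sup>2 \<le> k\<^sup>2 * (M\<^sup>2 * (ell2_norm g)\<^sup>2)"
      by (intro mult_left_mono) (simp_all add: power_mult_distrib)
    moreover have "2 * k * (c * (ell2_norm g)\<^sup>2) \<le> 2 * k * re_inner (C g) g"
      using coercive[OF g] k by (intro mult_left_mono) auto
    moreover have "(ell2_norm (\<lambda>x. g x - ?h x))\<^sup>2
        = (ell2_norm g)\<^sup>2 - 2 * k * re_inner (C g) g + k\<^sup>2 * (ell2_norm (C g))\<^sup>2"
      unfolding ell2_norm_square re_inner_diff_left[OF g h ell2_diff[OF g h]]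
        re_inner_diff_right[OF g g h] re_inner_diff_right[OF h g h]
        re_inner_scaleR_left re_inner_scaleR_right re_inner_commute[of g "C g"]
      by (simp add: power2_eq_square algebra_simps)
    ultimately have "(ell2_norm (\<lambda>x. g x - ?h x))\<^sup>2
        \<le> (ell2_norm g)\<^sup>2 - 2 * k * (c * (ell2_norm g)\<^sup>2) + k\<^sup>2 * (M\<^sup>2 * (ell2_norm g)\<^sup>2)"
      by linarith
    also have "\<dots> = q * (ell2_norm g)\<^sup>2"
      using \<open>M > 0\<close> by (simp add: k_def q_def field_simps power2_eq_square)
    finally have "ell2_norm (\<lambda>x. g x - ?h x) \<le> sqrt (q * (ell2_norm g)\<^sup>2)"
      by (rule real_le_rsqrt)
    then show ?thesis
      by (simp add: real_sqrt_mult)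
  qed
  have ex: "\<exists>u\<in>ell2 V. C u = f" if f: "f \<in> ell2 V" for f
  proof -
    define \<Phi> where "\<Phi> F = Abs_l2 (\<lambda>x. coord F x - complex_of_real k * (C (coord F) x - f x))" for F
    have mem: "(\<lambda>x. coord F x - complex_of_real k * (C (coord F) x - f x)) \<in> ell2 V" if "F \<in> D" for F
      using that f by (auto simp: D_def intro!: ell2_diff ell2_cmult bounded_operatorD(1)[OF C])
    have coord_\<Phi>: "coord (\<Phi> F) x = coord F x - complex_of_real k * (C (coord F) x - f x)"
      if "F \<in> D" for F x
      unfolding \<Phi>_def by (simp only: coord_Abs_l2[OF mem[OF that]])
    have "\<exists>!F. F \<in> D \<and> \<Phi> F = F"
    proof (rule Banach_fix)
      show "complete D"
        unfolding D_def by (rule complete_ell2)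
      show "D \<noteq> {}"
        using Abs_D[OF f] by blast
      show "\<Phi> ` D \<subseteq> D"
        using mem by (auto simp: \<Phi>_def intro!: Abs_D)
      show "0 \<le> sqrt q" "sqrt q < 1"
        using q by (auto simp: real_sqrt_lt_1_iff)
      fix F G assume FG: "F \<in> D" "G \<in> D"
      then have F: "coord F \<in> ell2 V" and G: "coord G \<in> ell2 V"
        by (auto simp: D_def)
      let ?g = "\<lambda>x. coord F x - coord G x"
      have g: "?g \<in> ell2 V"
        by (intro ell2_diff F G)
      have "coord (\<Phi> F - \<Phi> G) = (\<lambda>x. ?g x - complex_of_real k * C ?g x)"
        unfolding bounded_operator_diff[OF C F G] using FG
        by (intro ext) (simp add: coord_\<Phi> right_diff_distrib)
      then have "dist (\<Phi> F) (\<Phi> G) = ell2_norm (\<lambda>x. ?g x - complex_of_real k * C ?g x)"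
        by (simp add: dist_norm norm_l2_coord)
      also have "\<dots> \<le> sqrt q * ell2_norm ?g"
        by (rule contr[OF g])
      finally show "dist (\<Phi> F) (\<Phi> G) \<le> sqrt q * dist F G"
        by (simp add: dist_norm norm_l2_coord coord_diff)
    qed
    then obtain F where F: "F \<in> D" "\<Phi> F = F"
      by blast
    then have "C (coord F) x = f x" for x
      using coord_\<Phi>[OF F(1), of x] k by simp
    then show ?thesis
      using F(1) by (auto simp: D_def)
  qed
  define S where "S f = (SOME u. u \<in> ell2 V \<and> C u = f)" for f
  have S: "S f \<in> ell2 V" "C (S f) = f" if "f \<in> ell2 V" for f
    using someI_ex[of "\<lambda>u. u \<in> ell2 V \<and> C u = f"] ex[OF that] by (auto simp: S_def)
  have bound: "c * ell2_norm u \<le> ell2_norm (C u)" if u: "u \<in> ell2 V" for u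
  proof (cases "ell2_norm u = 0")
    case False
    have "c * (ell2_norm u)\<^sup>2 \<le> ell2_norm (C u) * ell2_norm u"
      using coercive[OF u] re_inner_le_norms[OF bounded_operatorD(1)[OF C u] u] by linarith
    then have "(c * ell2_norm u) * ell2_norm u \<le> ell2_norm (C u) * ell2_norm u"
      by (simp add: power2_eq_square algebra_simps)
    then show ?thesis
      by (rule mult_right_le_imp_le) (use False ell2_norm_nonneg[of u] in linarith)
  qed simp
  have inj: "u = w" if "u \<in> ell2 V" "w \<in> ell2 V" "C u = C w" for u w
  proof -
    have "C (\<lambda>x. u x - w x) = (\<lambda>x. 0)"
      using that by (simp add: bounded_operator_diff[OF C])
    then have "c * ell2_norm (\<lambda>x. u x - w x) \<le> 0"
      using bound[OF ell2_diff[OF that(1,2)]] by simp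
    then have "ell2_norm (\<lambda>x. u x - w x) = 0"
      using \<open>c > 0\<close> ell2_norm_nonneg[of "\<lambda>x. u x - w x"] by (simp add: mult_le_0_iff)
    then have "(\<lambda>x. u x - w x) = (\<lambda>x. 0)"
      using ell2_norm_eq_0[OF ell2_diff[OF that(1,2)]] by simp
    then show "u = w"
      by (simp add: fun_eq_iff)
  qed
  have "bounded_operator V S"
  proof (rule bounded_operatorI[of _ _ "1 / c"])
    show "S (\<lambda>x. f x + g x) = (\<lambda>x. S f x + S g x)" if "f \<in> ell2 V" "g \<in> ell2 V" for f g
      by (rule inj) (use that S bounded_operatorD(2)[OF C S(1) S(1)] in \<open>auto simp: ell2_add\<close>)
    show "S (\<lambda>x. a * f x) = (\<lambda>x. a * S f x)" if "f \<in> ell2 V" for f a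
      by (rule inj) (use that S bounded_operatorD(3)[OF C S(1)] in \<open>auto simp: ell2_cmult\<close>)
    show "ell2_norm (S f) \<le> 1 / c * ell2_norm f" if "f \<in> ell2 V" for f
      using bound[OF S(1)] S(2) that \<open>c > 0\<close> by (simp add: field_simps)
  qed (use S in auto)
  moreover have "S (C f) = f" if "f \<in> ell2 V" for f
    by (rule inj) (use that S bounded_operatorD(1)[OF C] in auto)
  ultimately show ?thesis
    unfolding op_invertible_def using S by blast
qed

section \<open>Self-adjoint operators\<close>

text \<open>For complex-linear \<open>T\<close> this is full self-adjointness: replacing
  \<open>g\<close> by \<open>\<i>\<close> times \<open>g\<close> gives the equality of the imaginary
  parts.\<close>

definition self_adjoint :: "'a set \<Rightarrow> 'a operator \<Rightarrow> bool" where
  "self_adjoint V T \<longleftrightarrow> (\<forall>f\<in>ell2 V. \<forall>g\<in>ell2 V. re_inner (T f) g = re_inner f (T g))"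

lemma self_adjointD:
  "self_adjoint V T \<Longrightarrow> f \<in> ell2 V \<Longrightarrow> g \<in> ell2 V \<Longrightarrow> re_inner (T f) g = re_inner f (T g)"
  by (simp add: self_adjoint_def)

lemma re_inner_cmult_self: "re_inner (\<lambda>x. c * f x) f = Re c * (ell2_norm f)\<^sup>2"
proof -
  have "Re (c * f x * cnj (f x)) = Re c * (cmod (f x))\<^sup>2" for x
    by (simp add: mult.assoc complex_norm_square[symmetric])
  then show ?thesis
    unfolding ell2_norm_square re_inner_self unfolding re_inner_def
    by (simp add: infsum_cmult_right')
qed

text \<open>The quadratic form of a self-adjoint operator is real, so an imaginary multiple of it
  has real part zero. In terms of \<open>re_inner\<close>: moving first the factor and then
  \<open>T\<close> across reverses the sign.\<close>

lemma self_adjoint_re_inner_imaginary: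
  assumes "bounded_operator V T" "self_adjoint V T" "f \<in> ell2 V"
  shows "re_inner (\<lambda>x. \<i> * complex_of_real s * T f x) f = 0"
proof -
  let ?c = "\<i> * complex_of_real s"
  have "re_inner (\<lambda>x. ?c * T f x) f = re_inner (T f) (\<lambda>x. - ?c * f x)"
    using re_inner_cmult[of ?c "T f" f] by simp
  also have "\<dots> = re_inner f (\<lambda>x. - ?c * T f x)"
    by (simp only: self_adjointD[OF assms(2,3) ell2_cmult[OF assms(3)]] bounded_operatorD(3)[OF assms(1,3)])
  also have "\<dots> = - re_inner f (\<lambda>x. ?c * T f x)"
    using re_inner_scaleR_right[of f "-1" "\<lambda>x. ?c * T f x"] by simp
  finally show ?thesis
    by (simp add: re_inner_commute)
qed

text \<open>Multiplication of \<open>z - T\<close> by \<open>- \<i> * sgn (Im z)\<close> turns the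
  imaginary part of \<open>z\<close> into the coercivity constant \<open>\<bar>Im z\<bar>\<close>,
  while \<open>T\<close> contributes nothing to the real part of the form.\<close>

lemma self_adjoint_spectrum_real:
  assumes T: "bounded_operator V T" "self_adjoint V T" and z: "z \<in> spectrum V T"
  shows "z \<in> \<real>"
proof (rule ccontr)
  assume "z \<notin> \<real>"
  then have Im: "Im z \<noteq> 0"
    by (simp add: complex_is_Real_iff)
  define c where "c = - \<i> * complex_of_real (sgn (Im z))"
  have bo: "bounded_operator V (\<lambda>f x. z * f x - T f x)"
    by (rule bounded_operator_shift[OF T(1)])
  have "op_invertible V (\<lambda>f x. c * (z * f x - T f x))"
  proof (rule coercive_invertible)
    show "bounded_operator V (\<lambda>f x. c * (z * f x - T f x))"
      by (rule bounded_operator_cmult[OF bo])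
    show "\<bar>Im z\<bar> > 0"
      using Im by simp
    fix f assume f: "f \<in> ell2 V"
    have "re_inner (\<lambda>x. c * (z * f x - T f x)) f
        = re_inner (\<lambda>x. (c * z) * f x - c * T f x) f"
      by (simp add: algebra_simps)
    also have "\<dots> = re_inner (\<lambda>x. (c * z) * f x) f - re_inner (\<lambda>x. c * T f x) f"
      by (intro re_inner_diff_left[where V = V] ell2_cmult f bounded_operatorD(1)[OF T(1)])
    also have "re_inner (\<lambda>x. c * T f x) f = 0"
      using self_adjoint_re_inner_imaginary[OF T f, of "- sgn (Im z)"] by (simp add: c_def)
    finally have "re_inner (\<lambda>x. c * (z * f x - T f x)) f = Re (c * z) * (ell2_norm f)\<^sup>2"
      by (simp only: re_inner_cmult_self diff_zero)
    moreover have "Re (c * z) = \<bar>Im z\<bar>"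
      by (simp add: c_def abs_sgn mult.commute)
    ultimately show "\<bar>Im z\<bar> * (ell2_norm f)\<^sup>2 \<le> re_inner (\<lambda>x. c * (z * f x - T f x)) f"
      by simp
  qed
  then have "op_invertible V (\<lambda>f x. z * f x - T f x)"
    by (rule op_invertible_cmultD[OF _ bo]) (use Im in \<open>auto simp: c_def sgn_eq_0_iff\<close>)
  then show False
    using z by (simp add: spectrum_iff)
qed

text \<open>For \<open>t < a\<close> the operator \<open>T - t\<close> is coercive with constant
  \<open>a - t\<close>, hence invertible. The next lemma is the mirror image.\<close>

lemma spectrum_ge:
  assumes T: "bounded_operator V T"
    and le: "\<And>f. f \<in> ell2 V \<Longrightarrow> a * (ell2_norm f)\<^sup>2 \<le> re_inner (T f) f"
    and z: "complex_of_real t \<in> spectrum V T"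
  shows "a \<le> t"
proof (rule ccontr)
  assume "\<not> a \<le> t"
  have bo: "bounded_operator V (\<lambda>f x. complex_of_real t * f x - T f x)"
    by (rule bounded_operator_shift[OF T])
  have "op_invertible V (\<lambda>f x. - 1 * (complex_of_real t * f x - T f x))"
  proof (rule coercive_invertible[where c = "a - t"])
    show "bounded_operator V (\<lambda>f x. - 1 * (complex_of_real t * f x - T f x))"
      by (rule bounded_operator_cmult[OF bo])
    show "a - t > 0"
      using \<open>\<not> a \<le> t\<close> by simp
    fix f assume f: "f \<in> ell2 V"
    have "re_inner (\<lambda>x. - 1 * (complex_of_real t * f x - T f x)) f
        = re_inner (\<lambda>x. T f x - complex_of_real t * f x) f"
      by (simp add: algebra_simps)
    also have "\<dots> = re_inner (T f) f - re_inner (\<lambda>x. complex_of_real t * f x) f"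
      by (intro re_inner_diff_left[where V = V] ell2_cmult f bounded_operatorD(1)[OF T])
    finally show "(a - t) * (ell2_norm f)\<^sup>2 \<le> re_inner (\<lambda>x. - 1 * (complex_of_real t * f x - T f x)) f"
      using le[OF f] by (simp add: re_inner_cmult_self algebra_simps)
  qed
  then have "op_invertible V (\<lambda>f x. complex_of_real t * f x - T f x)"
    by (rule op_invertible_cmultD[OF _ bo]) simp
  then show False
    using z by (simp add: spectrum_iff)
qed

lemma spectrum_le:
  assumes T: "bounded_operator V T"
    and le: "\<And>f. f \<in> ell2 V \<Longrightarrow> re_inner (T f) f \<le> b * (ell2_norm f)\<^sup>2"
    and z: "complex_of_real t \<in> spectrum V T"
  shows "t \<le> b"
proof (rule ccontr)
  assume "\<not> t \<le> b"
  have "op_invertible V (\<lambda>f x. complex_of_real t * f x - T f x)"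
  proof (rule coercive_invertible[where c = "t - b"])
    show "bounded_operator V (\<lambda>f x. complex_of_real t * f x - T f x)"
      by (rule bounded_operator_shift[OF T])
    show "t - b > 0"
      using \<open>\<not> t \<le> b\<close> by simp
    fix f assume f: "f \<in> ell2 V"
    have "re_inner (\<lambda>x. complex_of_real t * f x - T f x) f
        = re_inner (\<lambda>x. complex_of_real t * f x) f - re_inner (T f) f"
      by (intro re_inner_diff_left[where V = V] ell2_cmult f bounded_operatorD(1)[OF T])
    then show "(t - b) * (ell2_norm f)\<^sup>2 \<le> re_inner (\<lambda>x. complex_of_real t * f x - T f x) f"
      using le[OF f] by (simp add: re_inner_cmult_self algebra_simps)
  qed
  then show False
    using z by (simp add: spectrum_iff)
qed

text \<open>This gives the compact interval on which a continuous function is approximated by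
  polynomials.\<close>

lemma spectrum_bounded:
  assumes T: "bounded_operator V T"
  obtains M where "M > 0" "\<And>t. complex_of_real t \<in> spectrum V T \<Longrightarrow> \<bar>t\<bar> \<le> M"
proof -
  obtain M where M: "M > 0" "\<And>f. f \<in> ell2 V \<Longrightarrow> ell2_norm (T f) \<le> M * ell2_norm f"
    using bounded_operator_bound[OF T] by blast
  have *: "\<bar>re_inner (T f) f\<bar> \<le> M * (ell2_norm f)\<^sup>2" if f: "f \<in> ell2 V" for f
  proof -
    have "\<bar>re_inner (T f) f\<bar> \<le> ell2_norm (T f) * ell2_norm f"
      by (rule re_inner_le_norms[OF bounded_operatorD(1)[OF T f] f])
    also have "\<dots> \<le> (M * ell2_norm f) * ell2_norm f"
      by (intro mult_right_mono M f) simp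
    finally show ?thesis
      by (simp add: power2_eq_square mult.assoc)
  qed
  have "\<bar>t\<bar> \<le> M" if t: "complex_of_real t \<in> spectrum V T" for t
  proof -
    have "t \<le> M"
      by (rule spectrum_le[OF T _ t]) (use * in \<open>auto simp: abs_le_iff\<close>)
    moreover have "- M \<le> t"
    proof (rule spectrum_ge[OF T _ t])
      show "- M * (ell2_norm f)\<^sup>2 \<le> re_inner (T f) f" if "f \<in> ell2 V" for f
        using *[OF that] by linarith
    qed
    ultimately show ?thesis
      by linarith
  qed
  then show ?thesis
    using that M(1) by blast
qed

text \<open>Nonnegativity is tested on \<open>f - s C f\<close> with \<open>s\<close> the inverse of a bound for \<open>C\<close>.\<close>

lemma norm_square_le_quadratic_form:
  assumes C: "bounded_operator V C" "self_adjoint V C"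
    and pos: "\<And>f. f \<in> ell2 V \<Longrightarrow> 0 \<le> re_inner (C f) f"
    and M: "M > 0" "\<And>f. f \<in> ell2 V \<Longrightarrow> ell2_norm (C f) \<le> M * ell2_norm f"
    and f: "f \<in> ell2 V"
  shows "(ell2_norm (C f))\<^sup>2 \<le> M * re_inner (C f) f"
proof -
  define s where "s = 1 / M"
  let ?g = "\<lambda>x. complex_of_real s * C f x"
  have Cf: "C f \<in> ell2 V" and CCf: "C (C f) \<in> ell2 V"
    using bounded_operatorD(1)[OF C(1)] f by auto
  have g: "?g \<in> ell2 V"
    by (rule ell2_cmult[OF Cf])
  have sCCf: "(\<lambda>x. complex_of_real s * C (C f) x) \<in> ell2 V"
    by (rule ell2_cmult[OF CCf])
  have "0 \<le> re_inner (C (\<lambda>x. f x - ?g x)) (\<lambda>x. f x - ?g x)"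
    by (rule pos[OF ell2_diff[OF f g]])
  also have "C (\<lambda>x. f x - ?g x) = (\<lambda>x. C f x - complex_of_real s * C (C f) x)"
    using bounded_operator_diff[OF C(1) f g] bounded_operatorD(3)[OF C(1) Cf] by simp
  also have "re_inner \<dots> (\<lambda>x. f x - ?g x)
      = re_inner (C f) f - s * re_inner (C f) (C f) - s * re_inner (C (C f)) f
        + s * s * re_inner (C (C f)) (C f)"
    unfolding re_inner_diff_left[OF Cf sCCf ell2_diff[OF f g]] re_inner_diff_right[OF Cf f g]
      re_inner_diff_right[OF sCCf f g] re_inner_scaleR_left re_inner_scaleR_right
    by (simp add: algebra_simps)
  also have "re_inner (C (C f)) f = re_inner (C f) (C f)"
    by (rule self_adjointD[OF C(2) Cf f])
  finally have 1: "0 \<le> re_inner (C f) f - 2 * s * (ell2_norm (C f))\<^sup>2 + s * s * re_inner (C (C f)) (C f)"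
    by (simp add: ell2_norm_square)
  have "re_inner (C (C f)) (C f) \<le> ell2_norm (C (C f)) * ell2_norm (C f)"
    using re_inner_le_norms[OF CCf Cf] by linarith
  also have "\<dots> \<le> (M * ell2_norm (C f)) * ell2_norm (C f)"
    by (intro mult_right_mono M Cf) simp
  finally have "s * s * re_inner (C (C f)) (C f) \<le> s * s * (M * (ell2_norm (C f))\<^sup>2)"
    by (intro mult_left_mono) (auto simp: power2_eq_square mult.assoc)
  also have "\<dots> = s * (ell2_norm (C f))\<^sup>2"
    using M(1) by (simp add: s_def)
  finally have "s * (ell2_norm (C f))\<^sup>2 \<le> re_inner (C f) f"
    using 1 by linarith
  then show ?thesis
    using M(1) by (simp add: s_def field_simps)
qed

text \<open>The converse of \<open>coercive_invertible\<close> for nonnegative self-adjoint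
  operators: a bound \<open>D\<close> of the inverse controls the norm of \<open>f\<close> by that
  of \<open>C f\<close>, and the square of the latter is controlled by the quadratic form.\<close>

lemma positive_invertible_coercive:
  assumes C: "bounded_operator V C" "self_adjoint V C"
    and pos: "\<And>f. f \<in> ell2 V \<Longrightarrow> 0 \<le> re_inner (C f) f"
    and inv: "op_invertible V C"
  obtains c where "c > 0" "\<And>f. f \<in> ell2 V \<Longrightarrow> c * (ell2_norm f)\<^sup>2 \<le> re_inner (C f) f"
proof -
  obtain M where M: "M > 0" "\<And>f. f \<in> ell2 V \<Longrightarrow> ell2_norm (C f) \<le> M * ell2_norm f"
    using bounded_operator_bound[OF C(1)] by blast
  obtain S where S: "bounded_operator V S" "\<And>f. f \<in> ell2 V \<Longrightarrow> S (C f) = f"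
    using inv by (auto simp: op_invertible_def)
  obtain D where D: "D > 0" "\<And>f. f \<in> ell2 V \<Longrightarrow> ell2_norm (S f) \<le> D * ell2_norm f"
    using bounded_operator_bound[OF S(1)] by blast
  show ?thesis
  proof
    show "1 / (M * D\<^sup>2) > 0"
      using M D by simp
    fix f assume f: "f \<in> ell2 V"
    have "ell2_norm f \<le> D * ell2_norm (C f)"
      using D(2)[OF bounded_operatorD(1)[OF C(1) f]] S(2)[OF f] by simp
    then have "(ell2_norm f)\<^sup>2 \<le> (D * ell2_norm (C f))\<^sup>2"
      by (intro power_mono) auto
    also have "\<dots> = D\<^sup>2 * (ell2_norm (C f))\<^sup>2"
      by (rule power_mult_distrib)
    also have "\<dots> \<le> D\<^sup>2 * (M * re_inner (C f) f)"
      by (intro mult_left_mono norm_square_le_quadratic_form[OF C pos M f]) auto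
    finally show "1 / (M * D\<^sup>2) * (ell2_norm f)\<^sup>2 \<le> re_inner (C f) f"
      using M(1) D(1) by (simp add: field_simps)
  qed
qed

lemma re_inner_poly_op:
  assumes T: "bounded_operator V T" "self_adjoint V T" and "f \<in> ell2 V" "g \<in> ell2 V"
  shows "re_inner (poly_op p T f) g = re_inner f (poly_op (map_poly cnj p) T g)"
  using assms(3,4)
proof (induction p arbitrary: f)
  case 0
  then show ?case
    by (simp add: re_inner_def)
next
  case (pCons a p)
  let ?p = "map_poly cnj p"
  note mem = bounded_operatorD(1)[OF bounded_operator_poly[OF T(1)]] bounded_operatorD(1)[OF T(1)]
  have "re_inner (poly_op (pCons a p) T f) g
      = re_inner (\<lambda>x. a * f x) g + re_inner (poly_op p T (T f)) g"
    unfolding poly_op_pCons by (intro re_inner_add_left[where V = V] ell2_cmult mem pCons.prems)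
  also have "re_inner (poly_op p T (T f)) g = re_inner (T f) (poly_op ?p T g)"
    by (intro pCons.IH mem pCons.prems)
  also have "\<dots> = re_inner f (T (poly_op ?p T g))"
    by (intro self_adjointD[OF T(2)] mem pCons.prems)
  also have "T (poly_op ?p T g) = poly_op ?p T (T g)"
    by (rule poly_op_commute[OF T(1) pCons.prems(2), symmetric])
  also have "re_inner (\<lambda>x. a * f x) g + re_inner f (poly_op ?p T (T g))
      = re_inner f (\<lambda>x. cnj a * g x + poly_op ?p T (T g) x)"
    unfolding re_inner_cmult by (intro re_inner_add_right[where V = V, symmetric] ell2_cmult mem pCons.prems)
  also have "(\<lambda>x. cnj a * g x + poly_op ?p T (T g) x) = poly_op (map_poly cnj (pCons a p)) T g"
    by (simp add: map_poly_pCons poly_op_pCons)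
  finally show ?case .
qed

lemma ell2_exists_unit:
  assumes "V \<noteq> {}"
  obtains f where "f \<in> ell2 V" "ell2_norm f = 1"
proof -
  obtain x where "x \<in> V"
    using assms by blast
  then show ?thesis
    using that[OF ell2_indicator ell2_norm_indicator] by blast
qed

text \<open>
  For a real polynomial \<open>q\<close>, the supremum \<open>\<lambda>\<close> of the quadratic form of \<open>q(T)\<close> on the unit sphere is a
  value of \<open>q\<close> on the spectrum: otherwise the nonnegative operator \<open>\<lambda> - q(T)\<close> would be invertible,
  hence bounded below.
\<close>

lemma quadratic_form_sup:
  assumes T: "bounded_operator V T" "self_adjoint V T" and V: "V \<noteq> {}"
    and real: "map_poly cnj q = q"
  obtains l where "\<And>f. f \<in> ell2 V \<Longrightarrow> re_inner (poly_op q T f) f \<le> l * (ell2_norm f)\<^sup>2"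
    and "q = [:complex_of_real l:] \<or>
      (\<exists>t. complex_of_real t \<in> spectrum V T \<and> poly q (complex_of_real t) = complex_of_real l)"
proof -
  let ?B = "poly_op q T" and ?U = "{f \<in> ell2 V. ell2_norm f = 1}"
  have B: "bounded_operator V ?B"
    by (rule bounded_operator_poly[OF T(1)])
  obtain M where M: "\<And>f. f \<in> ell2 V \<Longrightarrow> ell2_norm (?B f) \<le> M * ell2_norm f"
    using bounded_operator_bound[OF B] by blast
  have bdd: "bdd_above ((\<lambda>f. re_inner (?B f) f) ` ?U)"
  proof (rule bdd_aboveI2)
    fix f assume f: "f \<in> ?U"
    then show "re_inner (?B f) f \<le> M"
      using M[of f] re_inner_le_norms[of "?B f" V f V] bounded_operatorD(1)[OF B, of f] by auto
  qed
  define l where "l = (SUP f\<in>?U. re_inner (?B f) f)"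
  have upper: "re_inner (?B f) f \<le> l * (ell2_norm f)\<^sup>2" if f: "f \<in> ell2 V" for f
  proof (cases "ell2_norm f = 0")
    case True
    then have "f = (\<lambda>x. 0)"
      using ell2_norm_eq_0[OF f] by simp
    then show ?thesis
      using bounded_operator_zero[OF B] by (simp add: re_inner_def)
  next
    case False
    define r where "r = 1 / ell2_norm f"
    let ?g = "\<lambda>x. complex_of_real r * f x"
    have "cmod (complex_of_real r) = 1 / ell2_norm f"
      unfolding r_def by (simp add: norm_divide)
    then have "?g \<in> ?U"
      using False by (auto simp: ell2_norm_cmult intro: ell2_cmult[OF f])
    then have "re_inner (?B ?g) ?g \<le> l"
      unfolding l_def by (rule cSUP_upper[OF _ bdd])
    then have "r * r * re_inner (?B f) f \<le> l"
      unfolding bounded_operatorD(3)[OF B f] re_inner_scaleR_left re_inner_scaleR_right by simp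
    then show ?thesis
      using False ell2_norm_nonneg[of f] by (simp add: r_def field_simps power2_eq_square)
  qed
  let ?r = "[:complex_of_real l:] - q"
  let ?C = "poly_op ?r T"
  have C_eq: "?C f = (\<lambda>x. complex_of_real l * f x - ?B f x)" for f
    by (simp add: poly_op_diff poly_op_pCons)
  have C: "bounded_operator V ?C"
    by (rule bounded_operator_poly[OF T(1)])
  have "cnj (coeff q n) = coeff q n" for n
    using arg_cong[OF real, of "\<lambda>p. coeff p n"] by (simp add: coeff_map_poly)
  then have "map_poly cnj ?r = ?r"
    by (intro poly_eqI) (simp add: coeff_map_poly coeff_pCons split: nat.split)
  then have sa: "self_adjoint V ?C"
    unfolding self_adjoint_def using re_inner_poly_op[OF T, where p = ?r] by simp
  have form: "re_inner (?C f) f = l * (ell2_norm f)\<^sup>2 - re_inner (?B f) f" if f: "f \<in> ell2 V" for f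
  proof -
    have "re_inner (?C f) f = re_inner (\<lambda>x. complex_of_real l * f x) f - re_inner (?B f) f"
      unfolding C_eq by (intro re_inner_diff_left[where V = V] ell2_cmult bounded_operatorD(1)[OF B] f)
    then show ?thesis
      by (simp add: re_inner_cmult_self)
  qed
  have not_inv: "\<not> op_invertible V ?C"
  proof
    assume "op_invertible V ?C"
    then obtain c where c: "c > 0" "\<And>f. f \<in> ell2 V \<Longrightarrow> c * (ell2_norm f)\<^sup>2 \<le> re_inner (?C f) f"
      by (rule positive_invertible_coercive[OF C sa, rotated]) (use form upper in auto)
    have "l \<le> l - c"
      unfolding l_def
    proof (rule cSUP_least)
      show "?U \<noteq> {}"
        using ell2_exists_unit[OF V] by blast
      fix f assume "f \<in> ?U"
      then show "re_inner (?B f) f \<le> (SUP f\<in>?U. re_inner (?B f) f) - c"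
        using c(2)[of f] form[of f] by (simp add: l_def)
    qed
    then show False
      using c(1) by simp
  qed
  show ?thesis
  \<comment> \<open>A constant \<open>q\<close> makes \<open>?r\<close> the zero polynomial, which
    has no factorisation to locate a spectral point; this is the first alternative of the
    conclusion.\<close>
  proof (cases "?r = 0")
    case True
    then show ?thesis
      using that[of l] upper by simp
  next
    case False
    then obtain z where z: "poly ?r z = 0" "z \<in> spectrum V T"
      using poly_op_invertible[OF T(1) False] not_inv by blast
    moreover have "z \<in> \<real>"
      by (rule self_adjoint_spectrum_real[OF T z(2)])
    ultimately obtain t where "z = complex_of_real t"
      by (auto elim: Reals_cases)
    with z show ?thesis
      using that[of l] upper by auto
  qed
qed

text \<open>For the polynomial \<open>[:0, 1:]\<close> the constant alternative of
  \<open>quadratic_form_sup\<close> is impossible, so a spectral point is left.\<close>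

lemma self_adjoint_spectrum_nonempty:
  assumes "bounded_operator V T" "self_adjoint V T" "V \<noteq> {}"
  shows "\<exists>t. complex_of_real t \<in> spectrum V T"
proof -
  have real: "map_poly cnj [:0, 1:] = [:0, 1:]"
    by (simp add: map_poly_pCons)
  obtain l where "[:0, 1:] = [:complex_of_real l:] \<or>
      (\<exists>t. complex_of_real t \<in> spectrum V T \<and> poly [:0, 1:] (complex_of_real t) = complex_of_real l)"
    by (rule quadratic_form_sup[OF assms real])
  then show ?thesis
    by auto
qed

text \<open>The squared norm of \<open>p(T) f\<close> is the quadratic form of \<open>q(T)\<close>,
  where \<open>q\<close> is \<open>p\<close> times its conjugate. This \<open>q\<close> is a real
  polynomial that equals the squared modulus of \<open>p\<close> on the real line, so
  \<open>quadratic_form_sup\<close> bounds the form by a value attained on the spectrum.\<close>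

theorem poly_op_norm_le:
  assumes T: "bounded_operator V T" "self_adjoint V T" and V: "V \<noteq> {}"
    and le: "\<And>t. complex_of_real t \<in> spectrum V T \<Longrightarrow> cmod (poly p (complex_of_real t)) \<le> c"
    and f: "f \<in> ell2 V"
  shows "ell2_norm (poly_op p T f) \<le> c * ell2_norm f"
proof -
  define q where "q = map_poly cnj p * p"
  have q: "poly q (complex_of_real t) = complex_of_real ((cmod (poly p (complex_of_real t)))\<^sup>2)" for t
    by (simp add: q_def mult.commute del: of_real_power) (simp only: complex_norm_square)
  have "map_poly cnj q = q"
  proof -
    have "poly (map_poly cnj q) = poly q"
      by (rule ext) (simp add: q_def mult.commute)
    then show ?thesis
      by (simp only: poly_eq_poly_eq_iff)
  qed
  then obtain l where l: "\<And>f. f \<in> ell2 V \<Longrightarrow> re_inner (poly_op q T f) f \<le> l * (ell2_norm f)\<^sup>2"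
    "q = [:complex_of_real l:] \<or>
      (\<exists>t. complex_of_real t \<in> spectrum V T \<and> poly q (complex_of_real t) = complex_of_real l)"
    using quadratic_form_sup[OF T V] by blast
  \<comment> \<open>If \<open>q\<close> is constant, any spectral point yields the value
    \<open>l\<close>, and nonemptiness of the spectrum supplies one.\<close>
  obtain t where t: "complex_of_real t \<in> spectrum V T" "poly q (complex_of_real t) = complex_of_real l"
    using l(2) self_adjoint_spectrum_nonempty[OF T V] by auto
  have "c \<ge> 0"
    using le[OF t(1)] norm_ge_zero order_trans by blast
  have "l = (cmod (poly p (complex_of_real t)))\<^sup>2"
    using t(2) unfolding q by (simp only: of_real_eq_iff)
  also have "\<dots> \<le> c\<^sup>2"
    by (intro power_mono le t) simp
  finally have "l \<le> c\<^sup>2" .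
  have pf: "poly_op p T f \<in> ell2 V"
    by (rule bounded_operatorD(1)[OF bounded_operator_poly[OF T(1)] f])
  have "(ell2_norm (poly_op p T f))\<^sup>2 = re_inner f (poly_op (map_poly cnj p) T (poly_op p T f))"
    unfolding ell2_norm_square by (rule re_inner_poly_op[OF T f pf])
  also have "\<dots> = re_inner (poly_op q T f) f"
    unfolding q_def poly_op_mult[OF T(1) f] by (rule re_inner_commute)
  also have "\<dots> \<le> l * (ell2_norm f)\<^sup>2"
    by (rule l(1)[OF f])
  also have "\<dots> \<le> c\<^sup>2 * (ell2_norm f)\<^sup>2"
    by (intro mult_right_mono \<open>l \<le> c\<^sup>2\<close>) simp
  finally have "(ell2_norm (poly_op p T f))\<^sup>2 \<le> (c * ell2_norm f)\<^sup>2"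
    by (simp add: power_mult_distrib)
  then show ?thesis
    by (rule power2_le_imp_le) (use \<open>c \<ge> 0\<close> in simp)
qed

section \<open>Continuous functional calculus\<close>

lemma complex_polynomial_approximation:
  fixes \<phi> :: "real \<Rightarrow> complex"
  assumes "continuous_on {a..b} \<phi>" "e > 0"
  shows "\<exists>p. \<forall>t\<in>{a..b}. cmod (poly p (complex_of_real t) - \<phi> t) < e"
proof -
  have *: "\<exists>p. \<forall>t\<in>{a..b}. cmod (poly p (complex_of_real t) - complex_of_real (\<psi> t)) < e / 2"
    if cont: "continuous_on {a..b} \<psi>" for \<psi> :: "real \<Rightarrow> real"
  proof -
    obtain g where g: "real_polynomial_function g" "\<And>t. t \<in> {a..b} \<Longrightarrow> \<bar>\<psi> t - g t\<bar> < e / 2"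
      using Stone_Weierstrass_real_polynomial_function[OF compact_Icc cont, of "e / 2"] \<open>e > 0\<close>
      by auto
    obtain c n where c: "g = (\<lambda>t. \<Sum>i\<le>n. c i * t ^ i)"
      using g(1) real_polynomial_function_iff_sum by auto
    define p where "p = (\<Sum>i\<le>n. monom (complex_of_real (c i)) i)"
    have "poly p (complex_of_real t) = complex_of_real (g t)" for t
      by (simp add: p_def c poly_sum poly_monom)
    then have "cmod (poly p (complex_of_real t) - complex_of_real (\<psi> t)) = \<bar>\<psi> t - g t\<bar>" for t
      by (metis abs_minus_commute norm_of_real of_real_diff)
    then show ?thesis
      using g(2) by metis
  qed
  obtain p where p: "\<And>t. t \<in> {a..b} \<Longrightarrow> cmod (poly p (complex_of_real t) - complex_of_real (Re (\<phi> t))) < e / 2"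
    using *[OF continuous_on_Re[OF assms(1)]] by blast
  obtain q where q: "\<And>t. t \<in> {a..b} \<Longrightarrow> cmod (poly q (complex_of_real t) - complex_of_real (Im (\<phi> t))) < e / 2"
    using *[OF continuous_on_Im[OF assms(1)]] by blast
  have "cmod (poly (p + smult \<i> q) (complex_of_real t) - \<phi> t) < e" if t: "t \<in> {a..b}" for t
  proof -
    have "poly (p + smult \<i> q) (complex_of_real t) - \<phi> t
        = (poly p (complex_of_real t) - complex_of_real (Re (\<phi> t)))
          + \<i> * (poly q (complex_of_real t) - complex_of_real (Im (\<phi> t)))"
      by (subst complex_eq[of "\<phi> t"]) (simp add: algebra_simps)
    then have "cmod (poly (p + smult \<i> q) (complex_of_real t) - \<phi> t)
        \<le> cmod (poly p (complex_of_real t) - complex_of_real (Re (\<phi> t)))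
          + cmod (poly q (complex_of_real t) - complex_of_real (Im (\<phi> t)))"
      using norm_triangle_ineq by (metis (no_types) mult_1 norm_ii norm_mult)
    then show ?thesis
      using p[OF t] q[OF t] by linarith
  qed
  then show ?thesis
    by blast
qed

lemma complex_polynomial_uniform_limit:
  fixes \<phi> :: "real \<Rightarrow> complex"
  assumes "continuous_on {a..b} \<phi>"
  obtains P where "uniform_limit {a..b} (\<lambda>k t. poly (P k) (complex_of_real t)) \<phi> sequentially"
proof -
  have "\<exists>P. \<forall>k::nat. \<forall>t\<in>{a..b}. cmod (poly (P k) (complex_of_real t) - \<phi> t) < inverse (real (Suc k))"
    by (intro choice allI complex_polynomial_approximation assms) simp
  then obtain P where P: "\<And>k t. t \<in> {a..b} \<Longrightarrow>
      cmod (poly (P k) (complex_of_real t) - \<phi> t) < inverse (real (Suc k))"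
    by blast
  have "uniform_limit {a..b} (\<lambda>k t. poly (P k) (complex_of_real t)) \<phi> sequentially"
  proof (rule uniform_limitI)
    fix e :: real assume "e > 0"
    then have "\<forall>\<^sub>F k in sequentially. inverse (real (Suc k)) < e"
      using LIMSEQ_inverse_real_of_nat by (rule order_tendstoD[rotated])
    then show "\<forall>\<^sub>F k in sequentially. \<forall>t\<in>{a..b}. dist (poly (P k) (complex_of_real t)) (\<phi> t) < e"
      by eventually_elim (use P less_trans in \<open>fastforce simp: dist_norm\<close>)
  qed
  then show ?thesis
    by (rule that)
qed

definition is_fun_calc :: "'a set \<Rightarrow> (real \<Rightarrow> complex) \<Rightarrow> 'a operator \<Rightarrow> 'a operator \<Rightarrow> bool" where
  "is_fun_calc V \<phi> T S \<longleftrightarrow> S \<in> extensional (ell2 V) \<and> bounded_operator V S \<and>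
     (\<forall>p. uniform_limit {t. complex_of_real t \<in> spectrum V T}
             (\<lambda>k t. poly (p k) (complex_of_real t)) \<phi> sequentially \<longrightarrow>
          (\<lambda>k. op_norm V (\<lambda>f x. poly_op (p k) T f x - S f x)) \<longlonglongrightarrow> 0)"

lemma fun_calc_eq_The: "fun_calc V \<phi> T = (THE S. is_fun_calc V \<phi> T S)"
  by (simp add: fun_calc_def is_fun_calc_def)

lemma poly_op_norm_diff_le:
  assumes T: "bounded_operator V T" "self_adjoint V T" "V \<noteq> {}"
    and le: "\<And>t. complex_of_real t \<in> spectrum V T \<Longrightarrow>
      cmod (poly p (complex_of_real t) - poly q (complex_of_real t)) \<le> c"
    and f: "f \<in> ell2 V"
  shows "ell2_norm (\<lambda>x. poly_op p T f x - poly_op q T f x) \<le> c * ell2_norm f"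
  using poly_op_norm_le[OF T, of "p - q" c f] le f by (simp add: poly_op_diff)

text \<open>By \<open>poly_op_norm_le\<close> the operators \<open>P k (T)\<close> form a Cauchy
  sequence uniformly on the unit ball, and completeness gives the limit operator. The defining
  property speaks about all approximating sequences, so a second sequence has to be compared with
  \<open>P\<close>.\<close>

theorem ex_is_fun_calc:
  assumes T: "bounded_operator V T" "self_adjoint V T" "V \<noteq> {}"
    and P: "uniform_limit {t. complex_of_real t \<in> spectrum V T}
      (\<lambda>k t. poly (P k) (complex_of_real t)) \<phi> sequentially"
  shows "\<exists>S. is_fun_calc V \<phi> T S"
proof -
  let ?K = "{t. complex_of_real t \<in> spectrum V T}"
  have mem: "poly_op p T f \<in> ell2 V" if "f \<in> ell2 V" for p f
    by (rule bounded_operatorD(1)[OF bounded_operator_poly[OF T(1)] that])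
  \<comment> \<open>This estimate is used twice: with both polynomials from \<open>P\<close> it
    gives the Cauchy property, with \<open>p k\<close> against \<open>P k\<close> the independence
    of the chosen sequence.\<close>
  have near: "ell2_norm (\<lambda>x. poly_op p T f x - poly_op q T f x) \<le> 2 * e * ell2_norm f"
    if "\<forall>t\<in>?K. dist (poly p (complex_of_real t)) (\<phi> t) < e"
      "\<forall>t\<in>?K. dist (poly q (complex_of_real t)) (\<phi> t) < e" "f \<in> ell2 V" for p q e f
  proof (rule poly_op_norm_diff_le[OF T _ that(3)])
    fix t assume "complex_of_real t \<in> spectrum V T"
    then show "cmod (poly p (complex_of_real t) - poly q (complex_of_real t)) \<le> 2 * e"
      using that(1,2) dist_triangle2[of "poly p (complex_of_real t)" "poly q (complex_of_real t)" "\<phi> t"]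
      by (force simp: dist_norm)
  qed
  have cau: "\<exists>N. \<forall>k\<ge>N. \<forall>l\<ge>N. \<forall>f\<in>ell2 V.
      ell2_norm (\<lambda>x. poly_op (P k) T f x - poly_op (P l) T f x) \<le> e * ell2_norm f"
    if "e > 0" for e
  proof -
    have "\<forall>\<^sub>F k in sequentially. \<forall>t\<in>?K. dist (poly (P k) (complex_of_real t)) (\<phi> t) < e / 2"
      by (rule uniform_limitD[OF P]) (use that in simp)
    then obtain N where N: "\<And>k. k \<ge> N \<Longrightarrow> \<forall>t\<in>?K. dist (poly (P k) (complex_of_real t)) (\<phi> t) < e / 2"
      unfolding eventually_sequentially by blast
    then show ?thesis
      using near[OF N N] by (intro exI[of _ N]) simp
  qed
  define F where "F f k = Abs_l2 (poly_op (P k) T f)" for f k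
  have F_diff: "ell2_norm (\<lambda>x. poly_op (P k) T f x - poly_op (P l) T f x) = norm (F f k - F f l)"
    if "f \<in> ell2 V" for f k l
    by (simp add: F_def ell2_norm_Abs[OF ell2_diff[OF mem mem]] Abs_l2_linear[OF mem mem] that)
  have "\<exists>L. L \<in> {F. coord F \<in> ell2 V} \<and> F f \<longlonglongrightarrow> L" if f: "f \<in> ell2 V" for f
  proof -
    have "Cauchy (F f)"
    proof (rule metric_CauchyI)
      fix e :: real assume "e > 0"
      define d where "d = e / (ell2_norm f + 1)"
      have "ell2_norm f + 1 > 0"
        using ell2_norm_nonneg[of f] by linarith
      then have d: "d > 0" "d * ell2_norm f < e"
        using \<open>e > 0\<close> by (auto simp: d_def field_simps)
      obtain N where "\<And>k l. k \<ge> N \<Longrightarrow> l \<ge> N \<Longrightarrow> norm (F f k - F f l) \<le> d * ell2_norm f"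
        using cau[OF d(1)] f unfolding F_diff[OF f, symmetric] by blast
      then show "\<exists>N. \<forall>k\<ge>N. \<forall>l\<ge>N. dist (F f k) (F f l) < e"
        using d(2) by (metis dist_norm le_less_trans)
    qed
    moreover have "F f k \<in> {F. coord F \<in> ell2 V}" for k
      using mem[OF f] by (simp add: F_def coord_Abs_l2[OF mem[OF f]])
    ultimately show ?thesis
      using complete_ell2[of V] unfolding complete_def by blast
  qed
  then obtain L where L: "\<And>f. f \<in> ell2 V \<Longrightarrow> coord (L f) \<in> ell2 V" "\<And>f. f \<in> ell2 V \<Longrightarrow> F f \<longlonglongrightarrow> L f"
    by (metis mem_Collect_eq)
  define S where "S = restrict (\<lambda>f. coord (L f)) (ell2 V)"
  have S: "S f \<in> ell2 V" "S f = coord (L f)" if "f \<in> ell2 V" for f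
    using that L(1) by (auto simp: S_def)
  have lim: "\<exists>N. \<forall>k\<ge>N. \<forall>f\<in>ell2 V. ell2_norm (\<lambda>x. poly_op (P k) T f x - S f x) \<le> e * ell2_norm f"
    if e: "e > 0" for e
  proof -
    obtain N where N: "\<And>k l f. k \<ge> N \<Longrightarrow> l \<ge> N \<Longrightarrow> f \<in> ell2 V \<Longrightarrow> norm (F f k - F f l) \<le> e * ell2_norm f"
      using cau[OF e] by (auto simp: F_diff)
    have "ell2_norm (\<lambda>x. poly_op (P k) T f x - S f x) \<le> e * ell2_norm f" if "k \<ge> N" and f: "f \<in> ell2 V" for k f
    proof -
      have "(\<lambda>l. norm (F f k - F f l)) \<longlonglongrightarrow> norm (F f k - L f)"
        by (intro tendsto_intros L f)
      then have "norm (F f k - L f) \<le> e * ell2_norm f"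
        by (rule LIMSEQ_le_const2) (use N that in blast)
      moreover have "coord (F f k - L f) = (\<lambda>x. poly_op (P k) T f x - S f x)"
        by (simp add: coord_diff F_def S[OF f] coord_Abs_l2[OF mem[OF f]])
      ultimately show ?thesis
        by (simp add: norm_l2_coord)
    qed
    then show ?thesis
      by blast
  qed
  have pointwise: "(\<lambda>k. poly_op (P k) T f x) \<longlonglongrightarrow> S f x" if f: "f \<in> ell2 V" for f x
  proof -
    have lim0: "(\<lambda>k. norm (F f k - L f)) \<longlonglongrightarrow> 0"
      using L(2)[OF f] by (simp add: LIM_zero_iff tendsto_norm_zero_iff)
    have "cmod (poly_op (P k) T f x - S f x) \<le> norm (F f k - L f)" for k
      using cmod_le_ell2_norm[OF coord_ell2[of "F f k - L f"], of x]
      by (simp add: norm_l2_coord F_def S[OF f] coord_Abs_l2[OF mem[OF f]])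
    then have "(\<lambda>k. poly_op (P k) T f x - S f x) \<longlonglongrightarrow> 0"
      by (intro Lim_null_comparison[OF _ lim0] always_eventually) blast
    then show ?thesis
      by (simp add: LIM_zero_iff)
  qed
  have bS: "bounded_operator V S"
  proof -
    obtain N where N: "\<And>f. f \<in> ell2 V \<Longrightarrow> ell2_norm (\<lambda>x. poly_op (P N) T f x - S f x) \<le> 1 * ell2_norm f"
      using lim[of 1] by auto
    obtain C where C: "\<And>f. f \<in> ell2 V \<Longrightarrow> ell2_norm (poly_op (P N) T f) \<le> C * ell2_norm f"
      using bounded_operator_bound[OF bounded_operator_poly[OF T(1)]] by blast
    note lin = bounded_operatorD[OF bounded_operator_poly[OF T(1)]]
    show ?thesis
    proof (rule bounded_operatorI[of _ _ "C + 1"])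
      show "S (\<lambda>x. f x + g x) = (\<lambda>x. S f x + S g x)" if fg: "f \<in> ell2 V" "g \<in> ell2 V" for f g
      proof (rule ext, rule LIMSEQ_unique[OF pointwise])
        show "(\<lambda>k. poly_op (P k) T (\<lambda>x. f x + g x) x) \<longlonglongrightarrow> S f x + S g x" for x
          unfolding lin(2)[OF fg] by (intro tendsto_add pointwise fg)
      qed (rule ell2_add[OF fg])
      show "S (\<lambda>x. a * f x) = (\<lambda>x. a * S f x)" if f: "f \<in> ell2 V" for f a
      proof (rule ext, rule LIMSEQ_unique[OF pointwise])
        show "(\<lambda>k. poly_op (P k) T (\<lambda>x. a * f x) x) \<longlonglongrightarrow> a * S f x" for x
          unfolding lin(3)[OF f] by (intro tendsto_mult tendsto_const pointwise f)
      qed (rule ell2_cmult[OF f])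
      show "ell2_norm (S f) \<le> (C + 1) * ell2_norm f" if f: "f \<in> ell2 V" for f
        using ell2_norm_triangle_sub[OF mem[OF f, of "P N"] ell2_diff[OF mem[OF f, of "P N"] S(1)[OF f]]]
          N[OF f] C[OF f] by (simp add: distrib_right)
    qed (rule S(1))
  qed
  have "(\<lambda>k. op_norm V (\<lambda>f x. poly_op (p k) T f x - S f x)) \<longlonglongrightarrow> 0"
    if p: "uniform_limit ?K (\<lambda>k t. poly (p k) (complex_of_real t)) \<phi> sequentially" for p
  proof (rule LIMSEQ_I)
    fix e :: real assume "e > 0"
    \<comment> \<open>The comparison of \<open>p k\<close> with \<open>P k\<close> costs twice this
      tolerance and that of \<open>P k\<close> with \<open>S\<close> once, together
      \<open>e / 2\<close>, which is strictly below \<open>e\<close>.\<close>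
    then have e: "e / 6 > 0"
      by simp
    have 1: "\<forall>\<^sub>F k in sequentially. \<forall>f\<in>ell2 V.
        ell2_norm (\<lambda>x. poly_op (P k) T f x - S f x) \<le> e / 6 * ell2_norm f"
      using lim[OF e] by (auto simp: eventually_sequentially)
    have "\<forall>\<^sub>F k in sequentially. norm (op_norm V (\<lambda>f x. poly_op (p k) T f x - S f x) - 0) < e"
      using uniform_limitD[OF P e] uniform_limitD[OF p e] 1
    proof eventually_elim
      case (elim k)
      have "op_norm V (\<lambda>f x. poly_op (p k) T f x - S f x) \<le> e / 2"
      proof (rule op_norm_le)
        fix f assume f: "f \<in> ell2 V" "ell2_norm f \<le> 1"
        have "ell2_norm (\<lambda>x. (poly_op (p k) T f x - poly_op (P k) T f x) + (poly_op (P k) T f x - S f x))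
            \<le> ell2_norm (\<lambda>x. poly_op (p k) T f x - poly_op (P k) T f x)
              + ell2_norm (\<lambda>x. poly_op (P k) T f x - S f x)"
          by (intro ell2_norm_triangle[where V = V] ell2_diff mem S f)
        also have "\<dots> \<le> 2 * (e / 6) * ell2_norm f + e / 6 * ell2_norm f"
          using near[OF elim(2,1) f(1)] elim(3) f(1) by (intro add_mono) auto
        also have "\<dots> = e / 2 * ell2_norm f"
          by simp
        also have "\<dots> \<le> e / 2 * 1"
          using f(2) \<open>e > 0\<close> by (intro mult_left_mono) auto
        finally show "ell2_norm (\<lambda>x. poly_op (p k) T f x - S f x) \<le> e / 2"
          by simp
      qed
      moreover have "0 \<le> op_norm V (\<lambda>f x. poly_op (p k) T f x - S f x)"
        by (intro op_norm_nonneg bounded_operator_minus bounded_operator_poly T bS)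
      ultimately show ?case
        using \<open>e > 0\<close> by simp
    qed
    then show "\<exists>N. \<forall>k\<ge>N. norm (op_norm V (\<lambda>f x. poly_op (p k) T f x - S f x) - 0) < e"
      by (simp add: eventually_sequentially)
  qed
  then show ?thesis
    unfolding is_fun_calc_def using bS by (intro exI[of _ S]) (auto simp: S_def)
qed

text \<open>One approximating sequence determines the operator on the carrier as its norm limit, and
  extensionality determines it elsewhere. The assumption on \<open>P\<close> guarantees such a
  sequence, without which the limit condition would be vacuous.\<close>

lemma is_fun_calc_unique:
  assumes T: "bounded_operator V T"
    and P: "uniform_limit {t. complex_of_real t \<in> spectrum V T}
      (\<lambda>k t. poly (P k) (complex_of_real t)) \<phi> sequentially"
    and S: "is_fun_calc V \<phi> T S" and S': "is_fun_calc V \<phi> T S'"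
  shows "S = S'"
proof (rule extensionalityI)
  show "S \<in> extensional (ell2 V)" "S' \<in> extensional (ell2 V)"
    using S S' by (auto simp: is_fun_calc_def)
  fix f assume f: "f \<in> ell2 V"
  let ?R = "\<lambda>S k f x. poly_op (P k) T f x - S f x"
  have b: "bounded_operator V S" "bounded_operator V S'"
    using S S' by (auto simp: is_fun_calc_def)
  have bR: "bounded_operator V (?R S k)" "bounded_operator V (?R S' k)" for k
    by (intro bounded_operator_minus bounded_operator_poly T b)+
  have mem: "S f \<in> ell2 V" "S' f \<in> ell2 V" "?R S k f \<in> ell2 V" "?R S' k f \<in> ell2 V" for k
    using bounded_operatorD(1)[OF b(1) f] bounded_operatorD(1)[OF b(2) f]
      bounded_operatorD(1)[OF bR(1) f] bounded_operatorD(1)[OF bR(2) f] by auto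
  have "(\<lambda>k. (op_norm V (?R S k) + op_norm V (?R S' k)) * ell2_norm f) \<longlonglongrightarrow> (0 + 0) * ell2_norm f"
    by (intro tendsto_intros) (use S S' P in \<open>auto simp: is_fun_calc_def\<close>)
  moreover have "ell2_norm (\<lambda>x. S' f x - S f x) \<le> (op_norm V (?R S k) + op_norm V (?R S' k)) * ell2_norm f" for k
  proof -
    have "ell2_norm (\<lambda>x. ?R S k f x - ?R S' k f x) \<le> ell2_norm (?R S k f) + ell2_norm (?R S' k f)"
      by (rule ell2_norm_triangle_sub[OF mem(3,4)])
    also have "\<dots> \<le> op_norm V (?R S k) * ell2_norm f + op_norm V (?R S' k) * ell2_norm f"
      by (intro add_mono ell2_norm_le_op_norm bR f)
    finally show ?thesis
      by (simp add: distrib_right)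
  qed
  ultimately have "ell2_norm (\<lambda>x. S' f x - S f x) \<le> 0"
    by (intro LIMSEQ_le_const[of "\<lambda>k. (op_norm V (?R S k) + op_norm V (?R S' k)) * ell2_norm f"]) auto
  then have "(\<lambda>x. S' f x - S f x) = (\<lambda>x. 0)"
    using ell2_norm_eq_0[OF ell2_diff[OF mem(2,1)]] ell2_norm_nonneg[of "\<lambda>x. S' f x - S f x"] by simp
  then show "S f = S' f"
    by (simp add: fun_eq_iff)
qed

theorem fun_calc_approximation:
  assumes T: "bounded_operator V T" "self_adjoint V T" "V \<noteq> {}"
    and P: "uniform_limit {t. complex_of_real t \<in> spectrum V T}
      (\<lambda>k t. poly (P k) (complex_of_real t)) \<phi> sequentially"
  shows "bounded_operator V (fun_calc V \<phi> T)"
    and "(\<lambda>k. op_norm V (\<lambda>f x. poly_op (P k) T f x - fun_calc V \<phi> T f x)) \<longlonglongrightarrow> 0"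
proof -
  obtain S where "is_fun_calc V \<phi> T S"
    using ex_is_fun_calc[OF T P] by blast
  moreover from this have "fun_calc V \<phi> T = S"
    unfolding fun_calc_eq_The by (blast intro: the_equality is_fun_calc_unique[OF T(1) P])
  ultimately have "is_fun_calc V \<phi> T (fun_calc V \<phi> T)"
    by simp
  then show "bounded_operator V (fun_calc V \<phi> T)"
    "(\<lambda>k. op_norm V (\<lambda>f x. poly_op (P k) T f x - fun_calc V \<phi> T f x)) \<longlonglongrightarrow> 0"
    using P by (auto simp: is_fun_calc_def)
qed

section \<open>Finite vertex sets\<close>

text \<open>Gaussian elimination: an unknown with nonzero coefficient in the new equation is solved
  for and substituted into the others, at the price of one equation and one unknown. It is needed
  for the linear dependence of the powers of an operator.\<close>

lemma homogeneous_system_nontrivial_solution: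
  fixes a :: "'i \<Rightarrow> 'k \<Rightarrow> 'b :: field"
  assumes "finite I" "finite N" "card I < card N"
  shows "\<exists>u. (\<exists>k\<in>N. u k \<noteq> 0) \<and> (\<forall>i\<in>I. (\<Sum>k\<in>N. a i k * u k) = 0)"
  using assms
proof (induction I arbitrary: N a)
  case empty
  then obtain k where "k \<in> N"
    by fastforce
  then show ?case
    by (intro exI[of _ "\<lambda>_. 1"]) auto
next
  case (insert i I)
  show ?case
  proof (cases "\<forall>k\<in>N. a i k = 0")
    case True
    then show ?thesis
      using insert.IH[of N a] insert by auto
  next
    case False
    then obtain m where m: "m \<in> N" "a i m \<noteq> 0"
      by blast
    define N' where "N' = N - {m}"
    have N': "finite N'" "card I < card N'" "m \<notin> N'" "N = insert m N'"
      using insert m by (auto simp: N'_def)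
    obtain u where u: "\<exists>k\<in>N'. u k \<noteq> 0"
      "\<And>j. j \<in> I \<Longrightarrow> (\<Sum>k\<in>N'. (a j k - a j m * a i k / a i m) * u k) = 0"
      using insert.IH[OF N'(1,2), of "\<lambda>j k. a j k - a j m * a i k / a i m"] by blast
    define w where "w = u(m := - (\<Sum>k\<in>N'. a i k * u k) / a i m)"
    have w: "(\<Sum>k\<in>N. a j k * w k) = a j m * w m + (\<Sum>k\<in>N'. a j k * u k)" for j
    proof -
      have "(\<Sum>k\<in>N'. a j k * w k) = (\<Sum>k\<in>N'. a j k * u k)"
        using N'(3) by (intro sum.cong) (auto simp: w_def)
      then show ?thesis
        using N'(1,3) by (simp add: N'(4))
    qed
    have "(\<Sum>k\<in>N. a j k * w k) = 0" if "j \<in> insert i I" for j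
    proof (cases "j = i")
      case True
      then show ?thesis
        unfolding w using m by (simp add: w_def)
    next
      case False
      have "(\<Sum>k\<in>N'. (a j k - a j m * a i k / a i m) * u k)
          = (\<Sum>k\<in>N'. a j k * u k) - a j m / a i m * (\<Sum>k\<in>N'. a i k * u k)"
        by (simp add: left_diff_distrib sum_subtractf sum_distrib_left mult.assoc)
      then show ?thesis
        unfolding w using u(2)[of j] False that by (simp add: w_def)
    qed
    moreover have "\<exists>k\<in>N. w k \<noteq> 0"
      using u(1) N'(3,4) by (auto simp: w_def)
    ultimately show ?thesis
      by blast
  qed
qed

lemma ell2_finite_expansion:
  assumes "finite V" "f \<in> ell2 V"
  shows "f = (\<lambda>x. \<Sum>y\<in>V. f y * indicator {y} x)"
proof
  fix x
  have "(\<Sum>y\<in>V. f y * indicator {y} x) = (\<Sum>y\<in>V. if y = x then f y else 0)"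
    by (intro sum.cong) (auto simp: indicator_def)
  then show "f x = (\<Sum>y\<in>V. f y * indicator {y} x)"
    using assms ell2_off[OF assms(2)] by (simp add: sum.delta)
qed

text \<open>Each power of \<open>T\<close> is determined by \<open>card (V \<times> V)\<close>
  matrix entries, and the exponents up to that number give one power more, so some nontrivial
  combination of them vanishes.\<close>

lemma annihilating_polynomial:
  assumes V: "finite V" and T: "bounded_operator V T"
  obtains p where "p \<noteq> 0" "\<And>f. f \<in> ell2 V \<Longrightarrow> poly_op p T f = (\<lambda>x. 0)"
proof -
  let ?n = "card (V \<times> V)"
  obtain u where u: "\<exists>k\<in>{..?n}. u k \<noteq> 0"
    "\<And>x y. x \<in> V \<Longrightarrow> y \<in> V \<Longrightarrow> (\<Sum>k\<le>?n. (T ^^ k) (indicator {y}) x * u k) = 0"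
    using homogeneous_system_nontrivial_solution[of "V \<times> V" "{..?n}"
        "\<lambda>(x, y) k. (T ^^ k) (indicator {y}) x"] V by auto
  define p where "p = (\<Sum>k\<le>?n. monom (u k) k)"
  have coeff: "coeff p k = (if k \<le> ?n then u k else 0)" for k
    by (simp add: p_def coeff_sum)
  have deg: "degree p \<le> ?n"
    by (rule degree_le) (simp add: coeff)
  have B: "bounded_operator V (poly_op p T)"
    by (rule bounded_operator_poly[OF T])
  have basis: "poly_op p T (indicator {y}) = (\<lambda>x. 0)" if y: "y \<in> V" for y
  proof
    fix x
    show "poly_op p T (indicator {y}) x = 0"
    proof (cases "x \<in> V")
      case True
      then show ?thesis
        unfolding poly_op_altdef[OF deg] using u(2)[OF True y] by (simp add: coeff mult.commute)
    next
      case False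
      then show ?thesis
        using ell2_off[OF bounded_operatorD(1)[OF B ell2_indicator[OF y]]] by simp
    qed
  qed
  show ?thesis
  proof (rule that)
    show "p \<noteq> 0"
      using u(1) coeff by (metis atMost_iff coeff_0)
    fix f assume f: "f \<in> ell2 V"
    have "poly_op p T (\<lambda>x. \<Sum>y\<in>V. f y * indicator {y} x) = (\<lambda>x. \<Sum>y\<in>V. poly_op p T (\<lambda>x. f y * indicator {y} x) x)"
      by (rule bounded_operator_sum[OF B]) (intro ell2_cmult ell2_indicator)
    also have "\<dots> = (\<lambda>x. \<Sum>y\<in>V. f y * poly_op p T (indicator {y}) x)"
      by (intro ext sum.cong refl) (simp add: bounded_operatorD(3)[OF B ell2_indicator])
    finally show "poly_op p T f = (\<lambda>x. 0)"
      using ell2_finite_expansion[OF V f] by (simp add: basis)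
  qed
qed

text \<open>Every spectral point is a root of an annihilating polynomial \<open>p\<close>: in
  \<open>p(z) - p(T) = (z - T) q(T)\<close> the term \<open>p(T)\<close> is zero, so
  \<open>q(T) / p(z)\<close> would invert \<open>z - T\<close> if \<open>p(z)\<close> were nonzero.
  Finiteness is what gives the \<open>Min\<close> in \<open>min_spectrum\<close> its
  meaning.\<close>

lemma finite_spectrum:
  assumes V: "finite V" and T: "bounded_operator V T"
  shows "finite (spectrum V T)"
proof -
  obtain p where p: "p \<noteq> 0" "\<And>f. f \<in> ell2 V \<Longrightarrow> poly_op p T f = (\<lambda>x. 0)"
    using annihilating_polynomial[OF assms] by blast
  have "poly p z = 0" if z: "z \<in> spectrum V T" for z
  proof (rule ccontr)
    assume nz: "poly p z \<noteq> 0"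
    define q where "q = synthetic_div p z"
    have q: "[:z, -1:] * q = [:poly p z:] - p"
    proof -
      have "[:z, -1:] = - [:- z, 1:]"
        by simp
      then have "[:z, -1:] * q = - ([:- z, 1:] * q)"
        by (simp only: mult_minus_left)
      also have "\<dots> = [:poly p z:] - ([:- z, 1:] * q + [:poly p z:])"
        by (simp only: diff_add_eq_diff_diff_swap diff_self diff_0)
      finally show ?thesis
        by (simp only: q_def synthetic_div_correct')
    qed
    have A: "poly_op [:z, -1:] T f = (\<lambda>x. z * f x - T f x)" for f
      by (simp add: poly_op_pCons)
    have bq: "bounded_operator V (poly_op q T)"
      by (rule bounded_operator_poly[OF T])
    let ?S = "\<lambda>f x. inverse (poly p z) * poly_op q T f x"
    have val: "poly_op ([:z, -1:] * q) T f = (\<lambda>x. poly p z * f x)" if "f \<in> ell2 V" for f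
      unfolding q poly_op_diff p(2)[OF that] by (simp add: poly_op_pCons)
    have "?S (\<lambda>x. z * f x - T f x) = f" if f: "f \<in> ell2 V" for f
    proof -
      have "poly_op q T (poly_op [:z, -1:] T f) = (\<lambda>x. poly p z * f x)"
        using val[OF f] poly_op_mult[OF T f, of q "[:z, -1:]"] by (simp only: mult.commute)
      then show ?thesis
        using nz by (simp add: A mult.assoc[symmetric])
    qed
    moreover have "(\<lambda>x. z * ?S f x - T (?S f) x) = f" if f: "f \<in> ell2 V" for f
    proof -
      have mem: "poly_op q T f \<in> ell2 V"
        by (rule bounded_operatorD(1)[OF bq f])
      have "poly_op [:z, -1:] T (poly_op q T f) = (\<lambda>x. poly p z * f x)"
        using val[OF f] poly_op_mult[OF T f, of "[:z, -1:]" q] by (simp only:)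
      then have "z * poly_op q T f x - T (poly_op q T f) x = poly p z * f x" for x
        unfolding A by metis
      then have "inverse (poly p z) * (z * poly_op q T f x - T (poly_op q T f) x) = f x" for x
        using nz by simp
      then show ?thesis
        unfolding bounded_operatorD(3)[OF T mem] by (simp add: right_diff_distrib mult.left_commute)
    qed
    ultimately have "op_invertible V (\<lambda>f x. z * f x - T f x)"
      unfolding op_invertible_def
      by (intro exI[of _ ?S] conjI ballI bounded_operator_cmult[OF bq])
    then show False
      using z by (simp add: spectrum_iff)
  qed
  then have "spectrum V T \<subseteq> {z. poly p z = 0}"
    by blast
  then show ?thesis
    using poly_roots_finite[OF p(1)] finite_subset by blast
qed

lemma eigenvalue_in_spectrum:
  assumes T: "bounded_operator V T" and f: "f \<in> ell2 V" "f \<noteq> (\<lambda>x. 0)" and ev: "T f = (\<lambda>x. z * f x)"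
  shows "z \<in> spectrum V T"
proof (rule ccontr)
  assume "z \<notin> spectrum V T"
  then obtain S where S: "bounded_operator V S" "S (\<lambda>x. z * f x - T f x) = f"
    using f(1) by (auto simp: spectrum_iff op_invertible_def)
  then show False
    using f(2) by (simp add: ev bounded_operator_zero)
qed

lemma finite_min_spectrum_eqI:
  assumes V: "finite V" and T: "bounded_operator V T"
    and f: "f \<in> ell2 V" "f \<noteq> (\<lambda>x. 0)" "T f = (\<lambda>x. complex_of_real l * f x)"
    and le: "\<And>g. g \<in> ell2 V \<Longrightarrow> l * (ell2_norm g)\<^sup>2 \<le> re_inner (T g) g"
  shows "min_spectrum V T = l"
  unfolding min_spectrum_def
proof (rule Min_eqI)
  have "{t. complex_of_real t \<in> spectrum V T} = complex_of_real -` spectrum V T"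
    by auto
  then show "finite {t. complex_of_real t \<in> spectrum V T}"
    using finite_vimageI[OF finite_spectrum[OF V T], of complex_of_real] by (simp add: inj_of_real)
  show "l \<in> {t. complex_of_real t \<in> spectrum V T}"
    using eigenvalue_in_spectrum[OF T f] by simp
  show "l \<le> t" if "t \<in> {t. complex_of_real t \<in> spectrum V T}" for t
    by (rule spectrum_ge[OF T le]) (use that in auto)
qed

section \<open>Adjacency operators\<close>

locale locally_finite_graph =
  fixes \<Gamma> :: "'a pair_pre_digraph"
  assumes arc_verts: "(x, y) \<in> parcs \<Gamma> \<Longrightarrow> x \<in> pverts \<Gamma> \<and> y \<in> pverts \<Gamma>"
    and arc_sym: "(x, y) \<in> parcs \<Gamma> \<Longrightarrow> (y, x) \<in> parcs \<Gamma>"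
    and finite_nbrs: "finite {y. (x, y) \<in> parcs \<Gamma>}"
begin

abbreviation nbrs :: "'a \<Rightarrow> 'a set" where
  "nbrs x \<equiv> {y. (x, y) \<in> parcs \<Gamma>}"

lemma adj_op_eq: "adj_op \<Gamma> f x = (\<Sum>y\<in>nbrs x. f y)"
proof (cases "x \<in> pverts \<Gamma>")
  case False
  then have "nbrs x = {}"
    using arc_verts by blast
  then show ?thesis
    using False by (simp add: adj_op_def)
qed (simp add: adj_op_def)

text \<open>Cauchy-Schwarz for the splitting of \<open>\<bar>f y\<bar>\<close> into
  \<open>sqrt (w y)\<close> and \<open>\<bar>f y\<bar> / sqrt (w y)\<close> yields one factor
  \<open>l\<close>, from the sum of \<open>w\<close> over the neighbours. Exchanging the two sums
  and using the symmetry of the arcs yields the other. On a finite set of vertices the exchange is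
  one of finite sums.\<close>

lemma schur_test_finite:
  fixes w :: "'a \<Rightarrow> real"
  assumes w: "\<And>x. x \<in> pverts \<Gamma> \<Longrightarrow> w x > 0" "\<And>x. x \<in> pverts \<Gamma> \<Longrightarrow> adj_op \<Gamma> w x \<le> l * w x"
    and l: "l \<ge> 0" and f: "f \<in> ell2 (pverts \<Gamma>)" and F: "finite F"
  shows "(\<Sum>x\<in>F. (cmod (adj_op \<Gamma> f x))\<^sup>2) \<le> l\<^sup>2 * (ell2_norm f)\<^sup>2"
proof -
  let ?V = "pverts \<Gamma>"
  define u where "u y = (cmod (f y))\<^sup>2 / w y" for y
  have pointwise: "(cmod (adj_op \<Gamma> f x))\<^sup>2 \<le> l * w x * (\<Sum>y\<in>nbrs x. u y)" if x: "x \<in> ?V" for x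
  proof -
    have pos: "w y > 0" if "y \<in> nbrs x" for y
      using that arc_verts w(1) by blast
    have "cmod (adj_op \<Gamma> f x) \<le> (\<Sum>y\<in>nbrs x. sqrt (w y) * (cmod (f y) / sqrt (w y)))"
    proof -
      have "(\<Sum>y\<in>nbrs x. sqrt (w y) * (cmod (f y) / sqrt (w y))) = (\<Sum>y\<in>nbrs x. cmod (f y))"
        by (intro sum.cong refl) (use pos in force)
      then show ?thesis
        unfolding adj_op_eq using norm_sum by metis
    qed
    then have "(cmod (adj_op \<Gamma> f x))\<^sup>2 \<le> (\<Sum>y\<in>nbrs x. sqrt (w y) * (cmod (f y) / sqrt (w y)))\<^sup>2"
      by (intro power_mono) auto
    also have "\<dots> \<le> (\<Sum>y\<in>nbrs x. (sqrt (w y))\<^sup>2) * (\<Sum>y\<in>nbrs x. (cmod (f y) / sqrt (w y))\<^sup>2)"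
      by (rule Cauchy_Schwarz_ineq_sum)
    also have "(\<Sum>y\<in>nbrs x. (sqrt (w y))\<^sup>2) = (\<Sum>y\<in>nbrs x. w y)"
      by (intro sum.cong refl) (use pos in \<open>simp add: less_imp_le\<close>)
    also have "(\<Sum>y\<in>nbrs x. (cmod (f y) / sqrt (w y))\<^sup>2) = (\<Sum>y\<in>nbrs x. u y)"
      by (intro sum.cong refl) (use pos in \<open>simp add: u_def power_divide less_imp_le\<close>)
    also have "(\<Sum>y\<in>nbrs x. w y) * (\<Sum>y\<in>nbrs x. u y) \<le> l * w x * (\<Sum>y\<in>nbrs x. u y)"
      using w(2)[OF x] pos by (intro mult_right_mono sum_nonneg) (auto simp: adj_op_eq u_def less_imp_le)
    finally show ?thesis .
  qed
  \<comment> \<open>\<open>E\<close> discards points off the graph, where the image is zero;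
    \<open>U\<close> collects all neighbours of \<open>E\<close>, so that both summation ranges are
    finite.\<close>
  define E where "E = F \<inter> ?V"
  define U where "U = (\<Union>x\<in>E. nbrs x)"
  have fin: "finite E" "finite U"
    using F finite_nbrs by (auto simp: E_def U_def)
  have "(\<Sum>x\<in>F. (cmod (adj_op \<Gamma> f x))\<^sup>2) = (\<Sum>x\<in>E. (cmod (adj_op \<Gamma> f x))\<^sup>2)"
    using F by (intro sum.mono_neutral_right) (auto simp: E_def adj_op_def)
  also have "\<dots> \<le> (\<Sum>x\<in>E. l * w x * (\<Sum>y\<in>nbrs x. u y))"
    by (intro sum_mono pointwise) (simp add: E_def)
  also have "\<dots> = (\<Sum>x\<in>E. \<Sum>y | y \<in> U \<and> (x, y) \<in> parcs \<Gamma>. l * w x * u y)"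
    unfolding sum_distrib_left by (intro sum.cong refl) (auto simp: U_def)
  also have "\<dots> = (\<Sum>y\<in>U. \<Sum>x | x \<in> E \<and> (x, y) \<in> parcs \<Gamma>. l * w x * u y)"
    by (rule sum.swap_restrict[OF fin])
  also have "\<dots> \<le> (\<Sum>y\<in>U. l\<^sup>2 * (cmod (f y))\<^sup>2)"
  proof (rule sum_mono)
    fix y assume "y \<in> U"
    then have y: "y \<in> ?V" "w y > 0"
      using arc_verts w(1) by (auto simp: U_def)
    have "(\<Sum>x | x \<in> E \<and> (x, y) \<in> parcs \<Gamma>. l * w x * u y) \<le> (\<Sum>x\<in>nbrs y. l * w x * u y)"
    proof (rule sum_mono2[OF finite_nbrs])
      show "0 \<le> l * w x * u y" if "x \<in> nbrs y - {x \<in> E. (x, y) \<in> parcs \<Gamma>}" for x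
      proof -
        have "w x > 0"
          using that arc_verts w(1) by blast
        then show ?thesis
          using y l by (simp add: u_def)
      qed
    qed (use arc_sym in auto)
    also have "\<dots> = l * u y * adj_op \<Gamma> w y"
      by (simp add: adj_op_eq sum_distrib_left sum_distrib_right mult_ac)
    also have "\<dots> \<le> l * u y * (l * w y)"
      using w(2)[OF y(1)] y(2) l by (intro mult_left_mono) (auto simp: u_def)
    also have "\<dots> = l\<^sup>2 * (cmod (f y))\<^sup>2"
      using y(2) by (simp add: u_def power2_eq_square)
    finally show "(\<Sum>x | x \<in> E \<and> (x, y) \<in> parcs \<Gamma>. l * w x * u y) \<le> l\<^sup>2 * (cmod (f y))\<^sup>2" .
  qed
  also have "\<dots> \<le> l\<^sup>2 * (ell2_norm f)\<^sup>2"
    unfolding sum_distrib_left[symmetric] ell2_norm_square re_inner_self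
    by (intro mult_left_mono finite_sum_le_infsum[OF ell2_summable[OF f] fin(2)]) auto
  finally show ?thesis .
qed

lemma schur_test:
  fixes w :: "'a \<Rightarrow> real"
  assumes w: "\<And>x. x \<in> pverts \<Gamma> \<Longrightarrow> w x > 0" "\<And>x. x \<in> pverts \<Gamma> \<Longrightarrow> adj_op \<Gamma> w x \<le> l * w x"
    and l: "l \<ge> 0"
  shows "bounded_operator (pverts \<Gamma>) (adj_op \<Gamma> :: 'a operator)" and "adj_norm \<Gamma> \<le> l"
proof -
  have *: "adj_op \<Gamma> f \<in> ell2 (pverts \<Gamma>)" "ell2_norm (adj_op \<Gamma> f) \<le> l * ell2_norm f"
    if f: "f \<in> ell2 (pverts \<Gamma>)" for f
  proof -
    have off: "adj_op \<Gamma> f x = 0" if "x \<notin> pverts \<Gamma>" for x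
      using that by (simp add: adj_op_def)
    show "adj_op \<Gamma> f \<in> ell2 (pverts \<Gamma>)"
      by (rule ell2_bdd_sumI(1)[OF off schur_test_finite[OF w l f]])
    have "(ell2_norm (adj_op \<Gamma> f))\<^sup>2 \<le> l\<^sup>2 * (ell2_norm f)\<^sup>2"
      using ell2_bdd_sumI(2)[OF off schur_test_finite[OF w l f]] by (simp add: ell2_norm_square re_inner_self)
    then have "(ell2_norm (adj_op \<Gamma> f))\<^sup>2 \<le> (l * ell2_norm f)\<^sup>2"
      by (simp add: power_mult_distrib)
    then show "ell2_norm (adj_op \<Gamma> f) \<le> l * ell2_norm f"
      by (rule power2_le_imp_le) (use l in simp)
  qed
  show "bounded_operator (pverts \<Gamma>) (adj_op \<Gamma> :: 'a operator)"
    by (rule bounded_operatorI[of _ _ l])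
      (use * in \<open>auto simp: adj_op_eq sum.distrib sum_distrib_left\<close>)
  show "adj_norm \<Gamma> \<le> l"
    unfolding adj_norm_def
  proof (rule op_norm_le)
    fix f :: "'a \<Rightarrow> complex" assume "f \<in> ell2 (pverts \<Gamma>)" "ell2_norm f \<le> 1"
    then show "ell2_norm (adj_op \<Gamma> f) \<le> l"
      using *(2)[of f] l mult_left_mono[of "ell2_norm f" 1 l] by auto
  qed
qed

lemma adj_op_of_real: "adj_op \<Gamma> (\<lambda>x. complex_of_real (w x)) = (\<lambda>x. complex_of_real (adj_op \<Gamma> w x))"
  by (rule ext) (simp add: adj_op_eq)

text \<open>A positive eigenvector is a weight for Schur's test, which bounds the norm from above;
  on a finite graph it is also square-summable, which bounds the norm from below by its
  eigenvalue.\<close>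

lemma perron_frobenius_finiteI:
  fixes w :: "'a \<Rightarrow> real"
  assumes fin: "finite (pverts \<Gamma>)" "pverts \<Gamma> \<noteq> {}"
    and w: "\<And>x. x \<in> pverts \<Gamma> \<Longrightarrow> w x > 0" "\<And>x. x \<in> pverts \<Gamma> \<Longrightarrow> adj_op \<Gamma> w x = l * w x"
    and l: "l \<ge> 0"
  shows "adj_norm \<Gamma> = l" and "perron_frobenius \<Gamma> w"
proof -
  have "\<And>x. x \<in> pverts \<Gamma> \<Longrightarrow> adj_op \<Gamma> w x \<le> l * w x"
    using w(2) by simp
  note schur = schur_test[OF w(1) this l]
  define f where "f x = (if x \<in> pverts \<Gamma> then complex_of_real (w x) else 0)" for x
  have f: "f \<in> ell2 (pverts \<Gamma>)"
    by (rule ell2_finite_support[OF fin(1)]) (auto simp: f_def)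
  have "adj_op \<Gamma> f = (\<lambda>x. complex_of_real l * f x)"
  proof
    fix x
    have "adj_op \<Gamma> f x = adj_op \<Gamma> (\<lambda>x. complex_of_real (w x)) x"
      unfolding adj_op_eq by (intro sum.cong refl) (use arc_verts in \<open>auto simp: f_def\<close>)
    then show "adj_op \<Gamma> f x = complex_of_real l * f x"
      using w(2) unfolding adj_op_of_real by (auto simp: f_def adj_op_def)
  qed
  then have "l * ell2_norm f \<le> adj_norm \<Gamma> * ell2_norm f"
    using ell2_norm_le_op_norm[OF schur(1) f] l by (simp add: ell2_norm_cmult adj_norm_def)
  moreover have "ell2_norm f > 0"
  proof -
    obtain x where "x \<in> pverts \<Gamma>"
      using fin(2) by blast
    then have "0 < cmod (f x)"
      using w(1) by (force simp: f_def)
    then show ?thesis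
      using cmod_le_ell2_norm[OF f, of x] by linarith
  qed
  ultimately have "l \<le> adj_norm \<Gamma>"
    by simp
  then show "adj_norm \<Gamma> = l"
    using schur(2) by simp
  then show "perron_frobenius \<Gamma> w"
    using w by (simp add: perron_frobenius_def)
qed

text \<open>Both sides are sums over all arcs, interchanged by \<open>prod.swap\<close>. The double
  sum converges absolutely because the bounded operator maps \<open>\<bar>f\<bar>\<close> to a
  square-summable function, whose product with \<open>g\<close> is absolutely summable.\<close>

lemma adj_op_self_adjoint:
  assumes bdd: "bounded_operator (pverts \<Gamma>) (adj_op \<Gamma> :: 'a operator)"
  shows "self_adjoint (pverts \<Gamma>) (adj_op \<Gamma>)"
proof -
  have main: "re_inner (adj_op \<Gamma> f) g = infsum (\<lambda>(x, y). Re (f y * cnj (g x))) (parcs \<Gamma>)"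
    if fg: "f \<in> ell2 (pverts \<Gamma>)" "g \<in> ell2 (pverts \<Gamma>)" for f g
  proof -
    have arcs: "parcs \<Gamma> = Sigma UNIV nbrs"
      by auto
    let ?h = "\<lambda>x. complex_of_real (cmod (f x))"
    have "?h \<in> ell2 (pverts \<Gamma>)"
      using fg(1) by (simp add: ell2_def)
    then have "adj_op \<Gamma> ?h \<in> ell2 (pverts \<Gamma>)"
      by (rule bounded_operatorD(1)[OF bdd])
    then have outer: "(\<lambda>x. cmod (adj_op \<Gamma> ?h x * g x)) summable_on UNIV"
      by (rule re_inner_summable(2)[OF _ fg(2)])
    have "(\<lambda>(x, y). cmod (f y) * cmod (g x)) summable_on Sigma UNIV nbrs"
    proof (rule summable_on_SigmaI[OF _ outer])
      fix x
      have "adj_op \<Gamma> ?h x = complex_of_real (\<Sum>y\<in>nbrs x. cmod (f y))"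
        by (simp add: adj_op_eq)
      then have "cmod (adj_op \<Gamma> ?h x * g x) = (\<Sum>y\<in>nbrs x. cmod (f y)) * cmod (g x)"
        by (simp add: norm_mult sum_nonneg del: of_real_sum)
      also have "\<dots> = (\<Sum>y\<in>nbrs x. cmod (f y) * cmod (g x))"
        by (rule sum_distrib_right)
      finally show "((\<lambda>y. case (x, y) of (x, y) \<Rightarrow> cmod (f y) * cmod (g x)) has_sum
          cmod (adj_op \<Gamma> ?h x * g x)) (nbrs x)"
        by (simp add: has_sum_finiteI[OF finite_nbrs])
    qed auto
    then have sm: "(\<lambda>(x, y). Re (f y * cnj (g x))) summable_on Sigma UNIV nbrs"
    proof (rule summable_on_real_comparison)
      fix p :: "'a \<times> 'a"
      obtain x y where p: "p = (x, y)"
        by (cases p)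
      show "\<bar>case p of (x, y) \<Rightarrow> Re (f y * cnj (g x))\<bar> \<le> (case p of (x, y) \<Rightarrow> cmod (f y) * cmod (g x))"
        using abs_Re_le_cmod[of "f y * cnj (g x)"] by (simp add: p norm_mult)
    qed
    have "infsum (\<lambda>(x, y). Re (f y * cnj (g x))) (parcs \<Gamma>)
        = infsum (\<lambda>(x, y). Re (f y * cnj (g x))) (Sigma UNIV nbrs)"
      by (rule arg_cong[OF arcs])
    also have "\<dots> = (\<Sum>\<^sub>\<infinity>x. \<Sum>\<^sub>\<infinity>y\<in>nbrs x. Re (f y * cnj (g x)))"
      by (rule infsum_Sigma'_banach[OF sm, symmetric])
    also have "\<dots> = re_inner (adj_op \<Gamma> f) g"
      unfolding re_inner_def by (intro infsum_cong) (simp add: finite_nbrs adj_op_eq sum_distrib_right)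
    finally show ?thesis ..
  qed
  have swap: "bij_betw prod.swap (parcs \<Gamma>) (parcs \<Gamma>)"
    by (rule bij_betw_byWitness[of _ prod.swap]) (use arc_sym in auto)
  show ?thesis
    unfolding self_adjoint_def
  proof (intro ballI)
    fix f g assume fg: "f \<in> ell2 (pverts \<Gamma>)" "g \<in> ell2 (pverts \<Gamma>)"
    have "re_inner f (adj_op \<Gamma> g) = infsum (\<lambda>(x, y). Re (g y * cnj (f x))) (parcs \<Gamma>)"
      by (subst re_inner_commute) (rule main[OF fg(2,1)])
    also have "\<dots> = infsum (\<lambda>p. (\<lambda>(x, y). Re (f y * cnj (g x))) (prod.swap p)) (parcs \<Gamma>)"
      by (intro infsum_cong) (auto simp: algebra_simps)
    also have "\<dots> = infsum (\<lambda>(x, y). Re (f y * cnj (g x))) (parcs \<Gamma>)"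
      by (rule infsum_reindex_bij_betw[OF swap])
    finally show "re_inner (adj_op \<Gamma> f) g = re_inner f (adj_op \<Gamma> g)"
      by (simp add: main[OF fg])
  qed
qed

lemma bounded_operator_hamiltonian:
  "bounded_operator (pverts \<Gamma>) (adj_op \<Gamma>) \<Longrightarrow> bounded_operator (pverts \<Gamma>) (hamiltonian \<Gamma>)"
  unfolding hamiltonian_def by (rule bounded_operator_shift)

lemma hamiltonian_self_adjoint:
  assumes bdd: "bounded_operator (pverts \<Gamma>) (adj_op \<Gamma> :: 'a operator)"
  shows "self_adjoint (pverts \<Gamma>) (hamiltonian \<Gamma>)"
  unfolding self_adjoint_def hamiltonian_def
proof (intro ballI)
  fix f g assume fg: "f \<in> ell2 (pverts \<Gamma>)" "g \<in> ell2 (pverts \<Gamma>)"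
  let ?E = "complex_of_real (adj_norm \<Gamma>)"
  note mem = bounded_operatorD(1)[OF bdd fg(1)] bounded_operatorD(1)[OF bdd fg(2)]
    ell2_cmult[OF fg(1), of ?E] ell2_cmult[OF fg(2), of ?E]
  show "re_inner (\<lambda>x. ?E * f x - adj_op \<Gamma> f x) g = re_inner f (\<lambda>x. ?E * g x - adj_op \<Gamma> g x)"
    unfolding re_inner_diff_left[OF mem(3,1) fg(2)] re_inner_diff_right[OF fg(1) mem(4,2)]
    by (simp add: re_inner_scaleR_left re_inner_scaleR_right self_adjointD[OF adj_op_self_adjoint[OF bdd] fg])
qed

text \<open>The quotient \<open>w / v\<close> is minimal on a set that the eigenvalue equation makes closed under adjacency.\<close>

lemma perron_frobenius_unique:
  assumes fin: "finite (pverts \<Gamma>)"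
    and conn: "\<And>S. S \<subseteq> pverts \<Gamma> \<Longrightarrow> S \<noteq> {} \<Longrightarrow> (\<And>x y. x \<in> S \<Longrightarrow> (x, y) \<in> parcs \<Gamma> \<Longrightarrow> y \<in> S) \<Longrightarrow> S = pverts \<Gamma>"
    and v: "perron_frobenius \<Gamma> v" and w: "perron_frobenius \<Gamma> w"
    and o: "r \<in> pverts \<Gamma>" "v r = w r" and x: "x \<in> pverts \<Gamma>"
  shows "v x = w x"
proof -
  let ?V = "pverts \<Gamma>"
  have vpos: "v y > 0" and vev: "adj_op \<Gamma> v y = adj_norm \<Gamma> * v y"
    and wev: "adj_op \<Gamma> w y = adj_norm \<Gamma> * w y" if "y \<in> ?V" for y
    using v w that by (auto simp: perron_frobenius_def)
  define c where "c = Min ((\<lambda>y. w y / v y) ` ?V)"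
  have c: "c * v y \<le> w y" if y: "y \<in> ?V" for y
  proof -
    have "c \<le> w y / v y"
      unfolding c_def using fin y by (intro Min_le) auto
    then show ?thesis
      using vpos[OF y] by (simp add: field_simps)
  qed
  define S where "S = {y \<in> ?V. w y = c * v y}"
  have "S = ?V"
  proof (rule conn)
    have "c \<in> (\<lambda>y. w y / v y) ` ?V"
      unfolding c_def using fin x by (intro Min_in) auto
    then show "S \<noteq> {}"
      using vpos by (force simp: S_def)
    fix y z assume y: "y \<in> S" and yz: "(y, z) \<in> parcs \<Gamma>"
    have "(\<Sum>z\<in>nbrs y. w z - c * v z) = adj_op \<Gamma> w y - c * adj_op \<Gamma> v y"
      by (simp add: adj_op_eq sum_subtractf sum_distrib_left)
    also have "\<dots> = 0"
      using y by (simp add: S_def vev wev)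
    finally have sum0: "(\<Sum>z\<in>nbrs y. w z - c * v z) = 0" .
    have "\<forall>z\<in>nbrs y. w z - c * v z = 0"
      using sum0 by (subst (asm) sum_nonneg_eq_0_iff[OF finite_nbrs]) (use arc_verts c in force)+
    then show "z \<in> S"
      using yz arc_verts by (auto simp: S_def)
  qed (simp add: S_def)
  then have *: "w y = c * v y" if "y \<in> ?V" for y
    using that by (auto simp: S_def)
  then have "c = 1"
    using o vpos[OF o(1)] by (metis less_irrefl mult_cancel_right1)
  then show ?thesis
    using *[OF x] by simp
qed

lemma locally_finite_graph_induced: "locally_finite_graph (induced \<Gamma> W)"
proof
  show "finite {y. (x, y) \<in> parcs (induced \<Gamma> W)}" for x
    by (rule finite_subset[OF _ finite_nbrs[of x]]) (auto simp: induced_def)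
qed (use arc_verts arc_sym in \<open>auto simp: induced_def\<close>)

text \<open>An induced subgraph imposes Dirichlet conditions, which are invisible to a function that
  already vanishes at the outer neighbours of the vertex.\<close>

lemma adj_op_induced:
  assumes "x \<in> W" "\<And>y. (x, y) \<in> parcs \<Gamma> \<Longrightarrow> y \<notin> W \<Longrightarrow> f y = 0"
  shows "adj_op (induced \<Gamma> W) f x = adj_op \<Gamma> f x"
proof -
  interpret I: locally_finite_graph "induced \<Gamma> W"
    by (rule locally_finite_graph_induced)
  show ?thesis
    unfolding adj_op_eq I.adj_op_eq
    by (rule sum.mono_neutral_left[OF finite_nbrs]) (use assms in \<open>auto simp: induced_def\<close>)
qed

lemma adj_op_induced_ell2:
  assumes "f \<in> ell2 (pverts \<Gamma> \<inter> W)"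
  shows "adj_op (induced \<Gamma> W) f = proj W (adj_op \<Gamma> f)"
proof
  fix x
  show "adj_op (induced \<Gamma> W) f x = proj W (adj_op \<Gamma> f) x"
  proof (cases "x \<in> W")
    case True
    have "adj_op (induced \<Gamma> W) f x = adj_op \<Gamma> f x"
    proof (rule adj_op_induced[OF True])
      fix y assume "(x, y) \<in> parcs \<Gamma>" "y \<notin> W"
      then show "f y = 0"
        using ell2_off[OF assms] by blast
    qed
    then show ?thesis
      using True by (simp add: proj_def)
  next
    case False
    then show ?thesis
      by (simp add: adj_op_def proj_def induced_def)
  qed
qed

end

section \<open>Restriction of operators to induced subgraphs\<close>

lemma proj_ell2:
  assumes "f \<in> ell2 V"
  shows "proj W f \<in> ell2 (V \<inter> W)" and "ell2_norm (proj W f) \<le> ell2_norm f"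
proof -
  have *: "(\<Sum>x\<in>F. (cmod (proj W f x))\<^sup>2) \<le> (ell2_norm f)\<^sup>2" if F: "finite F" for F
  proof -
    have "(\<Sum>x\<in>F. (cmod (proj W f x))\<^sup>2) \<le> (\<Sum>x\<in>F. (cmod (f x))\<^sup>2)"
      by (intro sum_mono) (simp add: proj_def)
    also have "\<dots> \<le> (ell2_norm f)\<^sup>2"
      unfolding ell2_norm_square re_inner_self
      by (rule finite_sum_le_infsum[OF ell2_summable[OF assms] F]) auto
    finally show ?thesis .
  qed
  have off: "proj W f x = 0" if "x \<notin> V \<inter> W" for x
    using that ell2_off[OF assms] by (auto simp: proj_def)
  show "proj W f \<in> ell2 (V \<inter> W)"
    by (rule ell2_bdd_sumI(1)[OF off *])
  have "(ell2_norm (proj W f))\<^sup>2 \<le> (ell2_norm f)\<^sup>2"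
    unfolding ell2_norm_square[of "proj W f"] re_inner_self by (rule ell2_bdd_sumI(2)[OF off *])
  then show "ell2_norm (proj W f) \<le> ell2_norm f"
    by (rule power2_le_imp_le) simp
qed

lemma proj_id: "f \<in> ell2 W \<Longrightarrow> proj W f = f"
  by (rule ext) (auto simp: proj_def ell2_off)

text \<open>Kept apart from \<open>locally_finite_graph\<close> because for the comb this assumption
  is itself obtained from \<open>schur_test\<close>, which is proved there.\<close>

locale bounded_graph = locally_finite_graph +
  assumes adj_bounded: "bounded_operator (pverts \<Gamma>) (adj_op \<Gamma> :: 'a operator)"
begin

lemma adj_norm_nonneg: "0 \<le> adj_norm \<Gamma>"
  unfolding adj_norm_def by (rule op_norm_nonneg[OF adj_bounded])

lemma induced_bounded:
  "bounded_operator (pverts (induced \<Gamma> W)) (adj_op (induced \<Gamma> W) :: 'a operator)"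
  "adj_norm (induced \<Gamma> W) \<le> adj_norm \<Gamma>"
proof -
  interpret I: locally_finite_graph "induced \<Gamma> W"
    by (rule locally_finite_graph_induced)
  have V: "pverts (induced \<Gamma> W) = pverts \<Gamma> \<inter> W"
    by (simp add: induced_def)
  have *: "adj_op (induced \<Gamma> W) f \<in> ell2 (pverts \<Gamma> \<inter> W)"
    "ell2_norm (adj_op (induced \<Gamma> W) f) \<le> adj_norm \<Gamma> * ell2_norm f" if f: "f \<in> ell2 (pverts \<Gamma> \<inter> W)" for f
  proof -
    have f': "f \<in> ell2 (pverts \<Gamma>)"
      using f ell2_mono[of "pverts \<Gamma> \<inter> W" "pverts \<Gamma>"] by blast
    note P = proj_ell2[OF bounded_operatorD(1)[OF adj_bounded f'], of W]
    show "adj_op (induced \<Gamma> W) f \<in> ell2 (pverts \<Gamma> \<inter> W)"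
      using P(1) by (simp add: adj_op_induced_ell2[OF f])
    show "ell2_norm (adj_op (induced \<Gamma> W) f) \<le> adj_norm \<Gamma> * ell2_norm f"
      using P(2) ell2_norm_le_op_norm[OF adj_bounded f'] by (simp add: adj_op_induced_ell2[OF f] adj_norm_def)
  qed
  show "bounded_operator (pverts (induced \<Gamma> W)) (adj_op (induced \<Gamma> W) :: 'a operator)"
    unfolding V by (rule bounded_operatorI[of _ _ "adj_norm \<Gamma>"])
      (use * in \<open>auto simp: I.adj_op_eq sum.distrib sum_distrib_left\<close>)
  show "adj_norm (induced \<Gamma> W) \<le> adj_norm \<Gamma>"
    unfolding adj_norm_def[of "induced \<Gamma> W"] V
  proof (rule op_norm_le)
    fix f assume "f \<in> ell2 (pverts \<Gamma> \<inter> W)" "ell2_norm f \<le> 1"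
    then show "ell2_norm (adj_op (induced \<Gamma> W) f) \<le> adj_norm \<Gamma>"
      using *(2)[of f] mult_left_mono[of "ell2_norm f" 1 "adj_norm \<Gamma>"] adj_norm_nonneg by auto
  qed
qed

text \<open>On \<open>ell2 W\<close> the compression is \<open>adj_norm \<Gamma>\<close> minus the
  adjacency operator of the induced graph. Cauchy-Schwarz bounds its form from below, and the
  Perron-Frobenius vector is an eigenvector for exactly this bound.\<close>

lemma min_spectrum_compression_hamiltonian:
  assumes fin: "finite (pverts (induced \<Gamma> W))" "pverts (induced \<Gamma> W) \<noteq> {}" and W: "W \<subseteq> pverts \<Gamma>"
    and pf: "perron_frobenius (induced \<Gamma> W) w"
  shows "min_spectrum W (compression W (hamiltonian \<Gamma>)) = adj_norm \<Gamma> - adj_norm (induced \<Gamma> W)"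
proof -
  interpret I: locally_finite_graph "induced \<Gamma> W"
    by (rule locally_finite_graph_induced)
  have V: "pverts (induced \<Gamma> W) = W" "pverts \<Gamma> \<inter> W = W"
    using W by (auto simp: induced_def)
  let ?E = "complex_of_real (adj_norm \<Gamma>)" and ?A = "adj_op (induced \<Gamma> W)"
  let ?l = "adj_norm (induced \<Gamma> W)"
  have A: "bounded_operator W (?A :: 'a operator)"
    using induced_bounded(1)[of W] by (simp add: V)
  have eq: "compression W (hamiltonian \<Gamma>) f = (\<lambda>x. ?E * f x - ?A f x)" if f: "f \<in> ell2 W" for f
  proof -
    have "compression W (hamiltonian \<Gamma>) f = proj W (\<lambda>x. ?E * f x - adj_op \<Gamma> f x)"
      by (simp add: compression_def proj_id[OF f] hamiltonian_def[abs_def])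
    then show ?thesis
      using adj_op_induced_ell2[of f W] ell2_off[OF f] f by (auto simp: proj_def V)
  qed
  have bdd: "bounded_operator W (compression W (hamiltonian \<Gamma>))"
    by (rule bounded_operator_cong[OF bounded_operator_shift[OF A] eq])
  define f where "f x = (if x \<in> W then complex_of_real (w x) else 0)" for x
  have f: "f \<in> ell2 W"
    by (rule ell2_finite_support[of W]) (use fin in \<open>auto simp: f_def V\<close>)
  have Af: "?A f = (\<lambda>x. complex_of_real ?l * f x)"
  proof
    fix x
    have "?A f x = ?A (\<lambda>x. complex_of_real (w x)) x"
      unfolding I.adj_op_eq by (intro sum.cong refl) (use I.arc_verts in \<open>auto simp: f_def V\<close>)
    then show "?A f x = complex_of_real ?l * f x"
    proof (cases "x \<in> W")
      case True
      then show ?thesis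
        using pf \<open>?A f x = _\<close> unfolding I.adj_op_of_real by (simp add: f_def V perron_frobenius_def)
    next
      case False
      then show ?thesis
        by (simp add: adj_op_def V f_def)
    qed
  qed
  show ?thesis
  proof (rule finite_min_spectrum_eqI[OF _ bdd f])
    show "finite W"
      using fin V by simp
    obtain x where x: "x \<in> W"
      using fin V by auto
    then have "f x \<noteq> 0"
      using pf by (force simp: f_def perron_frobenius_def V)
    then show "f \<noteq> (\<lambda>x. 0)"
      by auto
    show "compression W (hamiltonian \<Gamma>) f = (\<lambda>x. complex_of_real (adj_norm \<Gamma> - ?l) * f x)"
      unfolding eq[OF f] Af by (simp add: algebra_simps)
    fix g assume g: "g \<in> ell2 W"
    have "re_inner (compression W (hamiltonian \<Gamma>) g) g = adj_norm \<Gamma> * (ell2_norm g)\<^sup>2 - re_inner (?A g) g"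
      unfolding eq[OF g] re_inner_diff_left[OF ell2_cmult[OF g] bounded_operatorD(1)[OF A g] g]
      by (simp add: re_inner_cmult_self)
    moreover have "re_inner (?A g) g \<le> ?l * (ell2_norm g)\<^sup>2"
    proof -
      have "re_inner (?A g) g \<le> ell2_norm (?A g) * ell2_norm g"
        using re_inner_le_norms[OF bounded_operatorD(1)[OF A g] g] by linarith
      also have "\<dots> \<le> (?l * ell2_norm g) * ell2_norm g"
        using ell2_norm_le_op_norm[OF A g] by (intro mult_right_mono) (auto simp: adj_norm_def V)
      finally show ?thesis
        by (simp add: power2_eq_square mult.assoc)
    qed
    ultimately show "(adj_norm \<Gamma> - ?l) * (ell2_norm g)\<^sup>2 \<le> re_inner (compression W (hamiltonian \<Gamma>) g) g"
      by (simp add: algebra_simps)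
  qed
qed

end

section \<open>The comb over the lattice\<close>

lemma comb_product_induced:
  "comb_product (induced G A) (induced K B) r = induced (comb_product G K r) (A \<times> B)"
  unfolding comb_product_def induced_def by auto

lemma sum_abs_eq_1_iff:
  fixes z :: "int ^ 'd::finite"
  shows "(\<Sum>i\<in>UNIV. \<bar>z $ i\<bar>) = 1 \<longleftrightarrow> (\<exists>i s. (s = 1 \<or> s = -1) \<and> z = axis i s)"
proof
  assume sum: "(\<Sum>i\<in>UNIV. \<bar>z $ i\<bar>) = 1"
  then obtain i where i: "z $ i \<noteq> 0"
    by (metis abs_0 sum.neutral zero_neq_one)
  have split: "\<bar>z $ i\<bar> + (\<Sum>j\<in>UNIV - {i}. \<bar>z $ j\<bar>) = 1"
    using sum by (simp add: sum.remove[of UNIV i])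
  have nonneg: "(\<Sum>j\<in>UNIV - {i}. \<bar>z $ j\<bar>) \<ge> 0"
    by (intro sum_nonneg) auto
  have "\<bar>z $ i\<bar> = 1" and "(\<Sum>j\<in>UNIV - {i}. \<bar>z $ j\<bar>) = 0"
    using split nonneg i by linarith+
  then have "z $ i = 1 \<or> z $ i = -1" and "\<And>j. j \<noteq> i \<Longrightarrow> z $ j = 0"
    by (auto simp: sum_nonneg_eq_0_iff)
  then have "z = axis i (z $ i)"
    by (auto simp: vec_eq_iff axis_def)
  with \<open>z $ i = 1 \<or> z $ i = -1\<close> show "\<exists>i s. (s = 1 \<or> s = -1) \<and> z = axis i s"
    by blast
next
  assume "\<exists>i s. (s = 1 \<or> s = -1) \<and> z = axis i s"
  then obtain i s where "s = 1 \<or> s = -1" and z: "z = axis i s"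
    by blast
  then have s: "\<bar>s\<bar> = 1"
    by auto
  have "(\<Sum>j\<in>UNIV. \<bar>z $ j\<bar>) = (\<Sum>j\<in>UNIV. if j = i then \<bar>s\<bar> else 0)"
    unfolding z axis_def by (intro sum.cong) auto
  then show "(\<Sum>j\<in>UNIV. \<bar>z $ j\<bar>) = 1"
    using s by simp
qed

lemma lattice_nbrs:
  fixes g :: "int ^ 'd::finite"
  shows "{g'. (g, g') \<in> parcs lattice_graph} = (\<lambda>(i, s). g + axis i s) ` (UNIV \<times> {1, -1})"
proof -
  have "(g, g') \<in> parcs lattice_graph \<longleftrightarrow> (\<exists>i s. (s = 1 \<or> s = -1) \<and> g' - g = axis i s)" for g'
    using sum_abs_eq_1_iff[of "g' - g"] by (simp add: lattice_graph_def abs_minus_commute)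
  moreover have "g' - g = z \<longleftrightarrow> g' = g + z" for g' z
    by (auto simp: algebra_simps)
  ultimately show ?thesis
    by auto
qed

lemma sum_lattice_nbrs:
  fixes g :: "int ^ 'd::finite" and f :: "int ^ 'd \<Rightarrow> 'b::comm_monoid_add"
  shows "(\<Sum>g' | (g, g') \<in> parcs lattice_graph. f g') = (\<Sum>i\<in>UNIV. f (g + axis i 1) + f (g + axis i (-1)))"
proof -
  have "inj_on (\<lambda>(i, s). g + axis i s) (UNIV \<times> {1, - 1 :: int})"
    by (auto simp: inj_on_def axis_eq_axis)
  then have "(\<Sum>g' | (g, g') \<in> parcs lattice_graph. f g') = (\<Sum>(i, s)\<in>UNIV \<times> {1, -1}. f (g + axis i s))"
    unfolding lattice_nbrs by (subst sum.reindex) (auto simp: case_prod_beta)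
  also have "\<dots> = (\<Sum>i\<in>UNIV. \<Sum>s\<in>{1, -1}. f (g + axis i s))"
    by (rule sum.cartesian_product[symmetric])
  finally show ?thesis
    by simp
qed

lemma lattice_adjacent_le_1:
  assumes "(g, g') \<in> parcs lattice_graph"
  shows "\<bar>g $ i - g' $ i\<bar> \<le> 1"
proof -
  have "\<bar>g $ i - g' $ i\<bar> \<le> (\<Sum>i\<in>UNIV. \<bar>g $ i - g' $ i\<bar>)"
    by (rule member_le_sum) auto
  then show ?thesis
    using assms by (simp add: lattice_graph_def)
qed

definition comb_graph :: "((int ^ 'd::finite) \<times> int) pair_pre_digraph" where
  "comb_graph = comb_product lattice_graph int_graph 0"

definition comb_box :: "nat \<Rightarrow> ((int ^ 'd::finite) \<times> int) set" where
  "comb_box n = {g. \<forall>i. g $ i \<in> {- int n..int n}} \<times> {- int n..int n}"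

lemma comb_box_iff: "(g, h) \<in> comb_box n \<longleftrightarrow> (\<forall>i. \<bar>g $ i\<bar> \<le> int n) \<and> \<bar>h\<bar> \<le> int n"
  by (auto simp: comb_box_def abs_le_iff minus_le_iff)

lemma comb_product_boxes:
  "comb_product (lattice_box n) (int_path n) 0 = induced comb_graph (comb_box n)"
  unfolding lattice_box_def int_path_def comb_product_induced comb_graph_def comb_box_def ..

lemma pverts_comb_graph [simp]: "pverts comb_graph = UNIV"
  by (simp add: comb_graph_def comb_product_def lattice_graph_def int_graph_def)

lemma comb_arc_iff: "((g, h), (g', h')) \<in> parcs comb_graph \<longleftrightarrow>
    g' = g \<and> (h' = h + 1 \<or> h' = h - 1) \<or> h = 0 \<and> h' = 0 \<and> (g, g') \<in> parcs lattice_graph"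
  by (auto simp: comb_graph_def comb_product_def lattice_graph_def int_graph_def)

lemma comb_nbrs: "{y. ((g, h), y) \<in> parcs comb_graph} =
    {(g, h + 1), (g, h - 1)} \<union> (if h = 0 then (\<lambda>g'. (g', 0)) ` {g'. (g, g') \<in> parcs lattice_graph} else {})"
  by (auto simp: comb_arc_iff)

interpretation comb: locally_finite_graph comb_graph
proof
  fix x y :: "(int ^ 'd::finite) \<times> int"
  show "(y, x) \<in> parcs comb_graph" if "(x, y) \<in> parcs comb_graph"
    using that by (cases x; cases y) (auto simp: comb_arc_iff lattice_graph_def abs_minus_commute)
  show "finite {y. (x, y) \<in> parcs comb_graph}"
    by (cases x) (simp add: comb_nbrs lattice_nbrs)
qed simp

lemma comb_adj_op:
  fixes f :: "(int ^ 'd::finite) \<times> int \<Rightarrow> 'b::comm_monoid_add"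
  shows "adj_op comb_graph f (g, h) = f (g, h + 1) + f (g, h - 1) +
    (if h = 0 then \<Sum>i\<in>UNIV. f (g + axis i 1, 0) + f (g + axis i (-1), 0) else 0)"
proof (cases "h = 0")
  case True
  let ?B = "(\<lambda>g'. (g', 0 :: int)) ` {g'. (g, g') \<in> parcs lattice_graph}"
  have fin: "finite {g'. (g, g') \<in> parcs (lattice_graph :: (int ^ 'd) pair_pre_digraph)}"
    by (simp add: lattice_nbrs)
  have "adj_op comb_graph f (g, h) = sum f ({(g, 1), (g, -1)} \<union> ?B)"
    unfolding comb.adj_op_eq comb_nbrs using True by simp
  also have "\<dots> = sum f {(g, 1), (g, -1)} + sum f ?B"
    using fin by (intro sum.union_disjoint) auto
  also have "sum f ?B = (\<Sum>g' | (g, g') \<in> parcs lattice_graph. f (g', 0))"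
    by (subst sum.reindex) (auto simp: inj_on_def)
  finally show ?thesis
    using True by (simp add: sum_lattice_nbrs)
qed (simp add: comb.adj_op_eq comb_nbrs)

section \<open>Size and connectedness of the boxes\<close>

lemma vec_box:
  assumes "finite A"
  shows "finite {g :: 'a ^ 'd::finite. \<forall>i. g $ i \<in> A}"
    and "card {g :: 'a ^ 'd. \<forall>i. g $ i \<in> A} = card A ^ CARD('d)"
proof -
  have "bij_betw vec_lambda (UNIV \<rightarrow>\<^sub>E A) {g :: 'a ^ 'd. \<forall>i. g $ i \<in> A}"
    by (rule bij_betw_byWitness[of _ vec_nth]) (auto simp: PiE_def Pi_def)
  then show "finite {g :: 'a ^ 'd. \<forall>i. g $ i \<in> A}"
    "card {g :: 'a ^ 'd. \<forall>i. g $ i \<in> A} = card A ^ CARD('d)"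
    using assms by (auto simp: bij_betw_finite bij_betw_same_card card_PiE finite_PiE dest: bij_betw_finite bij_betw_same_card)
qed

lemma finite_comb_box: "finite (comb_box n)"
  unfolding comb_box_def by (intro finite_cartesian_product vec_box(1)) auto

lemma comb_box_nonempty: "(0, 0) \<in> comb_box n"
  by (simp add: comb_box_iff)

text \<open>Connectedness in the form that \<open>perron_frobenius_unique\<close> consumes.
  Membership in a closed set is carried down each fibre to the base and then along the base to the
  origin. A move decreases one coordinate in modulus and changes no other, so it stays in the box;
  \<open>\<bar>h\<bar>\<close> and then the sum of the \<open>\<bar>g $ i\<bar>\<close> serve as
  induction measures.\<close>

lemma comb_box_connected:
  assumes S: "S \<subseteq> comb_box n" "S \<noteq> {}"
    and closed: "\<And>x y. x \<in> S \<Longrightarrow> (x, y) \<in> parcs (induced comb_graph (comb_box n)) \<Longrightarrow> y \<in> S"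
  shows "S = comb_box n"
proof -
  have step: "x \<in> S \<longleftrightarrow> y \<in> S" if "(x, y) \<in> parcs comb_graph" "x \<in> comb_box n" "y \<in> comb_box n" for x y
    using closed[of x y] closed[of y x] that comb.arc_sym[OF that(1)] by (auto simp: induced_def)
  have fibre: "(g, h) \<in> S \<longleftrightarrow> (g, 0) \<in> S" if "(g, h) \<in> comb_box n" for g h
    using that
  proof (induction "nat \<bar>h\<bar>" arbitrary: h)
    case (Suc k)
    then have h: "h \<noteq> 0" "\<bar>h - sgn h\<bar> = int k" "\<bar>h\<bar> = int (Suc k)"
      by (auto simp: sgn_if abs_if)
    have box: "(g, h - sgn h) \<in> comb_box n"
      using Suc.prems h by (simp add: comb_box_iff)
    have "((g, h), (g, h - sgn h)) \<in> parcs comb_graph"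
      using h(1) by (auto simp: comb_arc_iff sgn_if)
    then have "(g, h) \<in> S \<longleftrightarrow> (g, h - sgn h) \<in> S"
      by (rule step[OF _ Suc.prems box])
    also have "\<dots> \<longleftrightarrow> (g, 0) \<in> S"
      using h by (intro Suc.hyps box) simp
    finally show ?case .
  qed simp
  have base: "(g, 0) \<in> S \<longleftrightarrow> (0, 0) \<in> S" if "(g, 0) \<in> comb_box n" for g
    using that
  proof (induction "nat (\<Sum>i\<in>UNIV. \<bar>g $ i\<bar>)" arbitrary: g rule: less_induct)
    case less
    show ?case
    proof (cases "g = 0")
      case False
      then obtain i where i: "g $ i \<noteq> 0"
        by (auto simp: vec_eq_iff)
      define g' where "g' = g + axis i (- sgn (g $ i))"
      have g': "g' $ j = (if j = i then g $ i - sgn (g $ i) else g $ j)" for j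
        by (simp add: g'_def axis_def)
      have abs: "\<bar>g' $ j\<bar> \<le> \<bar>g $ j\<bar>" "\<bar>g' $ i\<bar> < \<bar>g $ i\<bar>" for j
        using i by (auto simp: g' sgn_if)
      have lt: "(\<Sum>i\<in>UNIV. \<bar>g' $ i\<bar>) < (\<Sum>i\<in>UNIV. \<bar>g $ i\<bar>)"
        by (rule sum_strict_mono_ex1) (use abs in auto)
      have pos: "(\<Sum>i\<in>UNIV. \<bar>g' $ i\<bar>) \<ge> 0"
        by (rule sum_nonneg) simp
      have box: "(g', 0) \<in> comb_box n"
        using less.prems abs(1) order_trans by (fastforce simp: comb_box_iff)
      have "g' \<in> {g'. (g, g') \<in> parcs lattice_graph}"
        unfolding lattice_nbrs using i by (force simp: g'_def sgn_if)
      then have "((g, 0), (g', 0)) \<in> parcs comb_graph"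
        by (simp add: comb_arc_iff)
      then have "(g, 0) \<in> S \<longleftrightarrow> (g', 0) \<in> S"
        by (rule step[OF _ less.prems box])
      also have "\<dots> \<longleftrightarrow> (0, 0) \<in> S"
        by (rule less.hyps[OF _ box]) (use lt pos in linarith)
      finally show ?thesis .
    qed simp
  qed
  have *: "(g, h) \<in> S \<longleftrightarrow> (0, 0) \<in> S" if "(g, h) \<in> comb_box n" for g h
  proof -
    have "(g, 0) \<in> comb_box n"
      using that by (simp add: comb_box_iff)
    then show ?thesis
      using fibre[OF that] base by blast
  qed
  then have "(0, 0) \<in> S"
    using S by fastforce
  then show ?thesis
    using * S(1) by auto
qed

subsection \<open>The generalized Perron-Frobenius vector of the comb\<close>

text \<open>The positive root of \<open>s\<^sup>2 + 2 * d * s = 1\<close>, that is, the positive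
  solution of \<open>1 / s - s = 2 * d\<close>.\<close>

definition comb_decay :: "real \<Rightarrow> real" where
  "comb_decay d = sqrt (d\<^sup>2 + 1) - d"

lemma comb_decay:
  shows "comb_decay d > 0" and "(comb_decay d)\<^sup>2 = 1 - 2 * d * comb_decay d"
proof -
  have "d < sqrt (d\<^sup>2 + 1)"
    by (rule real_less_rsqrt) simp
  then show "comb_decay d > 0"
    by (simp add: comb_decay_def)
  have "(sqrt (d\<^sup>2 + 1))\<^sup>2 = d\<^sup>2 + 1"
    by (simp add: add_nonneg_pos less_imp_le)
  then show "(comb_decay d)\<^sup>2 = 1 - 2 * d * comb_decay d"
    unfolding comb_decay_def by (simp add: power2_eq_square algebra_simps)
qed

lemma sqrt_eq_comb_decay: "2 * sqrt (d\<^sup>2 + 1) = 2 * comb_decay d + 2 * d"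
  by (simp add: comb_decay_def)

lemma comb_pf_eigenvector:
  fixes g :: "int ^ 'd::finite"
  defines "d \<equiv> real CARD('d)"
  defines "v \<equiv> \<lambda>(g :: int ^ 'd, h). comb_decay d ^ nat \<bar>h\<bar>"
  shows "adj_op comb_graph v (g, h) = 2 * sqrt (d\<^sup>2 + 1) * v (g, h)"
proof (cases "h = 0")
  case True
  then show ?thesis
    unfolding comb_adj_op sqrt_eq_comb_decay by (simp add: v_def d_def)
next
  case False
  define k where "k = nat \<bar>h\<bar> - 1"
  let ?s = "comb_decay d"
  have h: "nat \<bar>h\<bar> = Suc k"
    using False by (simp add: k_def)
  \<comment> \<open>Both signs of \<open>h\<close> are treated together: one fibre neighbour is a
    step farther from the base and the other a step nearer.\<close>
  have "nat \<bar>h + 1\<bar> = Suc (Suc k) \<and> nat \<bar>h - 1\<bar> = k \<or> nat \<bar>h + 1\<bar> = k \<and> nat \<bar>h - 1\<bar> = Suc (Suc k)"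
    using False unfolding k_def by linarith
  then have "v (g, h + 1) + v (g, h - 1) = ?s ^ Suc (Suc k) + ?s ^ k"
    unfolding v_def prod.case by (elim disjE conjE) (simp_all only: add.commute)
  also have "\<dots> = ?s ^ k * (?s\<^sup>2 + 1)"
    by (simp add: power2_eq_square algebra_simps)
  also have "?s\<^sup>2 + 1 = (2 * ?s + 2 * d) * ?s"
    using comb_decay(2)[of d] by (simp add: power2_eq_square algebra_simps)
  finally have "v (g, h + 1) + v (g, h - 1) = (2 * ?s + 2 * d) * v (g, h)"
    by (simp add: v_def h)
  then show ?thesis
    using False by (simp only: comb_adj_op if_False add_0_right sqrt_eq_comb_decay)
qed

lemma comb_schur:
  fixes G :: "((int ^ 'd::finite) \<times> int) pair_pre_digraph"
  assumes "G = comb_graph"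
  shows "bounded_operator UNIV (adj_op G :: ((int ^ 'd) \<times> int) operator)"
    and "adj_norm G \<le> 2 * sqrt ((real CARD('d))\<^sup>2 + 1)"
proof -
  let ?d = "real CARD('d)"
  define v where "v = (\<lambda>(g :: int ^ 'd, h :: int). comb_decay ?d ^ nat \<bar>h\<bar>)"
  have pos: "v x > 0" for x
    using comb_decay(1)[of ?d] by (cases x) (simp add: v_def)
  have "adj_op comb_graph v x \<le> 2 * sqrt (?d\<^sup>2 + 1) * v x" for x
    using comb_pf_eigenvector[of "fst x" "snd x"] by (simp add: v_def)
  from comb.schur_test[OF pos this] show
    "bounded_operator UNIV (adj_op G :: ((int ^ 'd) \<times> int) operator)"
    "adj_norm G \<le> 2 * sqrt (?d\<^sup>2 + 1)"
    by (auto simp: assms)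
qed

interpretation comb: bounded_graph comb_graph
  by unfold_locales (simp add: comb_schur(1)[OF refl])

subsection \<open>Perron-Frobenius vectors of the boxes\<close>

text \<open>The frequency at which the cosine has its first zeros at
  \<open>\<plusminus> (n + 1)\<close>, the layer just outside the box, and is therefore positive
  inside.\<close>

definition box_freq :: "nat \<Rightarrow> real" where
  "box_freq n = pi / (2 * real (n + 1))"

text \<open>
  The profile along a fibre is the solution of \<open>f (k + 1) + f (k - 1) = (q + 1 / q) * f k\<close> with
  \<open>f 0 = 1\<close> and \<open>f (n + 1) = 0\<close>; only indices \<open>k \<le> n + 1\<close> matter, where no subtraction is truncated.
\<close>

definition box_profile :: "nat \<Rightarrow> real \<Rightarrow> nat \<Rightarrow> real" where
  "box_profile n q k = (q ^ k - q ^ (2 * (n + 1) - k)) / (1 - q ^ (2 * (n + 1)))"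

definition box_pf :: "nat \<Rightarrow> real \<Rightarrow> (int ^ 'd::finite) \<times> int \<Rightarrow> real" where
  "box_pf n q = (\<lambda>(g, h). (\<Prod>i\<in>UNIV. cos (box_freq n * real_of_int (g $ i))) * box_profile n q (nat \<bar>h\<bar>))"

lemma cos_box_freq_pos:
  assumes "\<bar>k\<bar> \<le> int n"
  shows "cos (box_freq n * real_of_int k) > 0"
proof (rule cos_gt_zero_pi)
  have "\<bar>real_of_int k\<bar> < real (n + 1)"
    using assms by linarith
  moreover have "box_freq n > 0"
    by (simp add: box_freq_def)
  ultimately have "\<bar>box_freq n * real_of_int k\<bar> < box_freq n * real (n + 1)"
    by (simp add: abs_mult)
  also have "\<dots> = pi / 2"
    by (simp add: box_freq_def field_simps)
  finally show "- (pi / 2) < box_freq n * real_of_int k" "box_freq n * real_of_int k < pi / 2"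
    by (simp_all add: abs_less_iff)
qed

lemma cos_box_freq_boundary:
  assumes "\<bar>k\<bar> = int (n + 1)"
  shows "cos (box_freq n * real_of_int k) = 0"
proof -
  have "\<bar>real_of_int k\<bar> = real (n + 1)"
    using assms by linarith
  then have "\<bar>box_freq n * real_of_int k\<bar> = pi / 2"
    unfolding abs_mult by (simp add: box_freq_def field_simps)
  then have "box_freq n * real_of_int k = pi / 2 \<or> box_freq n * real_of_int k = - (pi / 2)"
    by linarith
  then show ?thesis
    by (elim disjE) (simp_all only: cos_minus cos_pi_half)
qed

lemma prod_cos_shift:
  fixes g :: "int ^ 'd::finite"
  shows "(\<Prod>j\<in>UNIV. cos (t * real_of_int ((g + axis i 1) $ j))) + (\<Prod>j\<in>UNIV. cos (t * real_of_int ((g + axis i (-1)) $ j)))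
    = 2 * cos t * (\<Prod>j\<in>UNIV. cos (t * real_of_int (g $ j)))"
proof -
  have *: "(\<Prod>j\<in>UNIV. cos (t * real_of_int ((g + axis i s) $ j)))
      = cos (t * real_of_int (g $ i) + t * real_of_int s) * (\<Prod>j\<in>UNIV - {i}. cos (t * real_of_int (g $ j)))" for s
  proof -
    have "(\<Prod>j\<in>UNIV - {i}. cos (t * real_of_int ((g + axis i s) $ j))) = (\<Prod>j\<in>UNIV - {i}. cos (t * real_of_int (g $ j)))"
      by (intro prod.cong) (auto simp: axis_def)
    then show ?thesis
      by (subst prod.remove[of _ i]) (auto simp: axis_def distrib_left)
  qed
  show ?thesis
    unfolding * prod.remove[of UNIV i "\<lambda>j. cos (t * real_of_int (g $ j))", simplified]
    by (simp add: cos_add cos_diff algebra_simps)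
qed

text \<open>The last assumption is the eigenvalue equation at the base \<open>h = 0\<close>, with denominators cleared.\<close>

locale comb_box_eigen =
  fixes n :: nat and q d :: real
  assumes n: "n \<ge> 1" and q: "0 < q" "q < 1" and d: "d = real CARD('d::finite)"
    and eq: "(1 - q\<^sup>2) * (1 + q ^ (2 * (n + 1))) = 2 * d * cos (box_freq n) * q * (1 - q ^ (2 * (n + 1)))"
begin

abbreviation "w \<equiv> box_pf n q :: (int ^ 'd) \<times> int \<Rightarrow> real"

lemma qN: "q ^ (2 * (n + 1)) < 1"
  using power_strict_decreasing[of 0 "2 * (n + 1)" q] q by simp

lemma profile_pos:
  assumes "k \<le> n"
  shows "box_profile n q k > 0"
proof -
  have "q ^ (2 * (n + 1) - k) < q ^ k"
    using assms q by (intro power_strict_decreasing) auto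
  then show ?thesis
    using qN by (simp add: box_profile_def)
qed

lemma profile_boundary: "box_profile n q (n + 1) = 0"
  by (simp add: box_profile_def mult_2)

lemma profile_0: "box_profile n q 0 = 1"
  using qN by (simp add: box_profile_def)

lemma profile_step:
  assumes "Suc k \<le> n"
  shows "box_profile n q (Suc (Suc k)) + box_profile n q k = (q + 1 / q) * box_profile n q (Suc k)"
proof -
  define m where "m = 2 * (n + 1) - Suc (Suc k)"
  have m: "2 * (n + 1) = Suc (Suc k) + m"
    using assms by (simp add: m_def)
  have e: "2 * (n + 1) - k = m + 2" "2 * (n + 1) - Suc k = m + 1" "2 * (n + 1) - Suc (Suc k) = m"
    using m by auto
  have "(q ^ Suc (Suc k) - q ^ m) + (q ^ k - q ^ (m + 2)) = (q + 1 / q) * (q ^ Suc k - q ^ (m + 1))"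
    using q by (simp add: field_simps)
  then show ?thesis
    unfolding box_profile_def e by (simp only: add_divide_distrib[symmetric] times_divide_eq_right)
qed

lemma profile_base: "2 * box_profile n q 1 + 2 * d * cos (box_freq n) = q + 1 / q"
proof -
  define p c where "p = box_profile n q 1" and "c = 2 * d * cos (box_freq n)"
  let ?Q = "q ^ (2 * n + 1)"
  have Q: "q ^ (2 * (n + 1)) = q * ?Q" "2 * (n + 1) - 1 = 2 * n + 1"
    by simp_all
  have nz: "1 - q * ?Q \<noteq> 0" "q \<noteq> 0"
    using qN q unfolding Q by auto
  have p: "p * (1 - q * ?Q) = q - ?Q"
    unfolding p_def box_profile_def Q using nz(1) by simp
  \<comment> \<open>The two sides are compared after multiplication by the nonzero factor
    \<open>q * (1 - q * ?Q)\<close>, where the claim becomes the assumption \<open>eq\<close>. A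
    free \<open>r\<close> keeps the factor \<open>1 - q * ?Q\<close> from being expanded.\<close>
  have "(2 * p + c) * (q * r) = 2 * q * (p * r) + c * q * r" for r
    by algebra
  then have "(2 * p + c) * (q * (1 - q * ?Q)) = 2 * q * (p * (1 - q * ?Q)) + c * q * (1 - q * ?Q)" .
  also have "\<dots> = 2 * q * (q - ?Q) + (1 - q\<^sup>2) * (1 + q * ?Q)"
    using eq unfolding p Q c_def[symmetric] by simp
  also have "\<dots> = (q + 1 / q) * (q * (1 - q * ?Q))"
    using nz(2) by (simp add: field_simps power2_eq_square)
  finally show ?thesis
    using nz unfolding p_def c_def by (metis mult_cancel_right mult_eq_0_iff)
qed

lemma w_pos: "x \<in> comb_box n \<Longrightarrow> w x > 0"
  by (cases x) (auto simp: box_pf_def comb_box_iff intro!: mult_pos_pos prod_pos cos_box_freq_pos profile_pos)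

lemma w_origin: "w (0, 0) = 1"
  by (simp add: box_pf_def profile_0)

text \<open>An arc changes each coordinate by at most one, so it can leave the box only onto a
  coordinate of modulus exactly \<open>n + 1\<close>, where either a cosine factor or the profile is
  zero. Hence the box equation for \<open>w\<close> is the comb equation.\<close>

lemma w_outside:
  assumes x: "x \<in> comb_box n" and xy: "(x, y) \<in> parcs comb_graph" and y: "y \<notin> comb_box n"
  shows "w y = 0"
proof -
  obtain g h g' h' where xy_eq: "x = (g, h)" "y = (g', h')"
    by (cases x; cases y)
  have near: "\<bar>g $ i - g' $ i\<bar> \<le> 1" "\<bar>h - h'\<bar> \<le> 1" for i
    using xy lattice_adjacent_le_1 by (auto simp: xy_eq comb_arc_iff)
  from y consider i where "\<bar>g' $ i\<bar> > int n" | "\<bar>h'\<bar> > int n"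
    by (auto simp: xy_eq comb_box_iff not_le)
  then show ?thesis
  proof cases
    case 1
    have "\<bar>g $ i\<bar> \<le> int n"
      using x by (simp add: xy_eq comb_box_iff)
    then have "\<bar>g' $ i\<bar> = int (n + 1)"
      using 1 near(1)[of i] by linarith
    then have "(\<Prod>i\<in>UNIV. cos (box_freq n * real_of_int (g' $ i))) = 0"
      using cos_box_freq_boundary by (intro prod_zero) auto
    then show ?thesis
      by (simp add: xy_eq box_pf_def)
  next
    case 2
    have "\<bar>h\<bar> \<le> int n"
      using x by (simp add: xy_eq comb_box_iff)
    then have "nat \<bar>h'\<bar> = n + 1"
      using 2 near(2) by linarith
    then show ?thesis
      by (simp only: xy_eq box_pf_def prod.case profile_boundary mult_zero_right)
  qed
qed

lemma w_eigen:
  assumes x: "x \<in> comb_box n"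
  shows "adj_op (induced comb_graph (comb_box n)) w x = (q + 1 / q) * w x"
proof -
  obtain g h where gh: "x = (g, h)"
    by (cases x)
  let ?C = "\<lambda>g :: int ^ 'd. \<Prod>i\<in>UNIV. cos (box_freq n * real_of_int (g $ i))"
  have "adj_op (induced comb_graph (comb_box n)) w x = adj_op comb_graph w x"
    by (rule comb.adj_op_induced[OF x w_outside[OF x]])
  also have "\<dots> = (q + 1 / q) * w x"
  proof (cases "h = 0")
    case True
    have "adj_op comb_graph w x = 2 * (?C g * box_profile n q 1)
        + (\<Sum>i\<in>UNIV. ?C (g + axis i 1) + ?C (g + axis i (-1)))"
      unfolding gh comb_adj_op using True by (simp add: box_pf_def profile_0)
    also have "(\<Sum>i\<in>UNIV. ?C (g + axis i 1) + ?C (g + axis i (-1))) = 2 * d * cos (box_freq n) * ?C g"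
      unfolding prod_cos_shift by (simp add: d)
    also have "2 * (?C g * box_profile n q 1) + 2 * d * cos (box_freq n) * ?C g
        = (2 * box_profile n q 1 + 2 * d * cos (box_freq n)) * ?C g"
      by (simp add: algebra_simps)
    also have "\<dots> = (q + 1 / q) * w x"
      unfolding profile_base using True by (simp add: gh box_pf_def profile_0)
    finally show ?thesis .
  next
    case False
    define k where "k = nat \<bar>h\<bar> - 1"
    have h: "nat \<bar>h\<bar> = Suc k"
      using False by (simp add: k_def)
    have "Suc k \<le> n"
      using x h by (auto simp: gh comb_box_iff)
    have "nat \<bar>h + 1\<bar> = Suc (Suc k) \<and> nat \<bar>h - 1\<bar> = k \<or> nat \<bar>h + 1\<bar> = k \<and> nat \<bar>h - 1\<bar> = Suc (Suc k)"
      using False unfolding k_def by linarith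
    then have "w (g, h + 1) + w (g, h - 1) = ?C g * (box_profile n q (Suc (Suc k)) + box_profile n q k)"
      unfolding box_pf_def prod.case distrib_left by (elim disjE conjE) (simp_all only: add.commute)
    also have "\<dots> = (q + 1 / q) * w (g, h)"
      using profile_step[of k] \<open>Suc k \<le> n\<close> by (simp add: box_pf_def h)
    finally show ?thesis
      using False by (simp only: gh comb_adj_op if_False add_0_right)
  qed
  finally show ?thesis .
qed

lemma perron_frobenius_box:
  shows "adj_norm (induced comb_graph (comb_box n :: ((int ^ 'd) \<times> int) set)) = q + 1 / q"
    and "perron_frobenius (induced comb_graph (comb_box n)) w"
proof -
  let ?L = "induced comb_graph (comb_box n :: ((int ^ 'd) \<times> int) set)"
  interpret L: locally_finite_graph ?L
    by (rule comb.locally_finite_graph_induced)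
  have V: "pverts ?L = comb_box n"
    by (simp add: induced_def)
  have *: "\<And>x. x \<in> pverts ?L \<Longrightarrow> w x > 0" "\<And>x. x \<in> pverts ?L \<Longrightarrow> adj_op ?L w x = (q + 1 / q) * w x"
    using w_pos w_eigen by (auto simp: V)
  have "pverts ?L \<noteq> {}"
    using comb_box_nonempty[of n] V by blast
  from L.perron_frobenius_finiteI[OF _ this *] q
  show "adj_norm ?L = q + 1 / q" "perron_frobenius ?L w"
    by (auto simp: V finite_comb_box)
qed

end

text \<open>This lets arbitrary Perron-Frobenius vectors of the boxes, normalised at the origin, be
  replaced by the explicit ones.\<close>

lemma perron_frobenius_box_unique:
  assumes "perron_frobenius (induced comb_graph (comb_box n)) v" "perron_frobenius (induced comb_graph (comb_box n)) w"
    and "v (0, 0) = w (0, 0)" and x: "x \<in> comb_box n"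
  shows "v x = w x"
proof -
  interpret L: locally_finite_graph "induced comb_graph (comb_box n :: ((int ^ 'a) \<times> int) set)"
    by (rule comb.locally_finite_graph_induced)
  have V: "pverts (induced comb_graph (comb_box n)) = comb_box n"
    by (simp add: induced_def)
  show ?thesis
  proof (rule L.perron_frobenius_unique[OF _ _ assms(1,2), of "(0, 0)"], unfold V)
    show "S = comb_box n" if "S \<subseteq> comb_box n" "S \<noteq> {}"
      "\<And>x y. x \<in> S \<Longrightarrow> (x, y) \<in> parcs (induced comb_graph (comb_box n)) \<Longrightarrow> y \<in> S" for S
      by (rule comb_box_connected[OF that])
  qed (use assms x comb_box_nonempty finite_comb_box in auto)
qed

text \<open>An intermediate value argument between \<open>0\<close> and \<open>0.9\<close>. For
  \<open>n \<ge> 1\<close> the frequency is at most \<open>pi / 4\<close>, which keeps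
  \<open>?c\<close> above \<open>1.4\<close> and leaves room for a bound on \<open>q\<close> that
  does not depend on \<open>n\<close>. For \<open>n = 0\<close> the cosine is zero and no such
  \<open>q\<close> exists; that box is a single vertex.\<close>

lemma box_decay_exists:
  assumes n: "n \<ge> 1" and d: "d \<ge> 1"
  shows "\<exists>q. 0 < q \<and> q < 0.9 \<and>
    (1 - q\<^sup>2) * (1 + q ^ (2 * (n + 1))) = 2 * d * cos (box_freq n) * q * (1 - q ^ (2 * (n + 1)))"
proof -
  let ?N = "n + 1" and ?c = "2 * d * cos (box_freq n)"
  have c: "?c \<ge> 1.4"
  proof -
    have "cos (pi / 4) \<le> cos (box_freq n)"
      by (rule cos_monotone_0_pi_le) (use n in \<open>auto simp: box_freq_def field_simps\<close>)
    moreover have "cos (pi / 4) \<ge> 0.7"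
    proof -
      have "sqrt 2 \<ge> 1.4"
        by (rule real_le_rsqrt) (simp add: power2_eq_square)
      then show ?thesis
        by (simp add: cos_45)
    qed
    ultimately have "1 * 0.7 \<le> d * cos (box_freq n)"
      using d by (intro mult_mono) auto
    then show ?thesis
      by simp
  qed
  \<comment> \<open>The difference of the two sides divided by \<open>1 - q\<^sup>2\<close>. The
    division, through the geometric sum, removes the trivial solution \<open>q = 1\<close>.\<close>
  define P where "P q = 1 + q ^ (2 * ?N) - ?c * q * (\<Sum>k<?N. (q\<^sup>2) ^ k)" for q :: real
  \<comment> \<open>The positive part is at most \<open>1 + 0.9 ^ 4 < 1.7\<close>. The first two
    terms of the geometric sum give \<open>1.81\<close>, so the subtracted part is at least
    \<open>1.4 * 0.9 * 1.81 > 2\<close>.\<close>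
  have "P 0.9 < 0"
  proof -
    have "(0.9 :: real) ^ (2 * ?N) \<le> 0.9 ^ 4"
      using n by (intro power_decreasing) auto
    then have 1: "(0.9 :: real) ^ (2 * ?N) \<le> 0.7"
      by (rule order_trans) (simp add: power_numeral_reduce)
    have "(\<Sum>k<2. ((0.9 :: real)\<^sup>2) ^ k) \<le> (\<Sum>k<?N. ((0.9)\<^sup>2) ^ k)"
      using n by (intro sum_mono2) auto
    then have "1.81 \<le> (\<Sum>k<?N. ((0.9 :: real)\<^sup>2) ^ k)"
      by (simp add: numeral_2_eq_2 power2_eq_square)
    then have "1.4 * 0.9 * 1.81 \<le> ?c * 0.9 * (\<Sum>k<?N. ((0.9 :: real)\<^sup>2) ^ k)"
      using c by (intro mult_mono) auto
    then have "2 \<le> ?c * 0.9 * (\<Sum>k<?N. ((0.9 :: real)\<^sup>2) ^ k)"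
      by (rule order_trans[rotated]) simp
    then show ?thesis
      using 1 unfolding P_def by simp
  qed
  moreover have "P 0 = 1"
    by (simp add: P_def)
  moreover have "continuous_on {0..0.9} P"
    unfolding P_def by (intro continuous_intros)
  ultimately obtain q where q: "0 \<le> q" "q \<le> 0.9" "P q = 0"
    using IVT2'[of P "0.9" 0 0] by auto
  have "q \<noteq> 0"
    using q(3) \<open>P 0 = 1\<close> by auto
  have "q \<noteq> 0.9"
    using q(3) \<open>P 0.9 < 0\<close> by (metis less_irrefl)
  have geo: "(1 - q\<^sup>2) * (\<Sum>k<?N. (q\<^sup>2) ^ k) = 1 - q ^ (2 * ?N)"
    unfolding power_mult one_diff_power_eq[of "q\<^sup>2" ?N] ..
  have "(1 - q\<^sup>2) * (1 + q ^ (2 * ?N)) = (1 - q\<^sup>2) * (?c * q * (\<Sum>k<?N. (q\<^sup>2) ^ k))"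
    using q(3) by (simp add: P_def)
  also have "\<dots> = ?c * q * (1 - q ^ (2 * ?N))"
    unfolding geo[symmetric] by (simp only: mult_ac)
  finally show ?thesis
    using q \<open>q \<noteq> 0\<close> \<open>q \<noteq> 0.9\<close> by (intro exI[of _ q]) (auto simp: less_le)
qed

text \<open>Beyond index \<open>0\<close>, the uniform bound \<open>0.9\<close> makes the correction \<open>q ^ (2 * (n + 1))\<close> vanish in the limit.\<close>

definition box_decay :: "real \<Rightarrow> nat \<Rightarrow> real" where
  "box_decay d n = (SOME q. 0 < q \<and> q < 0.9 \<and>
    (1 - q\<^sup>2) * (1 + q ^ (2 * (n + 1))) = 2 * d * cos (box_freq n) * q * (1 - q ^ (2 * (n + 1))))"

lemma box_decay:
  assumes "n \<ge> 1" "d \<ge> 1"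
  shows "0 < box_decay d n" "box_decay d n < 0.9"
    and "(1 - (box_decay d n)\<^sup>2) * (1 + box_decay d n ^ (2 * (n + 1)))
      = 2 * d * cos (box_freq n) * box_decay d n * (1 - box_decay d n ^ (2 * (n + 1)))"
  using someI_ex[OF box_decay_exists[OF assms]] unfolding box_decay_def[symmetric] by blast+

section \<open>Limits as the boxes grow\<close>

lemma box_freq_tendsto: "box_freq \<longlonglongrightarrow> 0"
  unfolding box_freq_def by real_asymp

text \<open>The exponent is left general because both \<open>2 * (n + 1)\<close> and
  \<open>2 * (n + 1) - k\<close> occur; the threshold \<open>K\<close> excludes the small
  \<open>n\<close> for which the subtraction may truncate.\<close>

lemma box_decay_power_tendsto:
  assumes d: "d \<ge> 1" and m: "\<And>n. n \<ge> K \<Longrightarrow> m n \<ge> n"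
  shows "(\<lambda>n. box_decay d n ^ m n) \<longlonglongrightarrow> 0"
proof (rule Lim_null_comparison)
  show "(\<lambda>n. 0.9 ^ n :: real) \<longlonglongrightarrow> 0"
    by (rule LIMSEQ_power_zero) simp
  have "norm (box_decay d n ^ m n) \<le> 0.9 ^ n" if "n \<ge> max 1 K" for n
  proof -
    have "box_decay d n ^ m n \<le> box_decay d n ^ n"
      using box_decay(1,2)[of n d] d that m by (intro power_decreasing) auto
    also have "\<dots> \<le> 0.9 ^ n"
      using box_decay(1,2)[of n d] d that by (intro power_mono) auto
    finally show ?thesis
      using box_decay(1)[of n d] d that by simp
  qed
  then show "\<forall>\<^sub>F n in sequentially. norm (box_decay d n ^ m n) \<le> 0.9 ^ n"
    unfolding eventually_sequentially by blast
qed

text \<open>Absorbing the correction \<open>Q n\<close> into an effective coefficient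
  \<open>y n\<close> turns the implicit equation into \<open>1 - q\<^sup>2 = 2 * y n * q\<close>.
  Its positive root is explicit, namely \<open>comb_decay (y n)\<close>, so convergence of
  \<open>y n\<close> to \<open>d\<close> is all that is required.\<close>

lemma box_decay_tendsto:
  assumes d: "d \<ge> 1"
  shows "box_decay d \<longlonglongrightarrow> comb_decay d"
    and "(\<lambda>n. box_decay d n + 1 / box_decay d n) \<longlonglongrightarrow> 2 * sqrt (d\<^sup>2 + 1)"
proof -
  define Q where "Q n = box_decay d n ^ (2 * (n + 1))" for n
  define y where "y n = d * cos (box_freq n) * (1 - Q n) / (1 + Q n)" for n
  have "Q \<longlonglongrightarrow> 0"
    unfolding Q_def by (rule box_decay_power_tendsto[OF d, of 0]) simp
  then have "y \<longlonglongrightarrow> d * cos 0 * (1 - 0) / (1 + 0)"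
    unfolding y_def by (intro tendsto_intros box_freq_tendsto) auto
  then have y: "y \<longlonglongrightarrow> d"
    by simp
  have *: "box_decay d n = sqrt ((y n)\<^sup>2 + 1) - y n"
    "box_decay d n + 1 / box_decay d n = 2 * sqrt ((y n)\<^sup>2 + 1)" if n: "n \<ge> 1" for n
  proof -
    let ?q = "box_decay d n"
    have q: "?q > 0"
      by (rule box_decay(1)[OF n d])
    then have "1 + Q n > 0"
      by (simp add: Q_def add_pos_pos)
    then have "1 - ?q\<^sup>2 = 2 * y n * ?q"
      using box_decay(3)[OF n d] by (simp add: y_def Q_def field_simps)
    then have y_eq: "y n = (1 / ?q - ?q) / 2"
      using q by (simp add: field_simps power2_eq_square)
    have "(y n)\<^sup>2 + 1 = ((1 / ?q + ?q) / 2)\<^sup>2"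
      unfolding y_eq using q by (simp add: field_simps power2_eq_square)
    then have "sqrt ((y n)\<^sup>2 + 1) = (1 / ?q + ?q) / 2"
      using q by simp
    then show "?q = sqrt ((y n)\<^sup>2 + 1) - y n" "?q + 1 / ?q = 2 * sqrt ((y n)\<^sup>2 + 1)"
      unfolding y_eq by (simp_all add: field_simps)
  qed
  have "(\<lambda>n. sqrt ((y n)\<^sup>2 + 1) - y n) \<longlonglongrightarrow> comb_decay d"
    unfolding comb_decay_def by (intro tendsto_intros y)
  moreover have "\<forall>\<^sub>F n in sequentially. sqrt ((y n)\<^sup>2 + 1) - y n = box_decay d n"
    using eventually_ge_at_top[of 1] by eventually_elim (use *(1) in simp)
  ultimately show "box_decay d \<longlonglongrightarrow> comb_decay d"
    by (rule Lim_transform_eventually)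
  have "(\<lambda>n. 2 * sqrt ((y n)\<^sup>2 + 1)) \<longlonglongrightarrow> 2 * sqrt (d\<^sup>2 + 1)"
    by (intro tendsto_intros y)
  moreover have "\<forall>\<^sub>F n in sequentially. 2 * sqrt ((y n)\<^sup>2 + 1) = box_decay d n + 1 / box_decay d n"
    using eventually_ge_at_top[of 1] by eventually_elim (use *(2) in simp)
  ultimately show "(\<lambda>n. box_decay d n + 1 / box_decay d n) \<longlonglongrightarrow> 2 * sqrt (d\<^sup>2 + 1)"
    by (rule Lim_transform_eventually)
qed

lemma box_pf_tendsto:
  fixes g :: "int ^ 'd::finite"
  assumes d: "d \<ge> 1"
  shows "(\<lambda>n. box_pf n (box_decay d n) (g, h)) \<longlonglongrightarrow> comb_decay d ^ nat \<bar>h\<bar>"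
proof -
  let ?k = "nat \<bar>h\<bar>"
  have "(\<lambda>n. \<Prod>i\<in>UNIV. cos (box_freq n * real_of_int (g $ i))) \<longlonglongrightarrow> (\<Prod>i\<in>(UNIV :: 'd set). cos (0 * real_of_int (g $ i)))"
    by (intro tendsto_intros box_freq_tendsto)
  moreover have "(\<lambda>n. box_profile n (box_decay d n) ?k) \<longlonglongrightarrow> (comb_decay d ^ ?k - 0) / (1 - 0)"
    unfolding box_profile_def
  proof (intro tendsto_intros box_decay_tendsto(1)[OF d])
    show "(\<lambda>n. box_decay d n ^ (2 * (n + 1) - ?k)) \<longlonglongrightarrow> 0"
      by (rule box_decay_power_tendsto[OF d, of ?k]) simp
    show "(\<lambda>n. box_decay d n ^ (2 * (n + 1))) \<longlonglongrightarrow> 0"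
      by (rule box_decay_power_tendsto[OF d, of 0]) simp
  qed simp
  ultimately have "(\<lambda>n. (\<Prod>i\<in>UNIV. cos (box_freq n * real_of_int (g $ i))) * box_profile n (box_decay d n) ?k)
      \<longlonglongrightarrow> (\<Prod>i\<in>(UNIV :: 'd set). cos (0 * real_of_int (g $ i))) * ((comb_decay d ^ ?k - 0) / (1 - 0))"
    by (rule tendsto_mult)
  then show ?thesis
    by (simp add: box_pf_def)
qed

lemma comb_box_eigen_box_decay:
  assumes "n \<ge> 1"
  shows "comb_box_eigen TYPE('d::finite) n (box_decay (real CARD('d)) n) (real CARD('d))"
proof
  have "real CARD('d) \<ge> 1"
    by (simp add: Suc_leI)
  note q = box_decay[OF assms this]
  show "0 < box_decay (real CARD('d)) n" "box_decay (real CARD('d)) n < 1"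
    using q(1,2) by linarith+
  show "(1 - (box_decay (real CARD('d)) n)\<^sup>2) * (1 + box_decay (real CARD('d)) n ^ (2 * (n + 1)))
      = 2 * real CARD('d) * cos (box_freq n) * box_decay (real CARD('d)) n * (1 - box_decay (real CARD('d)) n ^ (2 * (n + 1)))"
    by (rule q(3))
qed (use assms in auto)

text \<open>The generalized eigenvector is constant along the base and thus not square-summable, so
  it gives only the upper bound. The lower bound comes from the boxes, whose norms
  \<open>q + 1 / q\<close> cannot exceed that of the comb.\<close>

theorem adj_norm_comb_graph:
  "adj_norm (comb_graph :: ((int ^ 'd::finite) \<times> int) pair_pre_digraph) = 2 * sqrt ((real CARD('d))\<^sup>2 + 1)"
proof (rule antisym)
  let ?G = "comb_graph :: ((int ^ 'd) \<times> int) pair_pre_digraph" and ?d = "real CARD('d)"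
  show "adj_norm ?G \<le> 2 * sqrt (?d\<^sup>2 + 1)"
    by (rule comb_schur(2)[OF refl])
  show "2 * sqrt (?d\<^sup>2 + 1) \<le> adj_norm ?G"
  proof (rule LIMSEQ_le_const2)
    show "(\<lambda>n. box_decay ?d n + 1 / box_decay ?d n) \<longlonglongrightarrow> 2 * sqrt (?d\<^sup>2 + 1)"
      by (rule box_decay_tendsto(2)) (simp add: Suc_leI)
    have "box_decay ?d n + 1 / box_decay ?d n \<le> adj_norm ?G" if "n \<ge> 1" for n
      using comb.induced_bounded(2)[of "comb_box n :: ((int ^ 'd) \<times> int) set"]
        comb_box_eigen.perron_frobenius_box(1)[OF comb_box_eigen_box_decay[OF that, where 'd = 'd]] by simp
    then show "\<exists>N. \<forall>n\<ge>N. box_decay ?d n + 1 / box_decay ?d n \<le> adj_norm ?G"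
      by blast
  qed
qed

lemma perron_frobenius_comb_graph:
  "perron_frobenius (comb_graph :: ((int ^ 'd::finite) \<times> int) pair_pre_digraph)
    (\<lambda>(g, h). comb_decay (real CARD('d)) ^ nat \<bar>h\<bar>)"
  unfolding perron_frobenius_def adj_norm_comb_graph
  using comb_decay(1) comb_pf_eigenvector[where 'd = 'd] by auto

text \<open>The case without a decay parameter: a single vertex has no arcs, and its norm is
  \<open>0\<close>.\<close>

lemma perron_frobenius_box_0: "perron_frobenius (induced comb_graph (comb_box 0)) (\<lambda>x. 1)"
proof -
  interpret L: locally_finite_graph "induced comb_graph (comb_box 0 :: ((int ^ 'a) \<times> int) set)"
    by (rule comb.locally_finite_graph_induced)
  have box: "comb_box 0 = {(0 :: int ^ 'a, 0 :: int)}"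
    by (auto simp: comb_box_iff vec_eq_iff)
  have arcs: "parcs (induced comb_graph (comb_box 0 :: ((int ^ 'a) \<times> int) set)) = {}"
    by (auto simp: induced_def box comb_arc_iff lattice_graph_def)
  have V: "pverts (induced comb_graph (comb_box 0)) = {(0 :: int ^ 'a, 0 :: int)}"
    by (simp add: induced_def box)
  show ?thesis
    by (rule L.perron_frobenius_finiteI(2)[of _ 0]) (auto simp: L.adj_op_eq arcs V)
qed

section \<open>The integrated density of states of the comb\<close>

text \<open>Coefficients of the powers of \<open>E - A\<close> for the adjacency operator \<open>A\<close> of the integer path.\<close>

primrec path_coeff :: "real \<Rightarrow> nat \<Rightarrow> int \<Rightarrow> real" where
  "path_coeff E 0 k = (if k = 0 then 1 else 0)"
| "path_coeff E (Suc i) k = E * path_coeff E i k - (path_coeff E i (k + 1) + path_coeff E i (k - 1))"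

lemma path_coeff_outside: "\<bar>k\<bar> > int i \<Longrightarrow> path_coeff E i k = 0"
  by (induction i arbitrary: k) auto

lemma cos_integral_01:
  "integral {0..1} (\<lambda>u. cos (pi * (real_of_int k * u))) = (if k = 0 then 1 else 0)"
proof (cases "k = 0")
  case False
  have "((\<lambda>u. cos (pi * (real_of_int k * u))) has_integral
      sin (pi * (real_of_int k * 1)) / (pi * real_of_int k) - sin (pi * (real_of_int k * 0)) / (pi * real_of_int k)) {0..1}"
    using False by (intro fundamental_theorem_of_calculus)
      (auto intro!: derivative_eq_intros simp flip: has_real_derivative_iff_has_vector_derivative)
  then show ?thesis
    using False by (simp add: integral_unique)
qed simp

text \<open>Fourier transform turns \<open>E - A\<close> on the integer path into multiplication by
  \<open>E - 2 * cos (pi * u)\<close>. That symbol is even, so half a period and cosines suffice;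
  the recursion is the product formula for two cosines.\<close>

lemma path_coeff_integral:
  "path_coeff E i k = integral {0..1} (\<lambda>u. cos (pi * (real_of_int k * u)) * (E - 2 * cos (pi * u)) ^ i)"
proof (induction i arbitrary: k)
  case 0
  then show ?case
    by (simp add: cos_integral_01)
next
  case (Suc i)
  let ?t = "\<lambda>u. E - 2 * cos (pi * u)" and ?c = "\<lambda>k u. cos (pi * (real_of_int k * u))"
  have int: "(\<lambda>u. ?c k u * ?t u ^ i) integrable_on {0..1}" for k
    by (intro integrable_continuous_interval continuous_intros)
  have "?c k u * ?t u ^ Suc i = E * (?c k u * ?t u ^ i) - (?c (k + 1) u * ?t u ^ i + ?c (k - 1) u * ?t u ^ i)" for u
  proof -
    have "2 * cos (pi * u) * ?c k u = ?c (k + 1) u + ?c (k - 1) u"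
      by (simp add: distrib_left distrib_right left_diff_distrib right_diff_distrib cos_add cos_diff mult.commute)
    then have "?c k u * ?t u = E * ?c k u - (?c (k + 1) u + ?c (k - 1) u)"
      by (simp add: algebra_simps)
    then have "(?c k u * ?t u) * ?t u ^ i = (E * ?c k u - (?c (k + 1) u + ?c (k - 1) u)) * ?t u ^ i"
      by simp
    then show ?thesis
      by (simp add: algebra_simps)
  qed
  then have "integral {0..1} (\<lambda>u. ?c k u * ?t u ^ Suc i)
      = integral {0..1} (\<lambda>u. E * (?c k u * ?t u ^ i) - (?c (k + 1) u * ?t u ^ i + ?c (k - 1) u * ?t u ^ i))"
    by presburger
  also have "\<dots> = E * integral {0..1} (\<lambda>u. ?c k u * ?t u ^ i)
      - (integral {0..1} (\<lambda>u. ?c (k + 1) u * ?t u ^ i) + integral {0..1} (\<lambda>u. ?c (k - 1) u * ?t u ^ i))"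
    by (subst integral_diff, intro integrable_on_mult_right int, intro integrable_add int,
        subst integral_add, intro int, intro int, subst integral_mult_right, rule refl)
  finally show ?case
    by (simp only: path_coeff.simps Suc.IH)
qed

text \<open>For \<open>\<bar>h\<bar> \<ge> i\<close> a walk of length \<open>i\<close> from \<open>(g, h)\<close> has no time to use an edge of the base.\<close>

lemma hamiltonian_power_indicator:
  fixes g g' :: "int ^ 'd::finite"
  assumes "int i \<le> \<bar>h\<bar>"
  shows "(hamiltonian comb_graph ^^ i) (indicator {(g, h)}) (g', h') =
    (if g' = g then complex_of_real (path_coeff (adj_norm (comb_graph :: ((int ^ 'd) \<times> int) pair_pre_digraph)) i (h' - h)) else 0)"
  using assms
proof (induction i arbitrary: g' h')
  case 0
  then show ?case
    by (auto simp: indicator_def)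
next
  case (Suc i)
  let ?E = "adj_norm (comb_graph :: ((int ^ 'd) \<times> int) pair_pre_digraph)"
  let ?F = "(hamiltonian comb_graph ^^ i) (indicator {(g, h)})"
  have F: "?F (g', h') = (if g' = g then complex_of_real (path_coeff ?E i (h' - h)) else 0)" for g' h'
    using Suc by simp
  \<comment> \<open>Here the height condition enters: \<open>Suc i \<le> \<bar>h\<bar>\<close> puts
    the base at distance greater than \<open>i\<close>, so after \<open>i\<close> steps nothing has
    arrived there and the lattice term of the adjacency operator is zero.\<close>
  have base: "?F (g', 0) = 0" for g'
    using Suc.prems by (simp add: F path_coeff_outside)
  have "(hamiltonian comb_graph ^^ Suc i) (indicator {(g, h)}) (g', h')
      = complex_of_real ?E * ?F (g', h') - (?F (g', h' + 1) + ?F (g', h' - 1))"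
    by (simp add: hamiltonian_def comb_adj_op base)
  also have "\<dots> = (if g' = g then complex_of_real (path_coeff ?E (Suc i) (h' - h)) else 0)"
    by (simp add: F algebra_simps)
  finally show ?case .
qed

text \<open>Taken as the image of the uniform distribution under the Fourier symbol of
  \<open>E - A\<close>. This avoids the arcsine density, which is singular at both endpoints, and
  integrals of continuous functions become integrals of continuous functions over
  \<open>{0..1}\<close>.\<close>

definition path_ids :: "real \<Rightarrow> real measure" where
  "path_ids E = distr (restrict_space lborel {0..1}) borel (\<lambda>u. E - 2 * cos (pi * u))"

lemma path_ids_measurable [measurable]:
  "(\<lambda>u. E - 2 * cos (pi * u)) \<in> borel_measurable (restrict_space lborel {0..1})"
  by (intro measurable_restrict_space1) measurable

lemma emeasure_path_ids:
  assumes "A \<in> sets borel"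
  shows "emeasure (path_ids E) A = emeasure lborel ({u. E - 2 * cos (pi * u) \<in> A} \<inter> {0..1})"
proof -
  have "emeasure (path_ids E) A = emeasure (restrict_space lborel {0..1})
      ((\<lambda>u. E - 2 * cos (pi * u)) -` A \<inter> space (restrict_space lborel {0..1}))"
    unfolding path_ids_def by (rule emeasure_distr[OF path_ids_measurable assms])
  also have "(\<lambda>u. E - 2 * cos (pi * u)) -` A \<inter> space (restrict_space lborel {0..1})
      = {u. E - 2 * cos (pi * u) \<in> A} \<inter> {0..1}"
    by (auto simp: space_restrict_space)
  finally show ?thesis
    by (simp add: emeasure_restrict_space)
qed

lemma prob_space_path_ids: "prob_space (path_ids E)"
proof
  have "space (path_ids E) = UNIV"
    by (simp add: path_ids_def)
  then show "emeasure (path_ids E) (space (path_ids E)) = 1"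
    by (simp add: emeasure_path_ids)
qed

lemma path_ids_integral:
  fixes \<phi> :: "real \<Rightarrow> complex"
  assumes "continuous_on UNIV \<phi>"
  shows "integrable (path_ids E) \<phi>"
    and "integral\<^sup>L (path_ids E) \<phi> = integral {0..1} (\<lambda>u. \<phi> (E - 2 * cos (pi * u)))"
proof -
  let ?f = "\<lambda>u. \<phi> (E - 2 * cos (pi * u))"
  have meas: "\<phi> \<in> borel_measurable borel"
    using assms by (rule borel_measurable_continuous_onI)
  have "continuous_on {0..1} ?f"
    by (intro continuous_on_compose2[OF assms] continuous_intros) auto
  then have int: "set_integrable lborel {0..1} ?f"
    by (rule borel_integrable_atLeastAtMost')
  then have int': "integrable (restrict_space lborel {0..1}) ?f"
    unfolding set_integrable_def by (subst integrable_restrict_space) auto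
  then show "integrable (path_ids E) \<phi>"
    unfolding path_ids_def by (subst integrable_distr_eq[OF path_ids_measurable meas])
  have "integral\<^sup>L (path_ids E) \<phi> = integral\<^sup>L (restrict_space lborel {0..1}) ?f"
    unfolding path_ids_def by (rule integral_distr[OF path_ids_measurable meas])
  also have "\<dots> = (LINT u:{0..1}|lborel. ?f u)"
    unfolding set_lebesgue_integral_def by (rule integral_restrict_space) simp
  also have "\<dots> = integral {0..1} ?f"
    by (rule set_borel_integral_eq_integral(2)[OF int])
  finally show "integral\<^sup>L (path_ids E) \<phi> = integral {0..1} ?f" .
qed

lemma path_ids_poly:
  "integral\<^sup>L (path_ids E) (\<lambda>t. poly p (complex_of_real t))
    = (\<Sum>i\<le>degree p. coeff p i * complex_of_real (path_coeff E i 0))"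
proof -
  have cont: "continuous_on UNIV (\<lambda>t. poly p (complex_of_real t))"
    by (intro continuous_intros)
  have "((\<lambda>u. coeff p i * complex_of_real ((E - 2 * cos (pi * u)) ^ i)) has_integral
      coeff p i * complex_of_real (path_coeff E i 0)) {0..1}" for i
  proof -
    have "(\<lambda>u. (E - 2 * cos (pi * u)) ^ i) integrable_on {0..1}"
      by (intro integrable_continuous_interval continuous_intros)
    moreover have "path_coeff E i 0 = integral {0..1} (\<lambda>u. (E - 2 * cos (pi * u)) ^ i)"
      using path_coeff_integral[of E i 0] by simp
    ultimately have "((\<lambda>u. (E - 2 * cos (pi * u)) ^ i) has_integral path_coeff E i 0) {0..1}"
      by (simp add: has_integral_integral)
    then show ?thesis
      by (intro has_integral_mult_right has_integral_of_real)
  qed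
  then have "((\<lambda>u. \<Sum>i\<le>degree p. coeff p i * complex_of_real ((E - 2 * cos (pi * u)) ^ i)) has_integral
      (\<Sum>i\<le>degree p. coeff p i * complex_of_real (path_coeff E i 0))) {0..1}"
    by (intro has_integral_sum) auto
  then show ?thesis
    unfolding path_ids_integral(2)[OF cont] by (intro integral_unique) (simp add: poly_altdef)
qed

text \<open>The point \<open>E\<close> is the image of \<open>u = 1 / 2\<close>, where the cosine
  vanishes. It shows that the support is nonempty, as required for the lower bound on the infimum in
  \<open>E_m\<close>.\<close>

lemma measure_support_path_ids:
  shows "t \<in> measure_support (path_ids E) \<Longrightarrow> E - 2 \<le> t" and "E \<in> measure_support (path_ids E)"
proof -
  show "E - 2 \<le> t" if "t \<in> measure_support (path_ids E)"
  proof (rule ccontr)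
    assume "\<not> E - 2 \<le> t"
    then have "emeasure (path_ids E) {..<E - 2} > 0"
      using that by (auto simp: measure_support_def)
    moreover have "{u. E - 2 * cos (pi * u) \<in> {..<E - 2}} = {}"
      using cos_le_one by (auto simp: not_less)
    ultimately show False
      by (simp add: emeasure_path_ids)
  qed
  show "E \<in> measure_support (path_ids E)"
    unfolding measure_support_def
  proof (intro CollectI allI impI)
    fix U assume U: "open U" "E \<in> U"
    let ?S = "{u. E - 2 * cos (pi * u) \<in> U} \<inter> {0<..<1}"
    have "continuous_on UNIV (\<lambda>u. E - 2 * cos (pi * u))"
      by (intro continuous_intros)
    from open_vimage[OF U(1) this] have "open {u. E - 2 * cos (pi * u) \<in> U}"
      by (simp add: vimage_def)
    then have "open ?S"
      by (intro open_Int) auto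
    moreover have "1 / 2 \<in> ?S"
      using U(2) by simp
    ultimately obtain e where e: "e > 0" "cball (1 / 2) e \<subseteq> ?S"
      by (meson open_contains_cball)
    have "0 < ennreal (2 * e)"
      using e(1) by simp
    also have "\<dots> = emeasure lborel {1 / 2 - e..1 / 2 + e}"
      using e(1) by simp
    also have "\<dots> \<le> emeasure lborel ({u. E - 2 * cos (pi * u) \<in> U} \<inter> {0..1})"
    proof (rule emeasure_mono)
      show "{1 / 2 - e..1 / 2 + e} \<subseteq> {u. E - 2 * cos (pi * u) \<in> U} \<inter> {0..1}"
        by (rule subset_trans[OF e(2)[unfolded cball_eq_atLeastAtMost]]) auto
      have "{u. E - 2 * cos (pi * u) \<in> U} \<in> sets borel"
        using \<open>open {u. E - 2 * cos (pi * u) \<in> U}\<close> by simp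
      then show "{u. E - 2 * cos (pi * u) \<in> U} \<inter> {0..1} \<in> sets lborel"
        by simp
    qed
    also have "\<dots> = emeasure (path_ids E) U"
      using U(1) by (simp add: emeasure_path_ids)
    finally show "emeasure (path_ids E) U > 0" .
  qed
qed

section \<open>Normalised traces over the boxes\<close>

lemma card_symmetric_interval: "card {- int n..int n} = 2 * n + 1"
  unfolding card_atLeastAtMost_int by linarith

lemma card_comb_box: "card (comb_box n :: ((int ^ 'd::finite) \<times> int) set) = (2 * n + 1) ^ CARD('d) * (2 * n + 1)"
  unfolding comb_box_def card_cartesian_product vec_box(2)[OF finite_atLeastAtMost_int]
    card_symmetric_interval ..

lemma card_comb_box_strip:
  "card {x \<in> comb_box n :: ((int ^ 'd::finite) \<times> int) set. \<bar>snd x\<bar> \<le> int m} \<le> (2 * n + 1) ^ CARD('d) * (2 * m + 1)"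
proof -
  let ?B = "{g :: int ^ 'd. \<forall>i. g $ i \<in> {- int n..int n}}"
  have "card {x \<in> comb_box n :: ((int ^ 'd) \<times> int) set. \<bar>snd x\<bar> \<le> int m} \<le> card (?B \<times> {- int m..int m})"
    by (intro card_mono finite_cartesian_product vec_box(1)) (auto simp: comb_box_def)
  also have "\<dots> = (2 * n + 1) ^ CARD('d) * (2 * m + 1)"
    unfolding card_cartesian_product vec_box(2)[OF finite_atLeastAtMost_int] card_symmetric_interval ..
  finally show ?thesis .
qed

lemma trace_op_comp_proj:
  assumes "finite W" "bounded_operator UNIV S"
  shows "trace_op UNIV (S \<circ> proj W) = (\<Sum>x\<in>W. S (indicator {x}) x)"
proof -
  have "proj W (indicator {x}) = (if x \<in> W then indicator {x} else (\<lambda>y. 0))" for x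
    by (auto simp: proj_def indicator_def)
  then have "(S \<circ> proj W) (indicator {x}) x = (if x \<in> W then S (indicator {x}) x else 0)" for x
    using bounded_operator_zero[OF assms(2)] by simp
  then have "trace_op UNIV (S \<circ> proj W) = (\<Sum>\<^sub>\<infinity>x. if x \<in> W then S (indicator {x}) x else 0)"
    unfolding trace_op_def by (intro infsum_cong) metis
  also have "\<dots> = (\<Sum>\<^sub>\<infinity>x\<in>W. S (indicator {x}) x)"
    by (rule infsum_cong_neutral) auto
  finally show ?thesis
    using assms(1) by simp
qed

text \<open>The deviation \<open>D x\<close> of a diagonal entry from the limit is zero at heights
  above the degree \<open>m\<close> and bounded everywhere. The remaining strip makes up at most the
  fraction \<open>(2 * m + 1) / (2 * n + 1)\<close> of the box, so the mean deviation tends to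
  zero.\<close>

lemma comb_poly_trace_tendsto:
  fixes G :: "((int ^ 'd::finite) \<times> int) pair_pre_digraph"
  assumes G: "G = comb_graph"
  shows "(\<lambda>n. (\<Sum>x\<in>comb_box n. poly_op p (hamiltonian G) (indicator {x}) x) / of_nat (card (comb_box n :: ((int ^ 'd) \<times> int) set)))
    \<longlonglongrightarrow> integral\<^sup>L (path_ids (adj_norm G)) (\<lambda>t. poly p (complex_of_real t))"
proof -
  let ?H = "hamiltonian G" and ?I = "integral\<^sup>L (path_ids (adj_norm G)) (\<lambda>t. poly p (complex_of_real t))"
  let ?W = "\<lambda>n. comb_box n :: ((int ^ 'd) \<times> int) set"
  define m where "m = degree p"
  have bdd: "bounded_operator UNIV (poly_op p ?H)"
    using comb.bounded_operator_hamiltonian comb.adj_bounded unfolding G by (intro bounded_operator_poly) auto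
  obtain C where C: "C > 0" "\<And>f. f \<in> ell2 UNIV \<Longrightarrow> ell2_norm (poly_op p ?H f) \<le> C * ell2_norm f"
    using bounded_operator_bound[OF bdd] by blast
  define D where "D x = poly_op p ?H (indicator {x}) x - ?I" for x
  have D_far: "D x = 0" if "\<bar>snd x\<bar> > int m" for x
  proof -
    obtain g h where x: "x = (g, h)"
      by (cases x)
    have "(?H ^^ i) (indicator {(g, h)}) (g, h) = complex_of_real (path_coeff (adj_norm G) i 0)" if "i \<le> m" for i
      unfolding G using hamiltonian_power_indicator[of i h g g h] that \<open>\<bar>snd x\<bar> > int m\<close> by (simp add: x)
    then show ?thesis
      by (simp add: D_def path_ids_poly poly_op_def x m_def)
  qed
  have D_le: "cmod (D x) \<le> C + cmod ?I" for x
  proof -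
    have "cmod (poly_op p ?H (indicator {x}) x) \<le> ell2_norm (poly_op p ?H (indicator {x}))"
      by (rule cmod_le_ell2_norm[OF bounded_operatorD(1)[OF bdd]]) (simp add: ell2_indicator)
    also have "\<dots> \<le> C * 1"
      using C(2)[OF ell2_indicator[of x UNIV]] by simp
    finally show ?thesis
      unfolding D_def using norm_triangle_ineq4[of "poly_op p ?H (indicator {x}) x" ?I] by linarith
  qed
  have le: "norm ((\<Sum>x\<in>?W n. poly_op p ?H (indicator {x}) x) / of_nat (card (?W n)) - ?I)
      \<le> (C + cmod ?I) * real (2 * m + 1) * (1 / real (2 * n + 1))" for n
  proof -
    let ?c = "real ((2 * n + 1) ^ CARD('d))"
    have c: "?c > 0" "real (card (?W n)) = ?c * real (2 * n + 1)"
      unfolding card_comb_box by (simp_all add: algebra_simps)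
    then have nz: "(of_nat (card (?W n)) :: complex) \<noteq> 0"
      using of_nat_eq_0_iff[of "card (?W n)"] by (metis mult_eq_0_iff of_nat_0_eq_iff less_irrefl Suc_neq_Zero Suc_eq_plus1)
    have "(\<Sum>x\<in>?W n. poly_op p ?H (indicator {x}) x) / of_nat (card (?W n)) - ?I = (\<Sum>x\<in>?W n. D x) / of_nat (card (?W n))"
      using nz by (simp add: D_def sum_subtractf field_simps)
    also have "(\<Sum>x\<in>?W n. D x) = (\<Sum>x | x \<in> ?W n \<and> \<bar>snd x\<bar> \<le> int m. D x)"
      by (rule sum.mono_neutral_right) (use finite_comb_box D_far in \<open>auto simp: not_le\<close>)
    also have "norm (\<dots> / of_nat (card (?W n))) \<le> (C + cmod ?I) * real ((2 * n + 1) ^ CARD('d) * (2 * m + 1)) / real (card (?W n))"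
    proof -
      have "norm (\<Sum>x | x \<in> ?W n \<and> \<bar>snd x\<bar> \<le> int m. D x) \<le> real (card {x \<in> ?W n. \<bar>snd x\<bar> \<le> int m}) * (C + cmod ?I)"
        by (rule sum_norm_bound) (rule D_le)
      also have "\<dots> \<le> real ((2 * n + 1) ^ CARD('d) * (2 * m + 1)) * (C + cmod ?I)"
        using card_comb_box_strip[of n m, where 'd = 'd] C(1) by (intro mult_right_mono of_nat_mono) auto
      finally show ?thesis
        unfolding norm_divide norm_of_nat mult.commute[of "C + cmod ?I"] by (rule divide_right_mono) simp
    qed
    also have "\<dots> = (C + cmod ?I) * real (2 * m + 1) * (1 / real (2 * n + 1))"
    proof -
      have "a * (c * b) / (c * b') = a * b * (1 / b')" if "c > 0" for a b b' c :: real
        using that by simp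
      from this[OF c(1)] show ?thesis
        unfolding c(2) of_nat_mult .
    qed
    finally show ?thesis .
  qed
  have "(\<lambda>n. (C + cmod ?I) * real (2 * m + 1) * (1 / real (2 * n + 1))) \<longlonglongrightarrow> (C + cmod ?I) * real (2 * m + 1) * 0"
    by (intro tendsto_mult tendsto_const) real_asymp
  then have lim: "(\<lambda>n. (C + cmod ?I) * real (2 * m + 1) * (1 / real (2 * n + 1))) \<longlonglongrightarrow> 0"
    by simp
  show ?thesis
    by (rule LIM_zero_cancel, rule Lim_null_comparison[OF always_eventually lim]) (use le in blast)
qed

text \<open>A polynomial close to \<open>\<phi>\<close> reduces the claim to
  \<open>comb_poly_trace_tendsto\<close>: the error in operator norm dominates the error of every
  diagonal entry, hence of their mean over a box, uniformly in \<open>n\<close>. Operator error,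
  trace limit and integral error cost \<open>e / 4\<close> each.\<close>

theorem comb_is_ids:
  fixes G :: "((int ^ 'd::finite) \<times> int) pair_pre_digraph"
  assumes G: "G = comb_graph"
  shows "is_ids UNIV comb_box (hamiltonian G) (path_ids (adj_norm G))"
  unfolding is_ids_def
proof (intro conjI allI impI)
  let ?H = "hamiltonian G" and ?N = "path_ids (adj_norm G)"
  let ?W = "\<lambda>n. comb_box n :: ((int ^ 'd) \<times> int) set"
  show "sets ?N = sets borel"
    by (simp add: path_ids_def)
  fix \<phi> :: "real \<Rightarrow> complex" assume \<phi>: "continuous_on UNIV \<phi>"
  show "integrable ?N \<phi>"
    by (rule path_ids_integral(1)[OF \<phi>])
  have H: "bounded_operator UNIV ?H" "self_adjoint UNIV ?H"
    using comb.bounded_operator_hamiltonian[OF comb.adj_bounded]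
      comb.hamiltonian_self_adjoint[OF comb.adj_bounded] by (auto simp: G)
  obtain M where M: "\<And>t. complex_of_real t \<in> spectrum UNIV ?H \<Longrightarrow> \<bar>t\<bar> \<le> M"
    using spectrum_bounded[OF H(1)] by blast
  \<comment> \<open>One interval contains both the real points of the spectrum, for the operator
    error, and all values \<open>adj_norm G - 2 * cos (pi * u)\<close>, for the integral error, so
    that the same polynomial serves for both.\<close>
  define R where "R = max M (\<bar>adj_norm G\<bar> + 2)"
  obtain P where P: "uniform_limit {-R..R} (\<lambda>k t. poly (P k) (complex_of_real t)) \<phi> sequentially"
    using complex_polynomial_uniform_limit[OF continuous_on_subset[OF \<phi>]] by blast
  have "{t. complex_of_real t \<in> spectrum UNIV ?H} \<subseteq> {-R..R}"
    using M by (fastforce simp: R_def)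
  then have P': "uniform_limit {t. complex_of_real t \<in> spectrum UNIV ?H}
      (\<lambda>k t. poly (P k) (complex_of_real t)) \<phi> sequentially"
    by (rule uniform_limit_on_subset[OF P])
  define S where "S = fun_calc UNIV \<phi> ?H"
  have S: "bounded_operator UNIV S"
    "(\<lambda>k. op_norm UNIV (\<lambda>f x. poly_op (P k) ?H f x - S f x)) \<longlonglongrightarrow> 0"
    unfolding S_def by (rule fun_calc_approximation[OF H UNIV_not_empty P'])+
  show "(\<lambda>n. trace_op UNIV (fun_calc UNIV \<phi> ?H \<circ> proj (?W n)) / of_nat (card (?W n))) \<longlonglongrightarrow> integral\<^sup>L ?N \<phi>"
    unfolding S_def[symmetric] trace_op_comp_proj[OF finite_comb_box S(1)]
  proof (rule LIMSEQ_I)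
    fix e :: real assume "e > 0"
    then have e: "e / 4 > 0"
      by simp
    have "\<forall>\<^sub>F k in sequentially. op_norm UNIV (\<lambda>f x. poly_op (P k) ?H f x - S f x) < e / 4"
      using order_tendstoD(2)[OF S(2) e] .
    moreover have "\<forall>\<^sub>F k in sequentially. \<forall>t\<in>{-R..R}. dist (poly (P k) (complex_of_real t)) (\<phi> t) < e / 4"
      by (rule uniform_limitD[OF P e])
    ultimately have "\<forall>\<^sub>F k in sequentially. op_norm UNIV (\<lambda>f x. poly_op (P k) ?H f x - S f x) < e / 4 \<and>
        (\<forall>t\<in>{-R..R}. dist (poly (P k) (complex_of_real t)) (\<phi> t) < e / 4)"
      by (rule eventually_conj)
    then obtain k where k1: "op_norm UNIV (\<lambda>f x. poly_op (P k) ?H f x - S f x) < e / 4"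
      and k2: "\<And>t. t \<in> {-R..R} \<Longrightarrow> dist (poly (P k) (complex_of_real t)) (\<phi> t) < e / 4"
      by (auto dest: eventually_happens)
    let ?p = "\<lambda>t. poly (P k) (complex_of_real t)"
    have cont: "continuous_on UNIV ?p"
      by (intro continuous_intros)
    have I: "cmod (integral\<^sup>L ?N ?p - integral\<^sup>L ?N \<phi>) \<le> e / 4"
    proof -
      let ?t = "\<lambda>u. adj_norm G - 2 * cos (pi * u)"
      have diff: "continuous_on UNIV (\<lambda>t. ?p t - \<phi> t)"
        by (intro continuous_on_diff cont \<phi>)
      have "integral\<^sup>L ?N ?p - integral\<^sup>L ?N \<phi> = integral {0..1} (\<lambda>u. ?p (?t u) - \<phi> (?t u))"
        unfolding path_ids_integral(2)[OF diff, symmetric]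
        by (rule Bochner_Integration.integral_diff[symmetric]) (intro path_ids_integral(1) cont \<phi>)+
      also have "norm \<dots> \<le> e / 4 * (1 - 0)"
      proof (rule integral_bound)
        show "continuous_on {0..1} (\<lambda>u. ?p (?t u) - \<phi> (?t u))"
          by (intro continuous_on_compose2[OF diff] continuous_intros) auto
        show "norm (?p (?t u) - \<phi> (?t u)) \<le> e / 4" for u
        proof -
          have "\<bar>adj_norm G\<bar> + 2 \<le> R"
            by (simp add: R_def)
          then have "- R \<le> ?t u" "?t u \<le> R"
            using cos_le_one[of "pi * u"] cos_ge_minus_one[of "pi * u"] by linarith+
          then have "?t u \<in> {-R..R}"
            by simp
          from k2[OF this] show ?thesis
            unfolding dist_norm by (rule less_imp_le)
        qed
      qed simp
      finally show ?thesis
        by simp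
    qed
    let ?b = "\<lambda>n. (\<Sum>x\<in>?W n. poly_op (P k) ?H (indicator {x}) x) / of_nat (card (?W n))"
    obtain n0 where n0: "\<And>n. n \<ge> n0 \<Longrightarrow> cmod (?b n - integral\<^sup>L ?N ?p) < e / 4"
      using LIMSEQ_D[OF comb_poly_trace_tendsto[OF G] e] by blast
    have ab: "cmod ((\<Sum>x\<in>?W n. S (indicator {x}) x) / of_nat (card (?W n)) - ?b n) \<le> e / 4" for n
    proof -
      have R: "bounded_operator UNIV (\<lambda>f x. poly_op (P k) ?H f x - S f x)"
        by (intro bounded_operator_minus bounded_operator_poly H S)
      have "cmod (S (indicator {x}) x - poly_op (P k) ?H (indicator {x}) x) \<le> e / 4" for x
      proof -
        have x: "indicator {x} \<in> ell2 UNIV"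
          by (simp add: ell2_indicator)
        have "cmod (poly_op (P k) ?H (indicator {x}) x - S (indicator {x}) x)
            \<le> ell2_norm (\<lambda>y. poly_op (P k) ?H (indicator {x}) y - S (indicator {x}) y)"
          by (rule cmod_le_ell2_norm[OF bounded_operatorD(1)[OF R x]])
        also have "\<dots> \<le> op_norm UNIV (\<lambda>f x. poly_op (P k) ?H f x - S f x)"
          by (rule bounded_operator_op_norm[OF R x]) simp
        finally show ?thesis
          using k1 by (simp add: norm_minus_commute)
      qed
      then have "cmod (\<Sum>x\<in>?W n. S (indicator {x}) x - poly_op (P k) ?H (indicator {x}) x) \<le> real (card (?W n)) * (e / 4)"
        by (rule sum_norm_bound)
      then show ?thesis
        unfolding diff_divide_distrib[symmetric] sum_subtractf[symmetric] norm_divide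
        using comb_box_nonempty[of n, where 'a = 'd] finite_comb_box[of n, where 'a = 'd] card_gt_0_iff[of "?W n"]
        by (subst pos_divide_le_eq) (auto simp: mult.commute)
    qed
    show "\<exists>n0. \<forall>n\<ge>n0. norm ((\<Sum>x\<in>?W n. S (indicator {x}) x) / of_nat (card (?W n)) - integral\<^sup>L ?N \<phi>) < e"
    proof (intro exI allI impI)
      fix n assume "n \<ge> n0"
      let ?a = "(\<Sum>x\<in>?W n. S (indicator {x}) x) / of_nat (card (?W n))"
      have "cmod (?a - integral\<^sup>L ?N \<phi>)
          \<le> cmod (?a - ?b n) + cmod (?b n - integral\<^sup>L ?N ?p) + cmod (integral\<^sup>L ?N ?p - integral\<^sup>L ?N \<phi>)"
        by (rule order_trans[OF _ add_right_mono[OF norm_triangle_ineq]])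
          (use norm_triangle_ineq[of "?a - integral\<^sup>L ?N ?p" "integral\<^sup>L ?N ?p - integral\<^sup>L ?N \<phi>"] in simp)
      then show "norm (?a - integral\<^sup>L ?N \<phi>) < e"
        using ab[of n] n0[OF \<open>n \<ge> n0\<close>] I \<open>e > 0\<close> by linarith
    qed
  qed
qed

text \<open>Testing with the constant \<open>1\<close> makes \<open>N'\<close> a probability measure
  as well, and testing with complex exponentials identifies the characteristic functions; Levy's
  theorem then identifies the measures.\<close>

lemma is_ids_unique:
  assumes N: "is_ids V W H N" "prob_space N" and N': "is_ids V W H N'"
  shows "N' = N"
proof -
  have eq: "integral\<^sup>L N' \<phi> = integral\<^sup>L N \<phi>" if "continuous_on UNIV \<phi>" for \<phi> :: "real \<Rightarrow> complex"
    using N(1) N' that LIMSEQ_unique unfolding is_ids_def by blast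
  interpret N: prob_space N
    by (rule N(2))
  have sets: "sets N = sets borel" "sets N' = sets borel"
    using N N' by (auto simp: is_ids_def)
  have "prob_space N'"
  proof -
    have "integrable N' (\<lambda>x. 1 :: complex)"
      using N' by (simp add: is_ids_def)
    then interpret N': finite_measure N'
      by (intro finite_measureI) (simp add: integrable_iff_bounded)
    have "integral\<^sup>L N' (\<lambda>x. 1 :: complex) = integral\<^sup>L N (\<lambda>x. 1)"
      by (rule eq) simp
    then have "measure N' (space N') = 1"
      by (simp add: N.prob_space scaleR_conv_of_real)
    then show ?thesis
      by (intro prob_spaceI) (simp add: N'.emeasure_eq_measure)
  qed
  then have "real_distribution N" "real_distribution N'"
    using N(2) sets sets_eq_imp_space_eq[OF sets(1)] sets_eq_imp_space_eq[OF sets(2)]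
    by (auto simp: real_distribution_def real_distribution_axioms_def)
  moreover have "char N' = char N"
  proof
    fix t
    show "char N' t = char N t"
      unfolding char_def by (rule eq) (intro continuous_intros)
  qed
  ultimately show ?thesis
    using Levy_uniqueness by blast
qed

lemma comb_ex1_ids:
  fixes G :: "((int ^ 'd::finite) \<times> int) pair_pre_digraph"
  assumes "G = comb_graph"
  shows "\<exists>!N. is_ids UNIV comb_box (hamiltonian G) N"
    and "ids UNIV comb_box (hamiltonian G) = path_ids (adj_norm G)"
proof -
  let ?N = "path_ids (adj_norm G)"
  have *: "is_ids UNIV comb_box (hamiltonian G) ?N"
    by (rule comb_is_ids[OF assms])
  have **: "N = ?N" if "is_ids UNIV comb_box (hamiltonian G) N" for N
    by (rule is_ids_unique[OF * prob_space_path_ids that])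
  show "\<exists>!N. is_ids UNIV comb_box (hamiltonian G) N"
    using * ** by (rule ex1I)
  show "ids UNIV comb_box (hamiltonian G) = ?N"
    unfolding ids_def using * ** by (rule the_equality)
qed

lemma comb_min_spectrum_tendsto:
  fixes G :: "((int ^ 'd::finite) \<times> int) pair_pre_digraph"
  assumes G: "G = comb_graph"
  shows "(\<lambda>n. min_spectrum (comb_box n) (compression (comb_box n) (hamiltonian G))) \<longlonglongrightarrow> 0"
proof -
  let ?d = "real CARD('d)"
  have "(\<lambda>n. adj_norm G - (box_decay ?d n + 1 / box_decay ?d n)) \<longlonglongrightarrow> adj_norm G - 2 * sqrt (?d\<^sup>2 + 1)"
    by (intro tendsto_intros box_decay_tendsto(2)) (simp add: Suc_leI)
  then have "(\<lambda>n. adj_norm G - (box_decay ?d n + 1 / box_decay ?d n)) \<longlonglongrightarrow> 0"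
    by (simp add: G adj_norm_comb_graph)
  moreover have "\<forall>\<^sub>F n in sequentially. adj_norm G - (box_decay ?d n + 1 / box_decay ?d n)
      = min_spectrum (comb_box n) (compression (comb_box n) (hamiltonian G))"
    using eventually_ge_at_top[of 1]
  proof eventually_elim
    case (elim n)
    let ?L = "induced comb_graph (comb_box n :: ((int ^ 'd) \<times> int) set)"
    note pf = comb_box_eigen.perron_frobenius_box[OF comb_box_eigen_box_decay[OF elim, where 'd = 'd]]
    have V: "pverts ?L = comb_box n"
      by (simp add: induced_def)
    have "min_spectrum (comb_box n) (compression (comb_box n) (hamiltonian G)) = adj_norm G - adj_norm ?L"
      unfolding G by (rule comb.min_spectrum_compression_hamiltonian[OF _ _ _ pf(2)])
        (use finite_comb_box comb_box_nonempty[of n] V in auto)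
    then show ?case
      by (simp add: pf(1))
  qed
  ultimately show ?thesis
    by (rule Lim_transform_eventually)
qed

text \<open>Convergence and unique existence are part of the conclusion because \<open>E_0\<close>
  and \<open>ids\<close> are defined by \<open>lim\<close> and \<open>THE\<close>. A
  Perron-Frobenius vector is determined only up to scale, hence the normalisation at the origin. The
  limit is asserted for every choice of normalised vectors, and the preceding conjunct shows that a
  choice exists.\<close>

theorem proposition9p2:
  fixes G :: "((int ^ 'd::finite) \<times> int) pair_pre_digraph"
    and L :: "nat \<Rightarrow> ((int ^ 'd) \<times> int) pair_pre_digraph"
    and d :: real
    and v :: "(int ^ 'd) \<times> int \<Rightarrow> real"
  assumes d: "d = real CARD('d)"
    and G: "G = comb_product lattice_graph int_graph 0"
    and L: "\<And>n. L n = comb_product (lattice_box n) (int_path n) 0"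
    and v: "\<And>g h. v (g, h) = (sqrt (d\<^sup>2 + 1) - d) ^ nat \<bar>h\<bar>"
  shows "convergent (\<lambda>n. min_spectrum (pverts (L n)) (compression (pverts (L n)) (hamiltonian G)))
    \<and> (\<exists>!N. is_ids (pverts G) (\<lambda>n. pverts (L n)) (hamiltonian G) N)
    \<and> low_energy_hidden_spectrum G L
    \<and> adj_norm G = 2 * sqrt (d\<^sup>2 + 1)
    \<and> (\<forall>n. \<exists>w. perron_frobenius (L n) w \<and> w (0, 0) = 1)
    \<and> (\<forall>w. (\<forall>n. perron_frobenius (L n) (w n) \<and> w n (0, 0) = 1)
          \<longrightarrow> (\<forall>x. (\<lambda>n. w n x) \<longlonglongrightarrow> v x))
    \<and> perron_frobenius G v"
proof (intro conjI allI impI)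
  have G': "G = comb_graph"
    by (simp add: G comb_graph_def)
  have L': "L n = induced comb_graph (comb_box n)" for n
    by (simp add: L comb_product_boxes)
  have V: "pverts G = UNIV" "(\<lambda>n. pverts (L n)) = comb_box" "\<And>n. pverts (L n) = comb_box n"
    by (auto simp: G' L' induced_def)
  have d1: "d \<ge> 1"
    by (simp add: d Suc_leI)
  have v': "v = (\<lambda>(g, h). comb_decay d ^ nat \<bar>h\<bar>)"
    by (auto simp: v comb_decay_def)
  show norm: "adj_norm G = 2 * sqrt (d\<^sup>2 + 1)"
    unfolding G' d by (rule adj_norm_comb_graph)
  show "perron_frobenius G v"
    unfolding v' G' d by (rule perron_frobenius_comb_graph)
  note lim = comb_min_spectrum_tendsto[OF G']
  show "convergent (\<lambda>n. min_spectrum (pverts (L n)) (compression (pverts (L n)) (hamiltonian G)))"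
    unfolding V using lim by (rule convergentI)
  show "\<exists>!N. is_ids (pverts G) (\<lambda>n. pverts (L n)) (hamiltonian G) N"
    unfolding V by (rule comb_ex1_ids(1)[OF G'])
  show "low_energy_hidden_spectrum G L"
  proof -
    have "2 < adj_norm G"
      unfolding norm using d1 by (simp add: real_less_rsqrt)
    also have "E_0 comb_box (hamiltonian G) = 0"
      unfolding E_0_def by (rule limI[OF lim])
    moreover have "adj_norm G - 2 \<le> E_m UNIV comb_box (hamiltonian G)"
      unfolding E_m_def comb_ex1_ids(2)[OF G']
      using measure_support_path_ids by (intro cInf_greatest) auto
    ultimately show ?thesis
      unfolding low_energy_hidden_spectrum_def V by linarith
  qed
  note box = comb_box_eigen_box_decay[where 'd = 'd, folded d]
  show "\<exists>w. perron_frobenius (L n) w \<and> w (0, 0) = 1" for n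
  proof (cases "n \<ge> 1")
    case True
    then show ?thesis
      unfolding L' using comb_box_eigen.perron_frobenius_box(2)[OF box] comb_box_eigen.w_origin[OF box] by blast
  next
    case False
    then have "n = 0"
      by simp
    then show ?thesis
      unfolding L' using perron_frobenius_box_0 by (intro exI[of _ "\<lambda>x. 1"]) simp
  qed
  fix w :: "nat \<Rightarrow> (int ^ 'd) \<times> int \<Rightarrow> real" and x :: "(int ^ 'd) \<times> int"
  assume w: "\<forall>n. perron_frobenius (L n) (w n) \<and> w n (0, 0) = 1"
  obtain g h where x: "x = (g, h)"
    by (cases x)
  define M where "M = Max (insert \<bar>h\<bar> (range (\<lambda>i. \<bar>g $ i\<bar>)))"
  \<comment> \<open>From index \<open>K\<close> on, the box contains \<open>x\<close>, so that
    uniqueness applies at \<open>x\<close>, and \<open>n \<ge> 1\<close>, so that the explicit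
    vector is available.\<close>
  define K where "K = max 1 (nat M)"
  have x_box: "x \<in> comb_box n" if "n \<ge> K" for n
  proof -
    have Mn: "M \<le> int n"
      using that unfolding K_def by linarith
    have My: "y \<le> M" if "y \<in> insert \<bar>h\<bar> (range (\<lambda>i. \<bar>g $ i\<bar>))" for y
      unfolding M_def by (rule Max_ge[OF _ that]) simp
    have "y \<le> int n" if "y \<in> insert \<bar>h\<bar> (range (\<lambda>i. \<bar>g $ i\<bar>))" for y
      using My[OF that] Mn by (rule order_trans)
    then show ?thesis
      by (simp add: x comb_box_iff)
  qed
  have eq: "box_pf n (box_decay d n) x = w n x" if "n \<ge> K" for n
  proof -
    have n: "n \<ge> 1"
      using that by (simp add: K_def)
    have "perron_frobenius (induced comb_graph (comb_box n)) (w n)"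
      and "box_pf n (box_decay d n) (0 :: int ^ 'd, 0) = w n (0, 0)"
      using w comb_box_eigen.w_origin[OF box[OF n]] by (simp_all add: L')
    then show ?thesis
      by (rule perron_frobenius_box_unique[OF comb_box_eigen.perron_frobenius_box(2)[OF box[OF n]] _ _ x_box[OF that]])
  qed
  have "(\<lambda>n. box_pf n (box_decay d n) x) \<longlonglongrightarrow> v x"
    unfolding x v' prod.case by (rule box_pf_tendsto[OF d1])
  moreover have "\<forall>\<^sub>F n in sequentially. box_pf n (box_decay d n) x = w n x"
    using eventually_ge_at_top[of K] by eventually_elim (rule eq)
  ultimately show "(\<lambda>n. w n x) \<longlonglongrightarrow> v x"
    by (rule Lim_transform_eventually)
qed

end
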